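(* Let $n=6$, so that $\dim V=12$, and let $E=C^2\oplus sl(2,k)\oplus (S_1\otimes k^2)$, a $k$-vector space of dimension $133$. Let $[\ ,\ ]:E\times E\to E$ be the unique antisymmetric bilinear map such that: $C^2$ and $sl(2,k)$ carry their commutator brackets and commute with each other; $[A,\psi\otimes u]=(A\cdot\psi)\otimes u$ for $A\in C^2$ and $[X,\psi\otimes u]=\psi\otimes Xu$ for $X\in sl(2,k)$ ($\psi\in S_1$, $u\in k^2$); and $$[\phi\otimes u,\psi\otimes w]=\omega(u,w)\,\tilde L_2(\phi,\psi)+B(\phi,\psi)\,\sigma(u,w)\qquad(\phi,\psi\in S_1,\ u,w\in k^2).$$ Then $(E,[\ ,\ ])$ is a simple Lie algebra.
   Context: $k$ is a field of characteristic not $2$ or $3$; $V$ is a $2n$-dimensional $k$-vector space with a nondegenerate symmetric bilinear form $g$ of Witt index $n$ (hyperbolic). $C=C(V,g)$ is the Clifford algebra, $vw+wv=2g(v,w)1$ for $v,w\in V\subset C$, with its usual ${\mathbb Z}_2$-grading $C=C_+\oplus C_-$. $S$ is a fixed $2^n$-dimensional $k$-vector space (spinors) with an algebra isomorphism $C\cong End(S)$; $c\cdot\psi$ denotes the action of $c\in C$ on $\psi\in S$. $S=S_1\oplus S_2$ is the decomposition into half-spinor spaces: each $S_i$ has dimension $2^{n-1}$, $C_+$ preserves $S_1$ and $S_2$, and $C_-$ interchanges them. A spinor norm is a bilinear map $B:S\times S\to k$ with $B(v\cdot\phi,\psi)=B(\phi,v\cdot\psi)$ for all $v\in V$, $\phi,\psi\in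 S$; a nondegenerate spinor norm $B$ is fixed; for $n=6$ it is antisymmetric and $B(S_1,S_2)=0$. An orthonormal basis of $V$ is a basis $x_1,\dots,x_{2n}$ with $g(x_i,x_j)=\pm\delta_{ij}$. $C^2\subset C$ is the span of the products $x_ix_j$, $i<j$ (independent of the choice of orthonormal basis); it is a Lie algebra under commutator, isomorphic to $\mathfrak{so}(V,g)$. The map $\tilde L_2:S\times S\to C^2$ is $\tilde L_2(\phi,\psi)=\frac12\sum_{i<j}g(x_i,x_i)g(x_j,x_j)B(\phi,x_jx_i\cdot\psi)\,x_ix_j$ for any orthonormal basis (independent of the choice); for $n=6$ it is symmetric. $\omega$ is the standard symplectic form on $k^2$, $\omega(u,w)=u_1w_2-u_2w_1$, and for $u,w\in k^2$ the endomorphism $\sigma(u,w)\in sl(2,k)$ is $\sigma(u,w)x=\omega(u,x)w+\omega(w,x)u$. *)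

theory Defs
  imports "HOL-Analysis.Analysis" "HOL-Library.Poly_Mapping"
begin

text \<open>Vector spaces over a field \<open>'k\<close> are given by a scalar multiplication on an additive group
  type, as in \<^theory>\<open>HOL.Vector_Spaces\<close>.\<close>

section \<open>Hyperbolic spaces\<close>

definition bilinear_form :: "('k::field \<Rightarrow> 'v::ab_group_add \<Rightarrow> 'v) \<Rightarrow> ('v \<Rightarrow> 'v \<Rightarrow> 'k) \<Rightarrow> bool" where
  "bilinear_form s b \<longleftrightarrow>
     (\<forall>v. Vector_Spaces.linear s (*) (b v)) \<and> (\<forall>w. Vector_Spaces.linear s (*) (\<lambda>v. b v w))"

definition nondegenerate :: "('v::zero \<Rightarrow> 'v \<Rightarrow> 'k::zero) \<Rightarrow> bool" where
  "nondegenerate b \<longleftrightarrow>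
     (\<forall>v. (\<forall>w. b v w = 0) \<longrightarrow> v = 0) \<and> (\<forall>w. (\<forall>v. b v w = 0) \<longrightarrow> w = 0)"

definition totally_isotropic ::
  "('k::field \<Rightarrow> 'v::ab_group_add \<Rightarrow> 'v) \<Rightarrow> ('v \<Rightarrow> 'v \<Rightarrow> 'k) \<Rightarrow> 'v set \<Rightarrow> bool" where
  "totally_isotropic s g U \<longleftrightarrow> module.subspace s U \<and> (\<forall>v\<in>U. \<forall>w\<in>U. g v w = 0)"

definition witt_index ::
  "('k::field \<Rightarrow> 'v::ab_group_add \<Rightarrow> 'v) \<Rightarrow> ('v \<Rightarrow> 'v \<Rightarrow> 'k) \<Rightarrow> nat" where
  "witt_index s g = Max {vector_space.dim s U | U. totally_isotropic s g U}"

text \<open>\<open>vector_space.dim\<close> is 0 for infinite-dimensional spaces, so for \<open>n > 0\<close> the second condition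
  includes finite-dimensionality.\<close>

definition hyperbolic_space ::
  "nat \<Rightarrow> ('k::field \<Rightarrow> 'v::ab_group_add \<Rightarrow> 'v) \<Rightarrow> ('v \<Rightarrow> 'v \<Rightarrow> 'k) \<Rightarrow> bool" where
  "hyperbolic_space n s g \<longleftrightarrow>
     vector_space s \<and> vector_space.dim s UNIV = 2 * n \<and>
     bilinear_form s g \<and> (\<forall>v w. g v w = g w v) \<and> nondegenerate g \<and> witt_index s g = n"

definition orthonormal_basis ::
  "nat \<Rightarrow> ('k::field \<Rightarrow> 'v::ab_group_add \<Rightarrow> 'v) \<Rightarrow> ('v \<Rightarrow> 'v \<Rightarrow> 'k) \<Rightarrow> (nat \<Rightarrow> 'v) \<Rightarrow> bool" where
  "orthonormal_basis n s g x \<longleftrightarrow>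
     inj_on x {..<2 * n} \<and> \<not> module.dependent s (x ` {..<2 * n}) \<and>
     module.span s (x ` {..<2 * n}) = UNIV \<and>
     (\<forall>i<2 * n. \<forall>j<2 * n. if i = j then g (x i) (x j) \<in> {1, - 1} else g (x i) (x j) = 0)"

section \<open>Presentations by generators and relations\<close>

text \<open>The free vector space on \<open>'a\<close> is the type of finitely supported functions \<open>'a \<Rightarrow>\<^sub>0 'k\<close>.\<close>

definition free_scale :: "'k::field \<Rightarrow> ('a \<Rightarrow>\<^sub>0 'k) \<Rightarrow> ('a \<Rightarrow>\<^sub>0 'k)" where
  "free_scale c f = Poly_Mapping.map ((*) c) f"

definition linear_extension ::
  "('k::field \<Rightarrow> 'm::ab_group_add \<Rightarrow> 'm) \<Rightarrow> ('a \<Rightarrow> 'm) \<Rightarrow> ('a \<Rightarrow>\<^sub>0 'k) \<Rightarrow> 'm" where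
  "linear_extension s b f = (\<Sum>a\<in>Poly_Mapping.keys f. s (Poly_Mapping.lookup f a) (b a))"

lemma lookup_free_scale [simp]:
  "Poly_Mapping.lookup (free_scale c f) a = c * Poly_Mapping.lookup f a"
  by (simp add: free_scale_def Poly_Mapping.map.rep_eq when_def)

lemma vector_space_free_scale: "vector_space (free_scale :: 'k::field \<Rightarrow> ('a \<Rightarrow>\<^sub>0 'k) \<Rightarrow> _)"
  by unfold_locales (auto intro!: poly_mapping_eqI simp: lookup_add algebra_simps)

text \<open>\<open>(M, b)\<close> is the quotient of the free vector space on \<open>A\<close> by the span of \<open>R\<close>.\<close>

definition presented_by ::
  "('k::field \<Rightarrow> 'm::ab_group_add \<Rightarrow> 'm) \<Rightarrow> ('a \<Rightarrow> 'm) \<Rightarrow> 'a set \<Rightarrow> ('a \<Rightarrow>\<^sub>0 'k) set \<Rightarrow> bool" where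
  "presented_by s b A R \<longleftrightarrow>
     vector_space s \<and>
     linear_extension s b ` {f. Poly_Mapping.keys f \<subseteq> A} = UNIV \<and>
     {f. Poly_Mapping.keys f \<subseteq> A \<and> linear_extension s b f = 0} = module.span free_scale R"

section \<open>The Clifford algebra and its spinors\<close>

definition k_algebra :: "('k::field \<Rightarrow> 'c::ring_1 \<Rightarrow> 'c) \<Rightarrow> bool" where
  "k_algebra s \<longleftrightarrow>
     vector_space s \<and> (\<forall>a x y. s a x * y = s a (x * y) \<and> x * s a y = s a (x * y))"

text \<open>The words (lists) in elements of \<open>V\<close> form a basis of the free associative algebra on the set
  \<open>V\<close>, with concatenation as product. The relations below, taken together, span the two-sided ideal
  generated by those making the generators linear in \<open>v \<in> V\<close> (the quotient by these is the tensor
  algebra of \<open>V\<close>) and by \<open>v w + w v - 2 g(v,w) 1\<close>.\<close>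

definition clifford_relations ::
  "('k::field \<Rightarrow> 'v::ab_group_add \<Rightarrow> 'v) \<Rightarrow> ('v \<Rightarrow> 'v \<Rightarrow> 'k) \<Rightarrow> ('v list \<Rightarrow>\<^sub>0 'k) set" where
  "clifford_relations s g =
     {Poly_Mapping.single (p @ [v + w] @ q) 1 - Poly_Mapping.single (p @ [v] @ q) 1
        - Poly_Mapping.single (p @ [w] @ q) 1 | p q v w. True} \<union>
     {Poly_Mapping.single (p @ [s a v] @ q) 1 - Poly_Mapping.single (p @ [v] @ q) a | p q a v. True} \<union>
     {Poly_Mapping.single (p @ [v, w] @ q) 1 + Poly_Mapping.single (p @ [w, v] @ q) 1
        - Poly_Mapping.single (p @ q) (2 * g v w) | p q v w. True}"

definition is_clifford_algebra ::
  "('k::field \<Rightarrow> 'v::ab_group_add \<Rightarrow> 'v) \<Rightarrow> ('v \<Rightarrow> 'v \<Rightarrow> 'k) \<Rightarrow>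
   ('k \<Rightarrow> 'c::ring_1 \<Rightarrow> 'c) \<Rightarrow> ('v \<Rightarrow> 'c) \<Rightarrow> bool" where
  "is_clifford_algebra sV g sC \<iota> \<longleftrightarrow>
     k_algebra sC \<and>
     presented_by sC (\<lambda>w. prod_list (map \<iota> w)) UNIV (clifford_relations sV g)"

definition clifford_even :: "('k::field \<Rightarrow> 'c::ring_1 \<Rightarrow> 'c) \<Rightarrow> ('v \<Rightarrow> 'c) \<Rightarrow> 'c set" where
  "clifford_even sC \<iota> = module.span sC {prod_list (map \<iota> w) | w. even (length w)}"

definition clifford_odd :: "('k::field \<Rightarrow> 'c::ring_1 \<Rightarrow> 'c) \<Rightarrow> ('v \<Rightarrow> 'c) \<Rightarrow> 'c set" where
  "clifford_odd sC \<iota> = module.span sC {prod_list (map \<iota> w) | w. odd (length w)}"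

text \<open>\<open>\<rho>\<close> is an isomorphism of algebras from \<open>C\<close> onto \<open>End(S)\<close>.\<close>

definition algebra_iso_End ::
  "('k::field \<Rightarrow> 'c::ring_1 \<Rightarrow> 'c) \<Rightarrow> ('k \<Rightarrow> 's::ab_group_add \<Rightarrow> 's) \<Rightarrow> ('c \<Rightarrow> 's \<Rightarrow> 's) \<Rightarrow> bool" where
  "algebra_iso_End sC sS \<rho> \<longleftrightarrow>
     bij_betw \<rho> UNIV {f. Vector_Spaces.linear sS sS f} \<and>
     (\<forall>c d \<psi>. \<rho> (c + d) \<psi> = \<rho> c \<psi> + \<rho> d \<psi>) \<and>
     (\<forall>a c \<psi>. \<rho> (sC a c) \<psi> = sS a (\<rho> c \<psi>)) \<and>
     (\<forall>c d. \<rho> (c * d) = \<rho> c \<circ> \<rho> d) \<and> \<rho> 1 = id"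

definition spinor_space ::
  "nat \<Rightarrow> ('k::field \<Rightarrow> 'c::ring_1 \<Rightarrow> 'c) \<Rightarrow> ('k \<Rightarrow> 's::ab_group_add \<Rightarrow> 's) \<Rightarrow> ('c \<Rightarrow> 's \<Rightarrow> 's) \<Rightarrow> bool" where
  "spinor_space n sC sS \<rho> \<longleftrightarrow>
     vector_space sS \<and> vector_space.dim sS UNIV = 2 ^ n \<and> algebra_iso_End sC sS \<rho>"

definition half_spinor_spaces ::
  "nat \<Rightarrow> ('k::field \<Rightarrow> 'c::ring_1 \<Rightarrow> 'c) \<Rightarrow> ('v \<Rightarrow> 'c) \<Rightarrow> ('k \<Rightarrow> 's::ab_group_add \<Rightarrow> 's) \<Rightarrow>
   ('c \<Rightarrow> 's \<Rightarrow> 's) \<Rightarrow> 's set \<Rightarrow> 's set \<Rightarrow> bool" where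
  "half_spinor_spaces n sC \<iota> sS \<rho> S1 S2 \<longleftrightarrow>
     module.subspace sS S1 \<and> module.subspace sS S2 \<and>
     S1 \<inter> S2 = {0} \<and> {\<phi> + \<psi> | \<phi> \<psi>. \<phi> \<in> S1 \<and> \<psi> \<in> S2} = UNIV \<and>
     vector_space.dim sS S1 = 2 ^ (n - 1) \<and> vector_space.dim sS S2 = 2 ^ (n - 1) \<and>
     (\<forall>c\<in>clifford_even sC \<iota>. \<rho> c ` S1 \<subseteq> S1 \<and> \<rho> c ` S2 \<subseteq> S2) \<and>
     (\<forall>c\<in>clifford_odd sC \<iota>. \<rho> c ` S1 \<subseteq> S2 \<and> \<rho> c ` S2 \<subseteq> S1)"

definition spinor_norm ::
  "('v \<Rightarrow> 'c::ring_1) \<Rightarrow> ('k::field \<Rightarrow> 's::ab_group_add \<Rightarrow> 's) \<Rightarrow> ('c \<Rightarrow> 's \<Rightarrow> 's) \<Rightarrow> ('s \<Rightarrow> 's \<Rightarrow> 'k) \<Rightarrow> bool" where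
  "spinor_norm \<iota> sS \<rho> B \<longleftrightarrow>
     bilinear_form sS B \<and> (\<forall>v \<phi> \<psi>. B (\<rho> (\<iota> v) \<phi>) \<psi> = B \<phi> (\<rho> (\<iota> v) \<psi>))"

definition C2 ::
  "nat \<Rightarrow> ('k::field \<Rightarrow> 'c::ring_1 \<Rightarrow> 'c) \<Rightarrow> ('v \<Rightarrow> 'c) \<Rightarrow> (nat \<Rightarrow> 'v) \<Rightarrow> 'c set" where
  "C2 n sC \<iota> x = module.span sC {\<iota> (x i) * \<iota> (x j) | i j. i < j \<and> j < 2 * n}"

definition L2 ::
  "nat \<Rightarrow> ('v \<Rightarrow> 'v \<Rightarrow> 'k) \<Rightarrow> ('k::field \<Rightarrow> 'c::ring_1 \<Rightarrow> 'c) \<Rightarrow> ('v \<Rightarrow> 'c) \<Rightarrow>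
   ('c \<Rightarrow> 's \<Rightarrow> 's) \<Rightarrow> ('s \<Rightarrow> 's \<Rightarrow> 'k) \<Rightarrow> (nat \<Rightarrow> 'v) \<Rightarrow> 's \<Rightarrow> 's \<Rightarrow> 'c" where
  "L2 n g sC \<iota> \<rho> B x \<phi> \<psi> =
     sC (1 / 2) (\<Sum>j<2 * n. \<Sum>i<j.
       sC (g (x i) (x i) * g (x j) (x j) * B \<phi> (\<rho> (\<iota> (x j) * \<iota> (x i)) \<psi>)) (\<iota> (x i) * \<iota> (x j)))"

section \<open>The Lie algebra \<open>sl(2,k)\<close> and tensor products\<close>

definition sl2 :: "('k::field ^ 2 ^ 2) set" where
  "sl2 = {X. trace X = 0}"

definition symp :: "'k::field ^ 2 \<Rightarrow> 'k ^ 2 \<Rightarrow> 'k" where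
  "symp u w = u $ 1 * w $ 2 - u $ 2 * w $ 1"

definition sigma :: "'k::field ^ 2 \<Rightarrow> 'k ^ 2 \<Rightarrow> 'k ^ 2 ^ 2" where
  "sigma u w = matrix (\<lambda>x. symp u x *s w + symp w x *s u)"

definition tensor_relations ::
  "('k::field \<Rightarrow> 'u::ab_group_add \<Rightarrow> 'u) \<Rightarrow> 'u set \<Rightarrow>
   ('k \<Rightarrow> 'w::ab_group_add \<Rightarrow> 'w) \<Rightarrow> 'w set \<Rightarrow> ('u \<times> 'w \<Rightarrow>\<^sub>0 'k) set" where
  "tensor_relations sU U sW W =
     {Poly_Mapping.single (u + u', w) 1 - Poly_Mapping.single (u, w) 1
        - Poly_Mapping.single (u', w) 1 | u u' w. u \<in> U \<and> u' \<in> U \<and> w \<in> W} \<union>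
     {Poly_Mapping.single (u, w + w') 1 - Poly_Mapping.single (u, w) 1
        - Poly_Mapping.single (u, w') 1 | u w w'. u \<in> U \<and> w \<in> W \<and> w' \<in> W} \<union>
     {Poly_Mapping.single (sU a u, w) 1 - Poly_Mapping.single (u, w) a | a u w. u \<in> U \<and> w \<in> W} \<union>
     {Poly_Mapping.single (u, sW a w) 1 - Poly_Mapping.single (u, w) a | a u w. u \<in> U \<and> w \<in> W}"

text \<open>The whole type \<open>'t\<close>, with \<open>tens u w\<close> as \<open>u \<otimes> w\<close>, is the tensor product of the subspaces
  \<open>U\<close> and \<open>W\<close>; values of \<open>tens\<close> outside \<open>U \<times> W\<close> are irrelevant.\<close>

definition is_tensor_product ::
  "('k::field \<Rightarrow> 'u::ab_group_add \<Rightarrow> 'u) \<Rightarrow> 'u set \<Rightarrow> ('k \<Rightarrow> 'w::ab_group_add \<Rightarrow> 'w) \<Rightarrow> 'w set \<Rightarrow>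
   ('k \<Rightarrow> 't::ab_group_add \<Rightarrow> 't) \<Rightarrow> ('u \<Rightarrow> 'w \<Rightarrow> 't) \<Rightarrow> bool" where
  "is_tensor_product sU U sW W sT tens \<longleftrightarrow>
     presented_by sT (\<lambda>(u, w). tens u w) (U \<times> W) (tensor_relations sU U sW W)"

section \<open>Lie algebras\<close>

definition bilinear_on ::
  "('k::field \<Rightarrow> 'e::ab_group_add \<Rightarrow> 'e) \<Rightarrow> 'e set \<Rightarrow> ('e \<Rightarrow> 'e \<Rightarrow> 'e) \<Rightarrow> bool" where
  "bilinear_on s L br \<longleftrightarrow>
     (\<forall>x\<in>L. \<forall>y\<in>L. br x y \<in> L) \<and>
     (\<forall>x\<in>L. \<forall>y\<in>L. \<forall>z\<in>L. br (x + y) z = br x z + br y z \<and> br z (x + y) = br z x + br z y) \<and>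
     (\<forall>a. \<forall>x\<in>L. \<forall>y\<in>L. br (s a x) y = s a (br x y) \<and> br x (s a y) = s a (br x y))"

definition lie_algebra ::
  "('k::field \<Rightarrow> 'e::ab_group_add \<Rightarrow> 'e) \<Rightarrow> 'e set \<Rightarrow> ('e \<Rightarrow> 'e \<Rightarrow> 'e) \<Rightarrow> bool" where
  "lie_algebra s L br \<longleftrightarrow>
     vector_space s \<and> module.subspace s L \<and> bilinear_on s L br \<and>
     (\<forall>x\<in>L. br x x = 0) \<and>
     (\<forall>x\<in>L. \<forall>y\<in>L. \<forall>z\<in>L. br x (br y z) + br y (br z x) + br z (br x y) = 0)"

definition lie_ideal ::
  "('k::field \<Rightarrow> 'e::ab_group_add \<Rightarrow> 'e) \<Rightarrow> 'e set \<Rightarrow> ('e \<Rightarrow> 'e \<Rightarrow> 'e) \<Rightarrow> 'e set \<Rightarrow> bool" where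
  "lie_ideal s L br I \<longleftrightarrow> module.subspace s I \<and> I \<subseteq> L \<and> (\<forall>x\<in>L. \<forall>y\<in>I. br x y \<in> I)"

definition simple_lie_algebra ::
  "('k::field \<Rightarrow> 'e::ab_group_add \<Rightarrow> 'e) \<Rightarrow> 'e set \<Rightarrow> ('e \<Rightarrow> 'e \<Rightarrow> 'e) \<Rightarrow> bool" where
  "simple_lie_algebra s L br \<longleftrightarrow>
     lie_algebra s L br \<and> (\<exists>x\<in>L. \<exists>y\<in>L. br x y \<noteq> 0) \<and>
     (\<forall>I. lie_ideal s L br I \<longrightarrow> I = {0} \<or> I = L)"

section \<open>The space \<open>E\<close> and its bracket\<close>

definition E_scale ::
  "('k::field \<Rightarrow> 'c \<Rightarrow> 'c) \<Rightarrow> ('k \<Rightarrow> 't \<Rightarrow> 't) \<Rightarrow> 'k \<Rightarrow> 'c \<times> ('k ^ 2 ^ 2) \<times> 't \<Rightarrow> 'c \<times> ('k ^ 2 ^ 2) \<times> 't" where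
  "E_scale sC sT a = (\<lambda>(A, X, t). (sC a A, map_matrix ((*) a) X, sT a t))"

definition E_space ::
  "nat \<Rightarrow> ('k::field \<Rightarrow> 'c::ring_1 \<Rightarrow> 'c) \<Rightarrow> ('v \<Rightarrow> 'c) \<Rightarrow> (nat \<Rightarrow> 'v) \<Rightarrow> ('c \<times> ('k ^ 2 ^ 2) \<times> 't) set" where
  "E_space n sC \<iota> x = C2 n sC \<iota> x \<times> sl2 \<times> UNIV"

definition is_E_bracket ::
  "nat \<Rightarrow> ('v \<Rightarrow> 'v \<Rightarrow> 'k) \<Rightarrow> ('k::field \<Rightarrow> 'c::ring_1 \<Rightarrow> 'c) \<Rightarrow> ('v \<Rightarrow> 'c) \<Rightarrow>
   ('c \<Rightarrow> 's \<Rightarrow> 's) \<Rightarrow> 's set \<Rightarrow> ('s \<Rightarrow> 's \<Rightarrow> 'k) \<Rightarrow> (nat \<Rightarrow> 'v) \<Rightarrow>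
   ('k \<Rightarrow> 't::ab_group_add \<Rightarrow> 't) \<Rightarrow> ('s \<Rightarrow> 'k ^ 2 \<Rightarrow> 't) \<Rightarrow>
   ('c \<times> ('k ^ 2 ^ 2) \<times> 't \<Rightarrow> 'c \<times> ('k ^ 2 ^ 2) \<times> 't \<Rightarrow> 'c \<times> ('k ^ 2 ^ 2) \<times> 't) \<Rightarrow> bool" where
  "is_E_bracket n g sC \<iota> \<rho> S1 B x sT tens br \<longleftrightarrow>
     bilinear_on (E_scale sC sT) (E_space n sC \<iota> x) br \<and>
     (\<forall>y\<in>E_space n sC \<iota> x. \<forall>z\<in>E_space n sC \<iota> x. br y z = - br z y) \<and>
     (\<forall>A\<in>C2 n sC \<iota> x. \<forall>A'\<in>C2 n sC \<iota> x. br (A, 0, 0) (A', 0, 0) = (A * A' - A' * A, 0, 0)) \<and>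
     (\<forall>X\<in>sl2. \<forall>Y\<in>sl2. br (0, X, 0) (0, Y, 0) = (0, X ** Y - Y ** X, 0)) \<and>
     (\<forall>A\<in>C2 n sC \<iota> x. \<forall>X\<in>sl2. br (A, 0, 0) (0, X, 0) = 0) \<and>
     (\<forall>A\<in>C2 n sC \<iota> x. \<forall>\<psi>\<in>S1. \<forall>u. br (A, 0, 0) (0, 0, tens \<psi> u) = (0, 0, tens (\<rho> A \<psi>) u)) \<and>
     (\<forall>X\<in>sl2. \<forall>\<psi>\<in>S1. \<forall>u. br (0, X, 0) (0, 0, tens \<psi> u) = (0, 0, tens \<psi> (X *v u))) \<and>
     (\<forall>\<phi>\<in>S1. \<forall>\<psi>\<in>S1. \<forall>u w. br (0, 0, tens \<phi> u) (0, 0, tens \<psi> w) =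
        (sC (symp u w) (L2 n g sC \<iota> \<rho> B x \<phi> \<psi>), map_matrix ((*) (B \<phi> \<psi>)) (sigma u w), 0))"

end

theory Submission
  imports Defs
begin

text \<open>The bracket on \<open>E\<close> has the shape of a graded Lie algebra: \<open>C\<^sup>2 \<oplus> sl(2)\<close> is a Lie algebra, it acts on
\<open>S\<^sub>1 \<otimes> k\<^sup>2\<close>, and the two maps from pairs of elements of \<open>S\<^sub>1 \<otimes> k\<^sup>2\<close> back to \<open>C\<^sup>2\<close> and to \<open>sl(2)\<close> are
equivariant. All instances of the Jacobi identity then follow from these structures, except the one
with three arguments in \<open>S\<^sub>1 \<otimes> k\<^sup>2\<close>. Writing \<open>k\<^sup>2\<close> in coordinates, that one says that on \<open>S\<^sub>1\<close>
\[ L(\psi,\phi)\theta - L(\phi,\theta)\psi = 2 B(\psi,\theta)\phi + B(\phi,\theta)\psi - B(\phi,\psi)\theta \]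
(lemma \<open>L_difference\<close>), where \<open>L\<close> is the bilinear map \<open>S \<times> S \<rightarrow> C\<^sup>2\<close> of the statement.

This identity is a Fierz identity. Let \<open>e\<^sub>K\<close> be the product of the generators indexed by
\<open>K \<subseteq> {0..<12}\<close>. Averaging \<open>e\<^sub>K\<inverse> c e\<^sub>K\<close> over all \<open>K\<close> gives a central element, hence a scalar, and for \<open>c\<close> of
rank one this becomes the completeness relation (lemma \<open>fierz\<close>)
\[ \sum_K \beta(e_K\phi)\, e_K^{-1}\theta = 64\, \beta(\theta)\, \phi . \]
Contracting it with the pairs \<open>e\<^sub>i e\<^sub>j\<close> weights the summand of \<open>K\<close> by \<open>(12 - 2|K|)\<^sup>2\<close>, because
\<open>\<Sum>\<^sub>i \<plusminus> e\<^sub>i e\<^sub>K e\<^sub>i = \<plusminus>(12 - 2|K|) e\<^sub>K\<close>. The summand is symmetric or antisymmetric in its first two spinors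
according to \<open>|K|\<close> modulo 4, and on \<open>S\<^sub>1\<close> it vanishes for odd \<open>|K|\<close>. Symmetrising therefore kills
\<open>|K| = 0, 4, 8, 12\<close>, the weight kills \<open>|K| = 6\<close>, and \<open>|K| = 10\<close> agrees with \<open>|K| = 2\<close> because the volume
element is scalar on \<open>S\<^sub>1\<close>. What remains expresses \<open>L\<close> through \<open>L\<close> with permuted arguments
(lemma \<open>L_symmetrised\<close>), and elimination, which divides by 3, gives the identity above. The same
completeness relation, traced against \<open>B\<close>, shows that \<open>B\<close> is antisymmetric, since
\<open>\<Sum>\<^sub>K (-1)\<^bsup>|K|(|K|-1)/2\<^esup> = -64\<close>.

For simplicity, let \<open>I\<close> be a nonzero ideal and \<open>h = diag(1,-1)\<close>. As the eigenvalues of \<open>ad h\<close> are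
\<open>0, \<plusminus>1, \<plusminus>2\<close>, a polynomial in \<open>ad h\<close> cuts out the component in \<open>S\<^sub>1 \<otimes> k\<^sup>2\<close>, so \<open>I\<close> contains a nonzero
\<open>\<phi> \<otimes> u\<close>; if the component happens to be 0, one first brackets with \<open>S\<^sub>1 \<otimes> k\<^sup>2\<close>, on which \<open>C\<^sup>2 \<oplus> sl(2)\<close>
acts faithfully because \<open>C\<^sup>2\<close> does so on \<open>S\<^sub>1\<close> (lemma \<open>so_faithful\<close>). Since \<open>B\<close> is
nondegenerate on \<open>S\<^sub>1\<close>, brackets of such an element reach \<open>sl(2)\<close>, hence all of \<open>S\<^sub>1 \<otimes> k\<^sup>2\<close>, hence every
\<open>L(\<phi>,\<psi>)\<close>; and these span \<open>C\<^sup>2\<close> (lemma \<open>L_spans\<close>), again by faithfulness.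

The tensor product \<open>S\<^sub>1 \<otimes> k\<^sup>2\<close> enters only through its two coordinate maps to \<open>S\<^sub>1\<close>, which come from its
universal property.\<close>

section \<open>Products of anticommuting generators\<close>

lemma sum_Pow_lessThan_Suc:
  fixes F :: "nat set \<Rightarrow> 'a::comm_monoid_add"
  shows "(\<Sum>K\<in>Pow {..<Suc m}. F K) = (\<Sum>K\<in>Pow {..<m}. F K) + (\<Sum>K\<in>Pow {..<m}. F (insert m K))"
proof -
  have inj: "inj_on (insert m) (Pow {..<m})"
  proof (rule inj_onI)
    fix A B assume "A \<in> Pow {..<m}" "B \<in> Pow {..<m}" "insert m A = insert m B"
    then show "A = B"
      using insert_ident[of m A B] by blast
  qed
  have "(\<Sum>K\<in>Pow {..<Suc m}. F K) = (\<Sum>K\<in>Pow {..<m} \<union> insert m ` Pow {..<m}. F K)"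
    by (simp add: lessThan_Suc Pow_insert)
  also have "\<dots> = (\<Sum>K\<in>Pow {..<m}. F K) + (\<Sum>K\<in>insert m ` Pow {..<m}. F K)"
    by (rule sum.union_disjoint) auto
  also have "(\<Sum>K\<in>insert m ` Pow {..<m}. F K) = (\<Sum>K\<in>Pow {..<m}. F (insert m K))"
    using inj by (simp add: sum.reindex)
  finally show ?thesis .
qed

lemma card_Int_lessThan_Suc:
  "card (K \<inter> {..<Suc m}) = (if m \<in> K then Suc (card (K \<inter> {..<m})) else card (K \<inter> {..<m}))"
  by (simp add: lessThan_Suc)

text \<open>The sign of the permutation that reverses a word of length \<open>k\<close>.\<close>

primrec reversal_sign :: "nat \<Rightarrow> 'k::comm_ring_1" where
  "reversal_sign 0 = 1"
| "reversal_sign (Suc k) = (- 1) ^ k * reversal_sign k"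

text \<open>The images \<open>e\<^sub>i\<close> of an orthonormal basis in an algebra, with \<open>eps i\<close> the square of the \<open>i\<close>-th basis vector.
The squares need not have a common sign, which is why the inverse of \<open>e\<^sub>i\<close> is \<open>eps i\<close> times \<open>e\<^sub>i\<close>.\<close>

locale clifford_frame =
  fixes N :: nat
    and sC :: "'k::field \<Rightarrow> 'c::ring_1 \<Rightarrow> 'c"
    and e :: "nat \<Rightarrow> 'c"
    and eps :: "nat \<Rightarrow> 'k"
  assumes alg: "k_algebra sC"
    and eps_sq: "i < N \<Longrightarrow> eps i * eps i = 1"
    and e_sq: "i < N \<Longrightarrow> e i * e i = sC (eps i) 1"
    and e_anti: "i < N \<Longrightarrow> j < N \<Longrightarrow> i \<noteq> j \<Longrightarrow> e i * e j = - (e j * e i)"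
begin

sublocale C: vector_space sC
  using alg by (simp add: k_algebra_def)

lemma scale_mult_left [simp]: "sC a c * d = sC a (c * d)"
  and scale_mult_right [simp]: "c * sC a d = sC a (c * d)"
  using alg by (auto simp: k_algebra_def)

definition e_inv :: "nat \<Rightarrow> 'c" where
  "e_inv i = sC (eps i) (e i)"

lemma e_e_inv: "i < N \<Longrightarrow> e i * e_inv i = 1" and e_inv_e: "i < N \<Longrightarrow> e_inv i * e i = 1"
  by (simp_all add: e_inv_def e_sq eps_sq)

lemma e_e_inv_left: "i < N \<Longrightarrow> e i * (e_inv i * c) = c"
  by (simp add: mult.assoc [symmetric] e_e_inv)

lemma e_anti_scale: "i < N \<Longrightarrow> j < N \<Longrightarrow> e i * e j = sC (if i = j then 1 else - 1) (e j * e i)"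
  by (cases "i = j") (simp_all add: e_anti[of i j])

text \<open>The factors of \<open>eprod m K\<close> are the generators with index in \<open>K\<close> below \<open>m\<close>, in increasing order. Recursion on
the bound \<open>m\<close>, rather than on the set, makes every sum over \<open>K \<subseteq> {..<m}\<close> amenable to induction.\<close>

primrec eprod :: "nat \<Rightarrow> nat set \<Rightarrow> 'c" where
  "eprod 0 K = 1"
| "eprod (Suc m) K = (if m \<in> K then eprod m K * e m else eprod m K)"

primrec eprod_inv :: "nat \<Rightarrow> nat set \<Rightarrow> 'c" where
  "eprod_inv 0 K = 1"
| "eprod_inv (Suc m) K = (if m \<in> K then e_inv m * eprod_inv m K else eprod_inv m K)"

primrec eprod_rev :: "nat \<Rightarrow> nat set \<Rightarrow> 'c" where
  "eprod_rev 0 K = 1"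
| "eprod_rev (Suc m) K = (if m \<in> K then e m * eprod_rev m K else eprod_rev m K)"

lemma eprod_insert [simp]: "m \<le> l \<Longrightarrow> eprod m (insert l K) = eprod m K"
  and eprod_inv_insert [simp]: "m \<le> l \<Longrightarrow> eprod_inv m (insert l K) = eprod_inv m K"
  by (induction m) auto

lemma eprod_inverse:
  "m \<le> N \<Longrightarrow> eprod m K * eprod_inv m K = 1 \<and> eprod_inv m K * eprod m K = 1"
proof (induction m)
  case (Suc m)
  then have *: "eprod m K * eprod_inv m K = 1" "eprod_inv m K * eprod m K = 1" "m < N"
    by auto
  have "eprod m K * e m * (e_inv m * eprod_inv m K) = 1"
    using * by (simp add: mult.assoc e_e_inv_left)
  moreover have "e_inv m * eprod_inv m K * (eprod m K * e m) = e_inv m * (eprod_inv m K * eprod m K) * e m"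
    by (simp only: mult.assoc)
  ultimately show ?case
    using * by (simp add: e_inv_e)
qed simp

text \<open>Moving \<open>e\<^sub>i\<close> through the product costs one sign for each factor, except for the factor \<open>e\<^sub>i\<close> itself.\<close>

lemma e_eprod:
  assumes "i < N" "m \<le> N"
  shows "e i * eprod m K =
    sC ((- 1) ^ (card (K \<inter> {..<m}) + of_bool (i < m \<and> i \<in> K))) (eprod m K * e i)"
  using assms(2)
proof (induction m)
  case (Suc m)
  then have IH: "e i * eprod m K =
      sC ((- 1) ^ (card (K \<inter> {..<m}) + of_bool (i < m \<and> i \<in> K))) (eprod m K * e i)"
    and m: "m < N"
    by auto
  show ?case
  proof (cases "m \<in> K")
    case False
    then show ?thesis
      using IH by (auto simp: card_Int_lessThan_Suc less_Suc_eq)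
  next
    case True
    have "e i * eprod (Suc m) K = (e i * eprod m K) * e m"
      using True by (simp add: mult.assoc)
    also have "\<dots> = sC ((- 1) ^ (card (K \<inter> {..<m}) + of_bool (i < m \<and> i \<in> K)) * (if i = m then 1 else - 1))
        (eprod m K * (e m * e i))"
      using e_anti_scale[OF assms(1) m] by (simp add: IH mult.assoc)
    finally show ?thesis
      using True by (auto simp: card_Int_lessThan_Suc less_Suc_eq mult.assoc)
  qed
qed simp

lemma eprod_rev_eq:
  "m \<le> N \<Longrightarrow> eprod_rev m K = sC (reversal_sign (card (K \<inter> {..<m}))) (eprod m K)"
proof (induction m)
  case (Suc m)
  then show ?case
    using e_eprod[of m m K] by (simp add: card_Int_lessThan_Suc mult.commute[of "reversal_sign _"])
qed simp

lemma eprod_inv_eq: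
  "m \<le> N \<Longrightarrow> \<exists>s. s * s = 1 \<and> eprod_inv m K = sC s (eprod m K)"
proof (induction m)
  case 0
  then show ?case by (intro exI[of _ 1]) simp
next
  case (Suc m)
  then obtain s where s: "s * s = 1" "eprod_inv m K = sC s (eprod m K)" and m: "m < N" "m \<le> N"
    by auto
  show ?case
  proof (cases "m \<in> K")
    case True
    let ?t = "(- 1) ^ card (K \<inter> {..<m}) :: 'k"
    have "?t * ?t = 1" by (simp flip: power_mult_distrib)
    moreover have "(eps m * s * ?t) * (eps m * s * ?t) = (eps m * eps m) * (s * s) * (?t * ?t)"
      by (simp only: mult_ac)
    ultimately have "(eps m * s * ?t) * (eps m * s * ?t) = 1"
      using s(1) eps_sq[OF m(1)] by simp
    moreover have "eprod_inv (Suc m) K = sC (eps m * s * ?t) (eprod (Suc m) K)"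
      using True s(2) m by (simp add: e_inv_def e_eprod)
    ultimately show ?thesis by blast
  qed (use s in auto)
qed

text \<open>The sum of the conjugates of \<open>c\<close> under the finite group generated by the \<open>e\<^sub>i\<close>, taken modulo signs. By the recursion in \<open>avg_Suc\<close> it is a
composition of such sums for single generators, each of which produces elements commuting with
that generator.\<close>

definition avg :: "nat \<Rightarrow> 'c \<Rightarrow> 'c" where
  "avg m c = (\<Sum>K\<in>Pow {..<m}. eprod_inv m K * c * eprod m K)"

lemma avg_Suc: "avg (Suc m) c = avg m c + e_inv m * avg m c * e m"
proof -
  have "eprod_inv (Suc m) K * c * eprod (Suc m) K = eprod_inv m K * c * eprod m K"
    if "K \<in> Pow {..<m}" for K
    using that by auto
  moreover have "eprod_inv (Suc m) (insert m K) * c * eprod (Suc m) (insert m K)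
      = e_inv m * (eprod_inv m K * c * eprod m K) * e m" for K
    by (simp add: mult.assoc)
  ultimately show ?thesis
    unfolding avg_def sum_Pow_lessThan_Suc
    by (simp add: sum_distrib_left sum_distrib_right)
qed

lemma e_e_inv_anti:
  assumes "i < N" "j < N" "i \<noteq> j"
  shows "e i * e_inv j = - (e_inv j * e i)"
  using e_anti[OF assms] by (simp add: e_inv_def)

lemma avg_commute:
  "i < m \<Longrightarrow> m \<le> N \<Longrightarrow> e i * avg m c = avg m c * e i"
proof (induction m)
  case (Suc m)
  then have m: "m < N" "m \<le> N" "i < N" by auto
  let ?d = "avg m c"
  show ?case
  proof (cases "i = m")
    case True
    have "e m * (e_inv m * ?d * e m) = ?d * e m"
      using e_e_inv_left[OF m(1)] by (simp add: mult.assoc)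
    moreover have "e_inv m * ?d * e m * e m = e m * ?d"
      using m by (simp add: mult.assoc e_sq e_inv_def eps_sq)
    ultimately show ?thesis
      using True by (simp add: avg_Suc algebra_simps)
  next
    case False
    with Suc.prems Suc.IH have IH: "e i * ?d = ?d * e i" and "i < m" by auto
    have "e i * (e_inv m * ?d * e m) = - (e_inv m * (e i * ?d) * e m)"
      using e_e_inv_anti[OF m(3,1) False] by (simp add: mult.assoc [symmetric])
    also have "\<dots> = - (e_inv m * ?d * (e i * e m))"
      by (simp add: IH mult.assoc)
    also have "\<dots> = e_inv m * ?d * e m * e i"
      using e_anti[OF m(3,1) False] by (simp add: mult.assoc)
    finally show ?thesis
      using IH by (simp add: avg_Suc algebra_simps)
  qed
qed simp

end

section \<open>The spin representation and the Fierz identity\<close>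

locale spin_rep = clifford_frame "2 * n" sC e eps + S: vector_space sS
  for n :: nat
    and sC :: "'k::field \<Rightarrow> 'c::ring_1 \<Rightarrow> 'c"
    and e :: "nat \<Rightarrow> 'c"
    and eps :: "nat \<Rightarrow> 'k"
    and sS :: "'k \<Rightarrow> 's::ab_group_add \<Rightarrow> 's" +
  fixes \<rho> :: "'c \<Rightarrow> 's \<Rightarrow> 's"
  assumes two_neq_0: "(2::'k) \<noteq> 0"
    and generated: "(\<And>i. i < 2 * n \<Longrightarrow> e i * c = c * e i) \<Longrightarrow> c * d = d * c"
    and dim_S: "S.dim UNIV = 2 ^ n"
    and iso: "algebra_iso_End sC sS \<rho>"
begin

lemma rho_add: "\<rho> (c + d) \<psi> = \<rho> c \<psi> + \<rho> d \<psi>"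
  and rho_scale: "\<rho> (sC a c) \<psi> = sS a (\<rho> c \<psi>)"
  and rho_mult: "\<rho> (c * d) \<psi> = \<rho> c (\<rho> d \<psi>)"
  and rho_1: "\<rho> 1 \<psi> = \<psi>"
  using iso by (auto simp: algebra_iso_End_def)

lemma rho_linear: "Vector_Spaces.linear sS sS (\<rho> c)"
  using iso by (auto simp: algebra_iso_End_def bij_betw_def)

lemma rho_surj: "Vector_Spaces.linear sS sS f \<Longrightarrow> \<exists>c. \<rho> c = f"
  using iso unfolding algebra_iso_End_def bij_betw_def by (metis image_iff mem_Collect_eq)

lemma rho_inj: "\<rho> c = \<rho> d \<Longrightarrow> c = d"
  using iso by (auto simp: algebra_iso_End_def bij_betw_def inj_on_def)

sublocale rho: Vector_Spaces.linear sS sS "\<rho> c" for c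
  by (rule rho_linear)

lemma rho_0 [simp]: "\<rho> 0 \<psi> = 0"
  using rho_add[of 0 0 \<psi>] by simp

lemma rho_minus: "\<rho> (- c) \<psi> = - \<rho> c \<psi>"
  using rho_add[of c "- c" \<psi>] by (simp add: eq_neg_iff_add_eq_0 add.commute)

lemma rho_diff: "\<rho> (c - d) \<psi> = \<rho> c \<psi> - \<rho> d \<psi>"
  using rho_add[of c "- d" \<psi>] by (simp add: rho_minus)

lemma rho_sum: "\<rho> (sum c A) \<psi> = (\<Sum>i\<in>A. \<rho> (c i) \<psi>)"
  by (induction A rule: infinite_finite_induct) (simp_all add: rho_add)

lemmas rho_simps = rho_add rho_minus rho_diff rho_scale rho_mult rho_1 rho_sum
  rho.add rho.neg rho.diff rho.scale rho.sum

abbreviation functional :: "('s \<Rightarrow> 'k) \<Rightarrow> bool" where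
  "functional \<beta> \<equiv> Vector_Spaces.linear sS (*) \<beta>"

lemma functionalD:
  assumes "functional \<beta>"
  shows "\<beta> (\<phi> + \<psi>) = \<beta> \<phi> + \<beta> \<psi>" "\<beta> (sS a \<phi>) = a * \<beta> \<phi>" "\<beta> (sum g A) = (\<Sum>i\<in>A. \<beta> (g i))"
proof -
  interpret Vector_Spaces.linear sS "(*)" \<beta> by fact
  show "\<beta> (\<phi> + \<psi>) = \<beta> \<phi> + \<beta> \<psi>" "\<beta> (sS a \<phi>) = a * \<beta> \<phi>" "\<beta> (sum g A) = (\<Sum>i\<in>A. \<beta> (g i))"
    by (rule add scale sum)+
qed

text \<open>Rank one operators are available inside the Clifford algebra because it is all of \<open>End(S)\<close>.\<close>

lemma rank_one: "functional \<beta> \<Longrightarrow> \<exists>c. \<forall>\<phi>. \<rho> c \<phi> = sS (\<beta> \<phi>) \<theta>"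
proof -
  assume "functional \<beta>"
  then have "Vector_Spaces.linear sS sS (\<lambda>\<phi>. sS (\<beta> \<phi>) \<theta>)"
    by (intro Vector_Spaces.linear_iff[THEN iffD2]) (auto simp: functionalD S.scale_left_distrib S.vector_space_axioms)
  from rho_surj[OF this] show ?thesis by metis
qed

definition basis :: "'s set" where
  "basis = (SOME b. S.independent b \<and> S.span b = UNIV)"

lemma basis: "S.independent basis" "S.span basis = UNIV"
proof -
  obtain b where "b \<subseteq> UNIV" "S.independent b" "UNIV \<subseteq> S.span b" "card b = S.dim UNIV"
    using S.basis_exists by blast
  then have "\<exists>b. S.independent b \<and> S.span b = UNIV" by auto
  from someI_ex[OF this] show "S.independent basis" "S.span basis = UNIV"
    by (auto simp: basis_def)
qed

lemma card_basis: "card basis = 2 ^ n"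
  using S.basis_card_eq_dim[of basis UNIV] basis dim_S by simp

lemma finite_basis: "finite basis"
  using card_basis card.infinite[of basis] by force

abbreviation "coord b \<phi> \<equiv> S.representation basis \<phi> b"

lemma functional_coord: "functional (coord b)"
  by (intro Vector_Spaces.linear_iff[THEN iffD2] conjI allI)
    (auto simp: S.representation_add S.representation_scale basis S.vector_space_axioms
      intro: vector_space_over_itself.vector_space_axioms)

lemma coord_expand: "(\<Sum>b\<in>basis. sS (coord b \<phi>) b) = \<phi>"
  using S.sum_representation_eq[OF basis(1), of \<phi> basis] finite_basis basis by simp

lemma coord_basis: "b \<in> basis \<Longrightarrow> coord b b = 1"
  using S.representation_basis[OF basis(1), of b] by simp

text \<open>Commuting with the operators \<open>\<psi> \<mapsto> \<beta>(\<psi>)\<phi>\<close>, where \<open>\<beta>\<close> is a coordinate functional, forces the value at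
\<open>\<phi>\<close> to be a multiple of \<open>\<phi>\<close> by a factor that does not depend on \<open>\<phi>\<close>.\<close>

lemma central_scalar:
  assumes "\<And>d. c * d = d * c"
  shows "\<exists>a. \<forall>\<phi>. \<rho> c \<phi> = sS a \<phi>"
proof -
  have "basis \<noteq> {}" using card_basis by auto
  then obtain b where b: "b \<in> basis" by blast
  have "\<rho> c \<phi> = sS (coord b (\<rho> c b)) \<phi>" for \<phi>
  proof -
    obtain d where d: "\<And>\<psi>. \<rho> d \<psi> = sS (coord b \<psi>) \<phi>"
      using rank_one[OF functional_coord] by metis
    have "\<rho> (c * d) b = \<rho> (d * c) b" by (simp add: assms)
    then show ?thesis using coord_basis[OF b] by (simp add: rho_mult d)
  qed
  then show ?thesis by blast
qed

lemma avg_central: "avg (2 * n) c * d = d * avg (2 * n) c"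
  by (rule generated) (simp add: avg_commute)

abbreviation "subsets \<equiv> Pow {..<2 * n}"
abbreviation "E K \<equiv> eprod (2 * n) K"
abbreviation "E_inv K \<equiv> eprod_inv (2 * n) K"

lemma fierz_scalar:
  assumes "functional \<beta>"
  shows "\<exists>a. \<forall>\<phi>. (\<Sum>K\<in>subsets. sS (\<beta> (\<rho> (E K) \<phi>)) (\<rho> (E_inv K) \<theta>)) = sS a \<phi>"
proof -
  obtain c where c: "\<And>\<psi>. \<rho> c \<psi> = sS (\<beta> \<psi>) \<theta>"
    using rank_one[OF assms] by metis
  have "\<rho> (avg (2 * n) c) \<phi> = (\<Sum>K\<in>subsets. sS (\<beta> (\<rho> (E K) \<phi>)) (\<rho> (E_inv K) \<theta>))" for \<phi>
    by (simp add: avg_def rho_simps c)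
  with central_scalar[of "avg (2 * n) c"] avg_central show ?thesis by metis
qed

text \<open>Each \<open>e\<^sub>K\<inverse>\<close> is \<open>e\<^sub>K\<close> up to a sign, so \<open>\<Sum>\<^sub>K e\<^sub>K \<otimes> e\<^sub>K\<inverse>\<close> is a symmetric tensor. This determines how the
scalar in \<open>fierz_scalar\<close> depends on \<open>\<beta>\<close> and \<open>\<theta>\<close>, without using traces.\<close>

lemma fierz_swap:
  assumes "functional \<beta>" "functional \<gamma>"
  shows "(\<Sum>K\<in>subsets. \<beta> (\<rho> (E K) \<phi>) * \<gamma> (\<rho> (E_inv K) \<theta>)) =
    (\<Sum>K\<in>subsets. \<gamma> (\<rho> (E K) \<theta>) * \<beta> (\<rho> (E_inv K) \<phi>))"
proof (rule sum.cong)
  fix K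
  obtain s where "E_inv K = sC s (E K)" using eprod_inv_eq by blast
  then show "\<beta> (\<rho> (E K) \<phi>) * \<gamma> (\<rho> (E_inv K) \<theta>) = \<gamma> (\<rho> (E K) \<theta>) * \<beta> (\<rho> (E_inv K) \<phi>)"
    by (simp add: rho_scale functionalD assms)
qed simp

text \<open>The completeness relation. The scalar of \<open>fierz_scalar\<close> is \<open>c \<beta>(\<theta>)\<close> for a constant \<open>c\<close>; summing over a
basis and its dual basis replaces the rank one operator by the identity, for which every one of the
\<open>4\<^sup>n\<close> summands is the identity, so \<open>2\<^sup>n c = 4\<^sup>n\<close>.\<close>

theorem fierz:
  assumes "functional \<beta>"
  shows "(\<Sum>K\<in>subsets. sS (\<beta> (\<rho> (E K) \<phi>)) (\<rho> (E_inv K) \<theta>)) = sS (2 ^ n * \<beta> \<theta>) \<phi>"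
proof -
  define l where "l \<theta> \<beta> = (SOME a. \<forall>\<phi>. (\<Sum>K\<in>subsets. sS (\<beta> (\<rho> (E K) \<phi>)) (\<rho> (E_inv K) \<theta>)) = sS a \<phi>)"
    for \<theta> and \<beta> :: "'s \<Rightarrow> 'k"
  have l: "(\<Sum>K\<in>subsets. sS (\<beta> (\<rho> (E K) \<phi>)) (\<rho> (E_inv K) \<theta>)) = sS (l \<theta> \<beta>) \<phi>"
    if "functional \<beta>" for \<beta> \<phi> \<theta>
    unfolding l_def by (rule spec[OF someI_ex[OF fierz_scalar[OF that]]])
  have l2: "(\<Sum>K\<in>subsets. \<beta> (\<rho> (E K) \<phi>) * \<gamma> (\<rho> (E_inv K) \<theta>)) = l \<theta> \<beta> * \<gamma> \<phi>"
    if "functional \<beta>" "functional \<gamma>" for \<beta> \<gamma> \<phi> \<theta>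
    using arg_cong[OF l[OF that(1)], of \<gamma>] by (simp add: functionalD that)
  have sym: "l \<theta> \<beta> * \<gamma> \<phi> = l \<phi> \<gamma> * \<beta> \<theta>" if "functional \<beta>" "functional \<gamma>" for \<beta> \<gamma> \<phi> \<theta>
  proof -
    have "l \<theta> \<beta> * \<gamma> \<phi> = (\<Sum>K\<in>subsets. \<gamma> (\<rho> (E K) \<theta>) * \<beta> (\<rho> (E_inv K) \<phi>))"
      using fierz_swap[OF that] l2[OF that] by simp
    then show ?thesis using l2[OF that(2,1)] by simp
  qed
  have "basis \<noteq> {}" using card_basis by auto
  then obtain b where b: "b \<in> basis" by blast
  define c where "c = l b (coord b)"
  have lc: "l \<theta> \<beta> = c * \<beta> \<theta>" if "functional \<beta>" for \<beta> \<theta>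
    using sym[OF that functional_coord, of \<theta> b b] coord_basis[OF b] by (simp add: c_def)
  have "sS (2 ^ n * c) b = (\<Sum>b'\<in>basis. sS (l b' (coord b')) b)"
    by (simp add: lc functional_coord coord_basis card_basis S.scale_sum_left [symmetric])
  also have "\<dots> = (\<Sum>b'\<in>basis. \<Sum>K\<in>subsets. sS (coord b' (\<rho> (E K) b)) (\<rho> (E_inv K) b'))"
    by (simp only: l[OF functional_coord])
  also have "\<dots> = (\<Sum>K\<in>subsets. \<rho> (E_inv K) (\<Sum>b'\<in>basis. sS (coord b' (\<rho> (E K) b)) b'))"
    by (subst sum.swap) (simp add: rho_simps)
  also have "\<dots> = (\<Sum>K\<in>subsets. \<rho> (E_inv K * E K) b)"
    by (simp add: coord_expand rho_mult)
  also have "\<dots> = (\<Sum>K\<in>subsets. sS 1 b)"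
    by (intro sum.cong) (auto simp: eprod_inverse rho_1)
  also have "\<dots> = sS (2 ^ (2 * n)) b"
    by (simp only: S.scale_sum_left [symmetric]) (simp add: card_Pow)
  finally have "2 ^ n * c = 2 ^ (2 * n)"
    using b basis S.dependent_zero S.scale_cancel_right by metis
  then have "c = 2 ^ n"
    using two_neq_0 by (simp add: mult_2 power_add)
  then show ?thesis using l[OF assms] lc[OF assms] by simp
qed

end

section \<open>Sums over small sets of generators, and contraction\<close>

lemma sum_lessThan_square:
  fixes X :: "nat \<Rightarrow> nat \<Rightarrow> 'a::ab_group_add"
  assumes "\<And>i j. X i j = X j i"
  shows "(\<Sum>i<m. \<Sum>j<m. X i j) = (\<Sum>i<m. X i i) + (\<Sum>j<m. \<Sum>i<j. X i j) + (\<Sum>j<m. \<Sum>i<j. X i j)"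
  using assms by (induction m) (simp_all add: sum.distrib algebra_simps)

lemma sum_Pow_card_0:
  fixes F :: "nat set \<Rightarrow> 'a::ab_group_add"
  shows "(\<Sum>K\<in>Pow {..<m}. if card K = 0 then F K else 0) = F {}"
proof -
  have "(\<Sum>K\<in>Pow {..<m}. if card K = 0 then F K else 0) = (\<Sum>K\<in>Pow {..<m}. if K = {} then F K else 0)"
    by (intro sum.cong) (auto dest: finite_subset)
  then show ?thesis by simp
qed

lemma card_insert_max: "K \<in> Pow {..<m::nat} \<Longrightarrow> card (insert m K) = Suc (card K)"
  using finite_subset[of K "{..<m}"] by (subst card_insert_disjoint) auto

lemma sum_Pow_card_1:
  fixes F :: "nat set \<Rightarrow> 'a::ab_group_add"
  shows "(\<Sum>K\<in>Pow {..<m}. if card K = 1 then F K else 0) = (\<Sum>i<m. F {i})"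
proof (induction m)
  case (Suc m)
  have "(\<Sum>K\<in>Pow {..<m}. if card (insert m K) = 1 then F (insert m K) else 0)
      = (\<Sum>K\<in>Pow {..<m}. if card K = 0 then F (insert m K) else 0)"
    by (intro sum.cong refl) (simp only: card_insert_max, simp)
  with Suc show ?case
    by (simp only: sum_Pow_lessThan_Suc sum_Pow_card_0[of "\<lambda>K. F (insert m K)"]) simp
qed simp

lemma sum_Pow_card_2:
  fixes F :: "nat set \<Rightarrow> 'a::ab_group_add"
  shows "(\<Sum>K\<in>Pow {..<m}. if card K = 2 then F K else 0) = (\<Sum>j<m. \<Sum>i<j. F {i, j})"
proof (induction m)
  case (Suc m)
  have "(\<Sum>K\<in>Pow {..<m}. if card (insert m K) = 2 then F (insert m K) else 0)
      = (\<Sum>K\<in>Pow {..<m}. if card K = 1 then F (insert m K) else 0)"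
    by (intro sum.cong refl) (simp only: card_insert_max, simp)
  with Suc show ?case
    by (simp only: sum_Pow_lessThan_Suc sum_Pow_card_1[of "\<lambda>K. F (insert m K)"])
      (simp add: insert_commute)
qed simp

text \<open>The sums of \<open>reversal_sign\<close> and of \<open>(-1)\<^bsup>|K|\<^esup> reversal_sign\<close> over all \<open>K\<close> satisfy the recursion
\<open>(a, b) \<mapsto> (a + b, b - a)\<close>; they are the real part plus or minus the imaginary part of \<open>(1 + i)\<^sup>m\<close>, and
\<open>(1 + i)\<^bsup>12\<^esup> = -64\<close>.\<close>

lemma sum_reversal_sign_12:
  "(\<Sum>K\<in>Pow {..<12::nat}. reversal_sign (card K)) = (- 64 :: 'k::comm_ring_1)"
proof -
  define a b :: "nat \<Rightarrow> 'k" where "a m = (\<Sum>K\<in>Pow {..<m}. reversal_sign (card K))"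
    and "b m = (\<Sum>K\<in>Pow {..<m}. (- 1) ^ card K * reversal_sign (card K))" for m
  have a: "a (Suc m) = a m + b m" for m
    unfolding a_def b_def sum_Pow_lessThan_Suc
    by (intro arg_cong2[where f = "(+)"] sum.cong refl) (simp only: card_insert_max reversal_sign.simps)
  have sign: "(- 1) ^ Suc c * ((- 1) ^ c * r) = - r" for c and r :: 'k
    by (cases "even c") auto
  have "(\<Sum>K\<in>Pow {..<m}. (- 1) ^ card (insert m K) * reversal_sign (card (insert m K))) =
      (\<Sum>K\<in>Pow {..<m}. - reversal_sign (card K) :: 'k)" for m :: nat
    by (intro sum.cong refl) (simp only: card_insert_max reversal_sign.simps sign)
  then have b: "b (Suc m) = b m - a m" for m
    unfolding a_def b_def sum_Pow_lessThan_Suc by (simp add: sum_negf)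
  have "a 0 = 1" "b 0 = 1" by (simp_all add: a_def b_def)
  then have "a 12 = - 64"
    by (simp add: eval_nat_numeral a b)
  then show ?thesis by (simp add: a_def)
qed

context clifford_frame
begin

lemma eprod_cong: "K \<inter> {..<m} = K' \<inter> {..<m} \<Longrightarrow> eprod m K = eprod m K'"
proof (induction m)
  case (Suc m)
  then have "K \<inter> {..<m} = K' \<inter> {..<m}" "m \<in> K \<longleftrightarrow> m \<in> K'"
    by (auto simp: lessThan_Suc set_eq_iff)
  with Suc show ?case by simp
qed simp

lemma eprod_inv_cong: "K \<inter> {..<m} = K' \<inter> {..<m} \<Longrightarrow> eprod_inv m K = eprod_inv m K'"
proof (induction m)
  case (Suc m)
  then have "K \<inter> {..<m} = K' \<inter> {..<m}" "m \<in> K \<longleftrightarrow> m \<in> K'"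
    by (auto simp: lessThan_Suc set_eq_iff)
  with Suc show ?case by simp
qed simp

lemma eprod_pair:
  "i < j \<Longrightarrow> eprod m {i, j} = (if j < m then e i * e j else if i < m then e i else 1)"
  "i < j \<Longrightarrow> eprod_inv m {i, j} = (if j < m then e_inv j * e_inv i else if i < m then e_inv i else 1)"
  by (induction m) (auto simp: less_Suc_eq)

text \<open>Sorting the word \<open>e\<^sub>K e\<^bsub>-K\<^esub>\<close> into increasing order only changes its sign.\<close>

lemma eprod_compl:
  "m \<le> N \<Longrightarrow> \<exists>s. s * s = 1 \<and> eprod m K * eprod m (- K) = sC s (eprod m UNIV)"
proof (induction m)
  case 0
  then show ?case by (intro exI[of _ 1]) simp
next
  case (Suc m)
  then obtain s where s: "s * s = 1" "eprod m K * eprod m (- K) = sC s (eprod m UNIV)"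
    and m: "m < N" "m \<le> N" by auto
  show ?case
  proof (cases "m \<in> K")
    case False
    then show ?thesis using s by (auto simp: mult.assoc [symmetric])
  next
    case True
    let ?t = "(- 1) ^ card (- K \<inter> {..<m}) :: 'k"
    have "?t * ?t = 1" by (simp flip: power_mult_distrib)
    moreover have "(?t * s) * (?t * s) = (s * s) * (?t * ?t)"
      by (simp only: mult_ac)
    ultimately have "(?t * s) * (?t * s) = 1" using s(1) by simp
    moreover have "eprod (Suc m) K * eprod (Suc m) (- K) = eprod m K * (e m * eprod m (- K))"
      using True by (simp add: mult.assoc)
    moreover have "\<dots> = sC ?t (eprod m K * eprod m (- K) * e m)"
      using e_eprod[OF m, of "- K"] True by (simp add: mult.assoc)
    ultimately show ?thesis
      using s(2) by (metis C.scale_scale eprod.simps(2) iso_tuple_UNIV_I scale_mult_left)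
  qed
qed

text \<open>Applied twice, this operator absorbs the pairs of generators in the definition of the map to \<open>C\<^sup>2\<close>, and it is diagonal
on the products \<open>e\<^sub>K\<close>.\<close>

definition contract :: "'c \<Rightarrow> 'c" where
  "contract c = (\<Sum>i<N. sC (eps i) (e i * c * e i))"

lemma contract_scale: "contract (sC a c) = sC a (contract c)"
  by (simp add: contract_def C.scale_sum_right mult.commute)

lemma contract_eprod:
  "contract (eprod N K) =
    sC ((- 1) ^ card (K \<inter> {..<N}) * (of_nat N - 2 * of_nat (card (K \<inter> {..<N})))) (eprod N K)"
proof -
  let ?c = "card (K \<inter> {..<N})"
  have "contract (eprod N K) = (\<Sum>i<N. sC ((- 1) ^ (?c + of_bool (i \<in> K))) (eprod N K))"
    unfolding contract_def
  proof (rule sum.cong)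
    fix i assume "i \<in> {..<N}"
    then have i: "i < N" by simp
    have "e i * eprod N K * e i = sC ((- 1) ^ (?c + of_bool (i \<in> K)) * eps i) (eprod N K)"
      using i by (simp add: e_eprod mult.assoc e_sq)
    then show "sC (eps i) (e i * eprod N K * e i) = sC ((- 1) ^ (?c + of_bool (i \<in> K))) (eprod N K)"
      using eps_sq[OF i] by (simp add: mult.left_commute)
  qed simp
  also have "\<dots> = sC (\<Sum>i<N. (- 1) ^ ?c * (1 - 2 * of_bool (i \<in> K))) (eprod N K)"
    unfolding C.scale_sum_left by (intro sum.cong) auto
  also have "(\<Sum>i<N. (- 1) ^ ?c * (1 - 2 * of_bool (i \<in> K)) :: 'k) = (- 1) ^ ?c * (of_nat N - 2 * of_nat ?c)"
    by (simp add: sum_distrib_left [symmetric] sum_subtractf of_bool_def sum.If_cases Int_commute)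
  finally show ?thesis .
qed

lemma contract_twice_eprod:
  "contract (contract (eprod N K)) = sC ((of_nat N - 2 * of_nat (card (K \<inter> {..<N})))\<^sup>2) (eprod N K)"
proof -
  let ?t = "(- 1) ^ card (K \<inter> {..<N}) :: 'k"
  have "?t * ?t = 1" by (simp flip: power_mult_distrib)
  then have "?t * x * (?t * x) = x\<^sup>2" for x
    by (metis mult.left_commute mult.right_neutral power2_eq_square mult.assoc)
  then show ?thesis by (simp add: contract_eprod contract_scale)
qed

end

section \<open>The spinor norm in dimension twelve\<close>

text \<open>The data of the statement for \<open>n = 6\<close>. The orthogonality of \<open>S1\<close> and \<open>S2\<close> and the antisymmetry of \<open>B\<close> are
consequences, proved below.\<close>

locale spin_norm = spin_rep n sC e eps sS \<rho>
  for n :: nat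
    and sC :: "'k::field \<Rightarrow> 'c::ring_1 \<Rightarrow> 'c"
    and e :: "nat \<Rightarrow> 'c"
    and eps :: "nat \<Rightarrow> 'k"
    and sS :: "'k \<Rightarrow> 's::ab_group_add \<Rightarrow> 's"
    and \<rho> :: "'c \<Rightarrow> 's \<Rightarrow> 's" +
  fixes S1 S2 :: "'s set"
    and B :: "'s \<Rightarrow> 's \<Rightarrow> 'k"
  assumes n6: "n = 6"
    and three_neq_0: "(3::'k) \<noteq> 0"
    and sub_S1: "S.subspace S1" and sub_S2: "S.subspace S2"
    and S1_Int_S2: "S1 \<inter> S2 = {0}"
    and S1_plus_S2: "\<And>\<phi>. \<exists>\<phi>1\<in>S1. \<exists>\<phi>2\<in>S2. \<phi> = \<phi>1 + \<phi>2"
    and e_S1: "i < 2 * n \<Longrightarrow> \<phi> \<in> S1 \<Longrightarrow> \<rho> (e i) \<phi> \<in> S2"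
    and e_S2: "i < 2 * n \<Longrightarrow> \<phi> \<in> S2 \<Longrightarrow> \<rho> (e i) \<phi> \<in> S1"
    and S1_nontrivial: "S1 \<noteq> {0}"
    and B_bilinear: "bilinear_form sS B"
    and B_nondeg: "nondegenerate B"
    and B_e: "i < 2 * n \<Longrightarrow> B (\<rho> (e i) \<phi>) \<psi> = B \<phi> (\<rho> (e i) \<psi>)"
begin

lemma B_functional: "functional (B \<phi>)" "functional (\<lambda>\<psi>. B \<psi> \<phi>)"
  using B_bilinear by (auto simp: bilinear_form_def)

lemma B_simps:
  "B (\<phi> + \<phi>') \<psi> = B \<phi> \<psi> + B \<phi>' \<psi>" "B \<psi> (\<phi> + \<phi>') = B \<psi> \<phi> + B \<psi> \<phi>'"
  "B (sS a \<phi>) \<psi> = a * B \<phi> \<psi>" "B \<psi> (sS a \<phi>) = a * B \<psi> \<phi>"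
  "B (sum g A) \<psi> = (\<Sum>i\<in>A. B (g i) \<psi>)" "B \<psi> (sum g A) = (\<Sum>i\<in>A. B \<psi> (g i))"
  using functionalD[OF B_functional(1)] functionalD[OF B_functional(2)] by auto

lemma B_0 [simp]: "B 0 \<psi> = 0" "B \<psi> 0 = 0"
  using B_simps(3)[of 0 0 \<psi>] B_simps(4)[of \<psi> 0 0] by auto

lemma B_minus [simp]: "B (- \<phi>) \<psi> = - B \<phi> \<psi>" "B \<psi> (- \<phi>) = - B \<psi> \<phi>"
  using B_simps(1)[of "- \<phi>" \<phi> \<psi>] B_simps(2)[of \<psi> "- \<phi>" \<phi>]
  by (auto simp: eq_neg_iff_add_eq_0)

lemma B_eprod: "m \<le> 2 * n \<Longrightarrow> B (\<rho> (eprod m K) \<phi>) \<psi> = B \<phi> (\<rho> (eprod_rev m K) \<psi>)"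
  by (induction m arbitrary: \<phi> \<psi>) (auto simp: rho_simps B_e)

lemma B_E: "B (\<rho> (E K) \<phi>) \<psi> = reversal_sign (card (K \<inter> {..<2 * n})) * B \<phi> (\<rho> (E K) \<psi>)"
  by (simp add: B_eprod eprod_rev_eq rho_simps B_simps)

lemma B_E_inv_E:
  "B (\<rho> (E_inv K) \<theta>) (\<rho> (E K) \<psi>) = reversal_sign (card (K \<inter> {..<2 * n})) * B \<theta> \<psi>"
proof -
  obtain s where s: "E_inv K = sC s (E K)" using eprod_inv_eq by blast
  have "B (\<rho> (E_inv K) \<theta>) (\<rho> (E K) \<psi>) =
      reversal_sign (card (K \<inter> {..<2 * n})) * B \<theta> (\<rho> (E_inv K * E K) \<psi>)"
    by (simp add: s rho_simps B_simps B_E)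
  then show ?thesis by (simp add: eprod_inverse rho_1)
qed

text \<open>Apply the bilinear form \<open>B\<close> to the two factors of the identity \<open>\<Sum>\<^sub>K e\<^sub>K \<otimes> e\<^sub>K\<inverse> = 64 \<cdot> swap\<close>. On the right
this gives \<open>64 B(\<psi>,\<phi>)\<close>. On the left, moving \<open>e\<^sub>K\<close> from one argument of \<open>B\<close> to the other reverses it and
cancels \<open>e\<^sub>K\<inverse>\<close> up to the reversal sign, which leaves \<open>-64 B(\<phi>,\<psi>)\<close>.\<close>

lemma B_antisym: "B \<phi> \<psi> = - B \<psi> \<phi>"
proof -
  have B_expand: "B \<theta> \<psi> = (\<Sum>b\<in>basis. coord b \<theta> * B b \<psi>)" for \<theta> \<psi>
    using arg_cong[OF coord_expand[of \<theta>], of "\<lambda>t. B t \<psi>"] by (simp add: B_simps)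
  have "(\<Sum>K\<in>subsets. B (\<rho> (E_inv K) \<phi>) (\<rho> (E K) \<psi>)) =
      (\<Sum>b\<in>basis. \<Sum>K\<in>subsets. B b (\<rho> (E K) \<psi>) * coord b (\<rho> (E_inv K) \<phi>))"
    by (subst sum.swap) (simp add: B_expand[of "\<rho> _ _"] mult.commute)
  also have "\<dots> = (\<Sum>b\<in>basis. 2 ^ n * B b \<phi> * coord b \<psi>)"
  proof (rule sum.cong)
    fix b
    show "(\<Sum>K\<in>subsets. B b (\<rho> (E K) \<psi>) * coord b (\<rho> (E_inv K) \<phi>)) = 2 ^ n * B b \<phi> * coord b \<psi>"
      using arg_cong[OF fierz[OF B_functional(1)[of b], of \<psi> \<phi>], of "coord b"]
      by (simp add: functionalD[OF functional_coord])
  qed simp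
  also have "\<dots> = 2 ^ n * B \<psi> \<phi>"
    by (simp add: B_expand[of \<psi>] sum_distrib_left ac_simps)
  also have "(\<Sum>K\<in>subsets. B (\<rho> (E_inv K) \<phi>) (\<rho> (E K) \<psi>)) =
      (\<Sum>K\<in>subsets. reversal_sign (card K)) * B \<phi> \<psi>"
    unfolding B_E_inv_E sum_distrib_right by (intro sum.cong) (auto simp: Int_absorb2)
  also have "\<dots> = - (64 * B \<phi> \<psi>)"
    using n6 by (simp add: sum_reversal_sign_12)
  finally have "2 ^ 6 * (B \<phi> \<psi> + B \<psi> \<phi>) = 0"
    using n6 by (simp add: algebra_simps) (metis add.right_inverse)
  then have "B \<phi> \<psi> + B \<psi> \<phi> = 0"
    using two_neq_0 by (metis mult_eq_0_iff power_not_zero)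
  then show ?thesis by (simp add: eq_neg_iff_add_eq_0)
qed

lemma eprod_half:
  assumes "m \<le> 2 * n"
  shows "\<phi> \<in> S1 \<Longrightarrow> \<rho> (eprod m K) \<phi> \<in> (if even (card (K \<inter> {..<m})) then S1 else S2)"
    and "\<phi> \<in> S2 \<Longrightarrow> \<rho> (eprod m K) \<phi> \<in> (if even (card (K \<inter> {..<m})) then S2 else S1)"
  using assms
proof (induction m arbitrary: \<phi>)
  case (Suc m)
  { case 1
    then show ?case using Suc.IH[of \<phi>] Suc.IH[of "\<rho> (e m) \<phi>"] e_S1[of m \<phi>]
      by (auto simp: card_Int_lessThan_Suc rho_mult)
  next
    case 2
    then show ?case using Suc.IH[of \<phi>] Suc.IH[of "\<rho> (e m) \<phi>"] e_S2[of m \<phi>]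
      by (auto simp: card_Int_lessThan_Suc rho_mult) }
qed (auto simp: rho_1)

lemma decomp_unique:
  assumes "\<phi>1 \<in> S1" "\<psi>1 \<in> S1" "\<phi>2 \<in> S2" "\<psi>2 \<in> S2" "\<phi>1 + \<phi>2 = \<psi>1 + \<psi>2"
  shows "\<phi>1 = \<psi>1 \<and> \<phi>2 = \<psi>2"
proof -
  have "\<phi>1 - \<psi>1 = \<psi>2 - \<phi>2" using assms(5) by (simp add: algebra_simps)
  moreover have "\<phi>1 - \<psi>1 \<in> S1" "\<psi>2 - \<phi>2 \<in> S2"
    using assms sub_S1 sub_S2 by (auto intro: S.subspace_diff)
  ultimately have "\<phi>1 - \<psi>1 \<in> S1 \<inter> S2" "\<psi>2 - \<phi>2 \<in> S1 \<inter> S2" by auto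
  then show ?thesis using S1_Int_S2 by auto
qed

text \<open>The operator that is 1 on \<open>S1\<close> and -1 on \<open>S2\<close> lies in the Clifford algebra; it anticommutes with all generators.\<close>

lemma grading: "\<exists>\<gamma>. (\<forall>\<phi>\<in>S1. \<rho> \<gamma> \<phi> = \<phi>) \<and> (\<forall>\<phi>\<in>S2. \<rho> \<gamma> \<phi> = - \<phi>)"
proof -
  \<comment> \<open>the projection onto \<open>S1\<close> along \<open>S2\<close>; the grading is twice it minus the identity\<close>
  define p where "p \<phi> = (SOME \<phi>1. \<phi>1 \<in> S1 \<and> \<phi> - \<phi>1 \<in> S2)" for \<phi>
  have p: "p \<phi> \<in> S1" "\<phi> - p \<phi> \<in> S2" for \<phi>
  proof -
    obtain \<phi>1 \<phi>2 where "\<phi>1 \<in> S1" "\<phi>2 \<in> S2" "\<phi> = \<phi>1 + \<phi>2" using S1_plus_S2 by blast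
    then have "\<phi>1 \<in> S1 \<and> \<phi> - \<phi>1 \<in> S2" by simp
    from someI[of "\<lambda>\<phi>1. \<phi>1 \<in> S1 \<and> \<phi> - \<phi>1 \<in> S2", OF this]
    show "p \<phi> \<in> S1" "\<phi> - p \<phi> \<in> S2" by (auto simp: p_def)
  qed
  have p_eq: "p \<phi> = \<phi>1" if "\<phi>1 \<in> S1" "\<phi> - \<phi>1 \<in> S2" for \<phi> \<phi>1
    using decomp_unique[OF p(1)[of \<phi>] that(1) p(2)[of \<phi>] that(2)] by simp
  have "p (\<phi> + \<psi>) = p \<phi> + p \<psi>" for \<phi> \<psi>
    using p[of \<phi>] p[of \<psi>] S.subspace_add[OF sub_S2 p(2)[of \<phi>] p(2)[of \<psi>]]
    by (intro p_eq) (auto intro: S.subspace_add sub_S1 simp: algebra_simps)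
  moreover have "p (sS a \<phi>) = sS a (p \<phi>)" for a \<phi>
    using p[of \<phi>] S.subspace_scale[OF sub_S2 p(2)[of \<phi>], of a]
    by (intro p_eq) (auto intro: S.subspace_scale sub_S1 simp: S.scale_right_diff_distrib)
  ultimately have "Vector_Spaces.linear sS sS (\<lambda>\<phi>. p \<phi> + p \<phi> - \<phi>)"
    by (intro Vector_Spaces.linear_iff[THEN iffD2])
      (auto simp: S.vector_space_axioms S.scale_right_diff_distrib S.scale_right_distrib)
  then obtain \<gamma> where \<gamma>: "\<rho> \<gamma> = (\<lambda>\<phi>. p \<phi> + p \<phi> - \<phi>)" using rho_surj by blast
  have "p \<phi> = \<phi>" if "\<phi> \<in> S1" for \<phi>
    using that sub_S2 by (intro p_eq) (auto simp: S.subspace_0)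
  moreover have "p \<phi> = 0" if "\<phi> \<in> S2" for \<phi>
    using that sub_S1 by (intro p_eq) (auto simp: S.subspace_0)
  ultimately show ?thesis by (intro exI[of _ \<gamma>]) (simp add: \<gamma>)
qed

text \<open>In even dimension the volume element anticommutes with every generator, as the grading does, so their product
is central and therefore a scalar.\<close>

lemma volume: "\<exists>z. z \<noteq> 0 \<and> (\<forall>\<phi>\<in>S1. \<rho> (E UNIV) \<phi> = sS z \<phi>) \<and> (\<forall>\<phi>\<in>S2. \<rho> (E UNIV) \<phi> = - sS z \<phi>)"
proof -
  obtain \<gamma> where \<gamma>: "\<And>\<phi>. \<phi> \<in> S1 \<Longrightarrow> \<rho> \<gamma> \<phi> = \<phi>" "\<And>\<phi>. \<phi> \<in> S2 \<Longrightarrow> \<rho> \<gamma> \<phi> = - \<phi>"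
    using grading by blast
  have "e i * \<gamma> = - (\<gamma> * e i)" if i: "i < 2 * n" for i
  proof (rule rho_inj, rule ext)
    fix \<phi>
    obtain \<phi>1 \<phi>2 where "\<phi>1 \<in> S1" "\<phi>2 \<in> S2" "\<phi> = \<phi>1 + \<phi>2" using S1_plus_S2 by blast
    then show "\<rho> (e i * \<gamma>) \<phi> = \<rho> (- (\<gamma> * e i)) \<phi>"
      using e_S1[OF i] e_S2[OF i] by (simp add: rho_simps \<gamma>)
  qed
  moreover have "e i * E UNIV = - (E UNIV * e i)" if "i < 2 * n" for i
    using e_eprod[OF that, of "2 * n" UNIV] that by simp
  ultimately have "e i * (E UNIV * \<gamma>) = E UNIV * \<gamma> * e i" if "i < 2 * n" for i
    using that by (simp add: mult.assoc [symmetric]) (simp add: mult.assoc)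
  from central_scalar[OF generated[OF this]]
  obtain z where z: "\<And>\<phi>. \<rho> (E UNIV) (\<rho> \<gamma> \<phi>) = sS z \<phi>" by (auto simp: rho_mult)
  have 1: "\<rho> (E UNIV) \<phi> = sS z \<phi>" if "\<phi> \<in> S1" for \<phi>
    using z[of \<phi>] \<gamma> that by simp
  have 2: "\<rho> (E UNIV) \<phi> = - sS z \<phi>" if "\<phi> \<in> S2" for \<phi>
    using z[of \<phi>] \<gamma> that by (simp add: rho_simps minus_equation_iff)
  obtain \<phi> where \<phi>: "\<phi> \<in> S1" "\<phi> \<noteq> 0"
    using S1_nontrivial S.subspace_0[OF sub_S1] by blast
  have "z \<noteq> 0"
  proof
    assume "z = 0"
    then have "\<rho> (E_inv UNIV * E UNIV) \<phi> = 0" using 1[OF \<phi>(1)] by (simp add: rho_mult)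
    then show False using \<phi> by (simp add: eprod_inverse rho_1)
  qed
  with 1 2 show ?thesis by blast
qed

text \<open>The volume element is self-adjoint for \<open>B\<close>, because reversing a word of length 12 is an even permutation, and it
has opposite eigenvalues on \<open>S1\<close> and \<open>S2\<close>.\<close>

lemma B_S1_S2:
  assumes "\<phi> \<in> S1" "\<psi> \<in> S2"
  shows "B \<phi> \<psi> = 0" "B \<psi> \<phi> = 0"
proof -
  obtain z where z: "z \<noteq> 0" "\<rho> (E UNIV) \<phi> = sS z \<phi>" "\<rho> (E UNIV) \<psi> = - sS z \<psi>"
    using volume assms by blast
  have "reversal_sign 12 = (1::'k)" by (simp add: eval_nat_numeral)
  then have "z * B \<phi> \<psi> = - (z * B \<phi> \<psi>)"
    using B_E[of UNIV \<phi> \<psi>] z n6 by (simp add: B_simps)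
  then have "2 * (z * B \<phi> \<psi>) = 0" by (simp add: eq_neg_iff_add_eq_0)
  then show "B \<phi> \<psi> = 0" using z(1) two_neq_0 by simp
  then show "B \<psi> \<phi> = 0" using B_antisym[of \<psi> \<phi>] by simp
qed

lemma B_nondeg_S1:
  assumes "\<phi> \<in> S1" "\<phi> \<noteq> 0"
  shows "\<exists>\<psi>\<in>S1. B \<phi> \<psi> \<noteq> 0"
proof -
  obtain \<psi> where "B \<phi> \<psi> \<noteq> 0" using B_nondeg assms unfolding nondegenerate_def by blast
  moreover obtain \<psi>1 \<psi>2 where "\<psi>1 \<in> S1" "\<psi>2 \<in> S2" "\<psi> = \<psi>1 + \<psi>2" using S1_plus_S2 by blast
  ultimately show ?thesis using B_S1_S2[OF assms(1)] by (auto simp: B_simps)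
qed

section \<open>The exchange identity for the map into the Clifford algebra\<close>

definition L :: "'s \<Rightarrow> 's \<Rightarrow> 'c" where
  "L \<phi> \<psi> = sC (1 / 2) (\<Sum>j<2 * n. \<Sum>i<j.
     sC (eps i * eps j * B \<phi> (\<rho> (e j * e i) \<psi>)) (e i * e j))"

text \<open>The summand of the completeness relation for the functional \<open>B \<psi>\<close>.\<close>

abbreviation R :: "'s \<Rightarrow> 's \<Rightarrow> 's \<Rightarrow> nat set \<Rightarrow> 's" where
  "R \<psi> \<phi> \<theta> K \<equiv> sS (B \<psi> (\<rho> (E K) \<phi>)) (\<rho> (E_inv K) \<theta>)"

lemma two_L: "(\<Sum>j<2 * n. \<Sum>i<j. sS (eps i * eps j * B \<phi> (\<rho> (e j * e i) \<psi>)) (\<rho> (e i * e j) \<theta>)) =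
    sS 2 (\<rho> (L \<phi> \<psi>) \<theta>)"
  using two_neq_0 by (simp add: L_def rho_sum rho_scale)

text \<open>A sum over all ordered pairs is what contraction produces. Its off-diagonal part is twice the sum over \<open>i < j\<close>
since exchanging \<open>i\<close> and \<open>j\<close> changes the signs of both \<open>e\<^sub>i e\<^sub>j\<close> and \<open>e\<^sub>j e\<^sub>i\<close>, and the diagonal part is a multiple of \<open>B\<close>.\<close>

lemma sum_pairs_all:
  "(\<Sum>i<2 * n. \<Sum>j<2 * n. sS (eps i * eps j * B \<phi> (\<rho> (e j * e i) \<psi>)) (\<rho> (e i * e j) \<theta>)) =
    sS (of_nat (2 * n) * B \<phi> \<psi>) \<theta> + sS 4 (\<rho> (L \<phi> \<psi>) \<theta>)"
proof -
  define X where "X i j = (if i < 2 * n \<and> j < 2 * n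
    then sS (eps i * eps j * B \<phi> (\<rho> (e j * e i) \<psi>)) (\<rho> (e i * e j) \<theta>) else 0)" for i j
  have "X i j = X j i" for i j
  proof (cases "i < 2 * n \<and> j < 2 * n \<and> i \<noteq> j")
    case True
    then have "e i * e j = - (e j * e i)" by (intro e_anti) auto
    with True show ?thesis by (simp only: X_def) (simp add: rho_minus mult.commute)
  qed (auto simp: X_def)
  note sq = sum_lessThan_square[of X "2 * n", OF this]
  have diag: "X i i = sS (B \<phi> \<psi>) \<theta>" if "i < 2 * n" for i
  proof -
    have "sS (eps i * eps i * B \<phi> (\<rho> (e i * e i) \<psi>)) (\<rho> (e i * e i) \<theta>) =
        sS ((eps i * eps i) * (eps i * eps i) * B \<phi> \<psi>) \<theta>"
      by (simp only: e_sq[OF that] rho_scale rho_1 B_simps S.scale_scale mult_ac)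
    then show ?thesis using that by (simp add: X_def eps_sq)
  qed
  have "(\<Sum>j<2 * n. \<Sum>i<j. X i j) = sS 2 (\<rho> (L \<phi> \<psi>) \<theta>)"
    unfolding two_L [symmetric] by (intro sum.cong) (auto simp: X_def)
  moreover have "(\<Sum>i<2 * n. X i i) = sS (of_nat (2 * n) * B \<phi> \<psi>) \<theta>"
    by (simp add: diag S.scale_sum_left [symmetric])
  moreover have "sS 4 t = sS 2 t + sS 2 t" for t
    by (simp flip: S.scale_left_distrib)
  ultimately show ?thesis
    using sq by (simp add: X_def add.assoc)
qed

lemma contract_twice_E_inv:
  "contract (contract (E_inv K)) = sC ((of_nat (2 * n) - 2 * of_nat (card (K \<inter> {..<2 * n})))\<^sup>2) (E_inv K)"
proof -
  obtain s where "E_inv K = sC s (E K)" using eprod_inv_eq by blast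
  then show ?thesis by (simp add: contract_scale contract_twice_eprod mult.commute[of s])
qed

lemma contract_twice:
  "contract (contract c) = (\<Sum>i<2 * n. \<Sum>j<2 * n. sC (eps i * eps j) (e i * e j * c * (e j * e i)))"
  unfolding contract_def by (simp add: sum_distrib_left sum_distrib_right C.scale_sum_right mult.assoc)

text \<open>Expand \<open>B(\<psi>, e\<^sub>j e\<^sub>i \<theta>) \<phi>\<close> by the completeness relation: the pair \<open>e\<^sub>j e\<^sub>i\<close> moves next to \<open>e\<^sub>K\<inverse>\<close>, and summing over
\<open>i\<close> and \<open>j\<close> contracts \<open>e\<^sub>K\<inverse>\<close> twice.\<close>

lemma fierz_pairs:
  "sS (2 ^ n) (sS (of_nat (2 * n) * B \<psi> \<theta>) \<phi> + sS 4 (\<rho> (L \<psi> \<theta>) \<phi>)) =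
    (\<Sum>K\<in>subsets. sS ((of_nat (2 * n) - 2 * of_nat (card K))\<^sup>2) (R \<psi> \<phi> \<theta> K))"
proof -
  have "sS (2 ^ n) (sS (of_nat (2 * n) * B \<psi> \<theta>) \<phi> + sS 4 (\<rho> (L \<psi> \<theta>) \<phi>)) =
      (\<Sum>i<2 * n. \<Sum>j<2 * n. sS (eps i * eps j) (\<rho> (e i * e j) (sS (2 ^ n * B \<psi> (\<rho> (e j * e i) \<theta>)) \<phi>)))"
    unfolding sum_pairs_all [symmetric] by (simp add: S.scale_sum_right rho_simps ac_simps)
  also have "\<dots> = (\<Sum>i<2 * n. \<Sum>j<2 * n. \<Sum>K\<in>subsets.
      sS (eps i * eps j) (\<rho> (e i * e j) (sS (B \<psi> (\<rho> (E K) \<phi>)) (\<rho> (E_inv K) (\<rho> (e j * e i) \<theta>)))))"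
    by (simp only: fierz[OF B_functional(1), symmetric] rho.sum S.scale_sum_right)
  also have "\<dots> = (\<Sum>i<2 * n. \<Sum>K\<in>subsets. \<Sum>j<2 * n.
      sS (eps i * eps j) (\<rho> (e i * e j) (sS (B \<psi> (\<rho> (E K) \<phi>)) (\<rho> (E_inv K) (\<rho> (e j * e i) \<theta>)))))"
    by (intro sum.cong refl sum.swap)
  also have "\<dots> = (\<Sum>K\<in>subsets. \<Sum>i<2 * n. \<Sum>j<2 * n.
      sS (eps i * eps j) (\<rho> (e i * e j) (sS (B \<psi> (\<rho> (E K) \<phi>)) (\<rho> (E_inv K) (\<rho> (e j * e i) \<theta>)))))"
    by (rule sum.swap)
  also have "\<dots> = (\<Sum>K\<in>subsets. sS (B \<psi> (\<rho> (E K) \<phi>)) (\<rho> (contract (contract (E_inv K))) \<theta>))"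
    unfolding contract_twice by (simp add: rho_simps S.scale_sum_right ac_simps)
  also have "\<dots> = (\<Sum>K\<in>subsets. sS ((of_nat (2 * n) - 2 * of_nat (card K))\<^sup>2) (R \<psi> \<phi> \<theta> K))"
    unfolding contract_twice_E_inv
    by (intro sum.cong) (simp_all add: rho_scale Int_absorb2 mult.commute[of "B _ _"])
  finally show ?thesis .
qed

text \<open>The product over the complement of \<open>K\<close> is a multiple of the volume element times \<open>e\<^sub>K\<inverse>\<close>. The volume element acts on
\<open>S1\<close> by a scalar \<open>z\<close>, which occurs once with exponent 1 and once with exponent -1.\<close>

lemma R_compl:
  assumes "\<phi> \<in> S1" "\<theta> \<in> S1" "even (card (K \<inter> {..<2 * n}))"
  shows "R \<psi> \<phi> \<theta> (- K) = R \<psi> \<phi> \<theta> K"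
proof -
  obtain s where s: "s * s = 1" "E K * E (- K) = sC s (E UNIV)" using eprod_compl by blast
  obtain r where r: "r * r = 1" "E_inv K = sC r (E K)" using eprod_inv_eq by blast
  obtain z where z: "z \<noteq> 0" "\<And>\<phi>. \<phi> \<in> S1 \<Longrightarrow> \<rho> (E UNIV) \<phi> = sS z \<phi>" using volume by blast
  have inv: "\<rho> (E_inv K) (\<rho> (E K) \<phi>) = \<phi>" "\<rho> (E K) (\<rho> (E_inv K) \<phi>) = \<phi>" for K \<phi>
    by (simp_all add: eprod_inverse rho_1 flip: rho_mult)
  have E: "\<rho> (E (- K)) \<xi> = sS (s * z) (\<rho> (E_inv K) \<xi>)" if "\<xi> \<in> S1" for \<xi>
  proof -
    have "\<rho> (E (- K)) \<xi> = \<rho> (E_inv K) (\<rho> (E K * E (- K)) \<xi>)"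
      by (simp add: rho_mult inv)
    then show ?thesis using that by (simp add: s rho_simps z)
  qed
  have "\<rho> (E K) \<theta> \<in> S1" using eprod_half(1)[of "2 * n" \<theta> K] assms by simp
  from E[OF this] have "\<rho> (E (- K)) (\<rho> (E K) \<theta>) = sS (s * z) \<theta>" by (simp add: inv)
  then have "\<rho> (E_inv (- K)) (\<rho> (E (- K)) (\<rho> (E K) \<theta>)) = \<rho> (E_inv (- K)) (sS (s * z) \<theta>)"
    by (simp only:)
  then have "\<rho> (E K) \<theta> = sS (s * z) (\<rho> (E_inv (- K)) \<theta>)"
    by (simp only: inv rho.scale)
  then have "\<rho> (E_inv K) \<theta> = sS (r * (s * z)) (\<rho> (E_inv (- K)) \<theta>)"
    by (simp add: r rho_scale)
  moreover have "B \<psi> (\<rho> (E (- K)) \<phi>) = s * z * r * B \<psi> (\<rho> (E K) \<phi>)"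
    by (simp add: E assms r rho_scale B_simps)
  ultimately show ?thesis by (simp add: ac_simps)
qed

lemma R_swap: "R \<phi> \<psi> \<theta> K = sS (- reversal_sign (card (K \<inter> {..<2 * n}))) (R \<psi> \<phi> \<theta> K)"
  using B_antisym[of \<phi> "\<rho> (E K) \<psi>"] by (simp add: B_E)

lemma R_odd:
  assumes "\<psi> \<in> S1" "\<phi> \<in> S1" "odd (card (K \<inter> {..<2 * n}))"
  shows "R \<psi> \<phi> \<theta> K = 0"
  using eprod_half(1)[of "2 * n" \<phi> K] assms B_S1_S2 by simp

lemma sum_R_card_2: "(\<Sum>K\<in>subsets. if card K = 2 then R \<psi> \<phi> \<theta> K else 0) = sS 2 (\<rho> (L \<psi> \<phi>) \<theta>)"
  unfolding sum_Pow_card_2 two_L [symmetric]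
proof (intro sum.cong refl)
  fix i j assume "j \<in> {..<2 * n}" "i \<in> {..<j}"
  then have ij: "i < j" "i < 2 * n" "j < 2 * n" by auto
  then have 1: "e i * e j = - (e j * e i)" by (intro e_anti) auto
  show "R \<psi> \<phi> \<theta> {i, j} = sS (eps i * eps j * B \<psi> (\<rho> (e j * e i) \<phi>)) (\<rho> (e i * e j) \<theta>)"
    using ij by (simp add: eprod_pair e_inv_def 1 rho_minus rho_scale ac_simps)
qed

lemma sum_R_card_10:
  assumes "\<phi> \<in> S1" "\<theta> \<in> S1"
  shows "(\<Sum>K\<in>subsets. if card K = 10 then R \<psi> \<phi> \<theta> K else 0) = sS 2 (\<rho> (L \<psi> \<phi>) \<theta>)"
proof -
  have "(\<Sum>K\<in>subsets. if card K = 10 then R \<psi> \<phi> \<theta> K else 0) =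
      (\<Sum>K\<in>subsets. if card K = 2 then R \<psi> \<phi> \<theta> K else 0)"
  proof (rule sum.reindex_bij_witness[of _ "\<lambda>K. {..<2 * n} - K" "\<lambda>K. {..<2 * n} - K"])
    fix K assume "K \<in> subsets"
    then have K: "K \<subseteq> {..<2 * n}" "finite K" by (auto dest: finite_subset)
    have "card K \<le> 12" using card_mono[OF _ K(1)] n6 by simp
    moreover have "card ({..<2 * n} - K) = 12 - card K" using K n6 by (simp add: card_Diff_subset)
    ultimately have c: "card ({..<2 * n} - K) = 2 \<longleftrightarrow> card K = 10" by auto
    have "R \<psi> \<phi> \<theta> ({..<2 * n} - K) = R \<psi> \<phi> \<theta> K" if "card K = 10"
    proof -
      have "E ({..<2 * n} - K) = E (- K)" "E_inv ({..<2 * n} - K) = E_inv (- K)"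
        by (rule eprod_cong eprod_inv_cong; blast)+
      with R_compl[OF assms, of K \<psi>] that K show ?thesis by (simp add: Int_absorb2)
    qed
    with c show "(if card ({..<2 * n} - K) = 2 then R \<psi> \<phi> \<theta> ({..<2 * n} - K) else 0) =
      (if card K = 10 then R \<psi> \<phi> \<theta> K else 0)" by auto
  qed auto
  then show ?thesis by (simp add: sum_R_card_2)
qed

text \<open>Add \<open>fierz_pairs\<close> to its copy with \<open>\<phi>\<close> and \<open>\<psi>\<close> exchanged. By \<open>R_swap\<close> the summand of \<open>K\<close> gets the weight
\<open>(12 - 2|K|)\<^sup>2 (1 - r)\<close> with \<open>r\<close> the reversal sign of \<open>|K|\<close>; among even \<open>|K|\<close> this is nonzero only for 2 and 10,
where it is \<open>64 \<cdot> 2 = 128\<close>.\<close>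

lemma L_symmetrised:
  assumes "\<phi> \<in> S1" "\<psi> \<in> S1" "\<theta> \<in> S1"
  shows "\<rho> (L \<psi> \<theta>) \<phi> + \<rho> (L \<phi> \<theta>) \<psi> + sS 3 (sS (B \<psi> \<theta>) \<phi> + sS (B \<phi> \<theta>) \<psi>) = sS 2 (\<rho> (L \<psi> \<phi>) \<theta>)"
proof -
  let ?w = "\<lambda>K. (of_nat (2 * n) - 2 * of_nat (card K))\<^sup>2 :: 'k"
  have weight: "sS (?w K) (R \<psi> \<phi> \<theta> K) + sS (?w K) (R \<phi> \<psi> \<theta> K) =
      sS 128 (if card K = 2 then R \<psi> \<phi> \<theta> K else 0) + sS 128 (if card K = 10 then R \<psi> \<phi> \<theta> K else 0)"
    if "K \<in> subsets" for K
  proof (cases "even (card K)")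
    case False
    from that have "K \<inter> {..<2 * n} = K" by auto
    with False have "odd (card (K \<inter> {..<2 * n}))" by (simp only: not_False_eq_True)
    from R_odd[OF assms(2,1) this] R_odd[OF assms(1,2) this]
    have "R \<psi> \<phi> \<theta> K = 0" "R \<phi> \<psi> \<theta> K = 0" by this+
    moreover have "card K \<noteq> 2" "card K \<noteq> 10" using False by auto
    ultimately show ?thesis by (simp only: if_False S.scale_zero_right)
  next
    case True
    from that have K: "K \<inter> {..<2 * n} = K" by auto
    have "card K \<le> 12" using that card_mono[of "{..<2 * n}" K] n6 by simp
    with True have "card K \<in> {0, 2, 4, 6, 8, 10, 12}" by (simp, presburger)
    moreover have "sS (?w K) (R \<psi> \<phi> \<theta> K) + sS (?w K) (R \<phi> \<psi> \<theta> K) =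
        sS (?w K * (1 - reversal_sign (card K))) (R \<psi> \<phi> \<theta> K)"
    proof -
      have "sS (?w K) (R \<phi> \<psi> \<theta> K) = sS (- (?w K * reversal_sign (card K))) (R \<psi> \<phi> \<theta> K)"
        unfolding R_swap[of \<phi> K \<psi> \<theta>] by (simp add: K)
      moreover have "sS (w * (1 - r)) t = sS w t + sS (- (w * r)) t" for w r t
        by (simp add: right_diff_distrib S.scale_left_diff_distrib)
      ultimately show ?thesis by (simp only:)
    qed
    moreover have "reversal_sign 2 = (- 1 :: 'k)" "reversal_sign 4 = (1 :: 'k)"
        "reversal_sign 8 = (1 :: 'k)" "reversal_sign 10 = (- 1 :: 'k)" "reversal_sign 12 = (1 :: 'k)"
      by (simp_all add: eval_nat_numeral)
    ultimately show ?thesis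
      using n6 by (elim insertE) simp_all
  qed
  have "sS 64 (sS (12 * B \<psi> \<theta>) \<phi> + sS 4 (\<rho> (L \<psi> \<theta>) \<phi>)) + sS 64 (sS (12 * B \<phi> \<theta>) \<psi> + sS 4 (\<rho> (L \<phi> \<theta>) \<psi>))
     = (\<Sum>K\<in>subsets. sS (?w K) (R \<psi> \<phi> \<theta> K) + sS (?w K) (R \<phi> \<psi> \<theta> K))"
    using fierz_pairs[of \<psi> \<theta> \<phi>] fierz_pairs[of \<phi> \<theta> \<psi>] n6 by (simp add: sum.distrib)
  also have "\<dots> = (\<Sum>K\<in>subsets. sS 128 (if card K = 2 then R \<psi> \<phi> \<theta> K else 0) +
      sS 128 (if card K = 10 then R \<psi> \<phi> \<theta> K else 0))"
    by (rule sum.cong[OF refl weight])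
  also have "\<dots> = sS 128 (sS 2 (\<rho> (L \<psi> \<phi>) \<theta>)) + sS 128 (sS 2 (\<rho> (L \<psi> \<phi>) \<theta>))"
    by (simp only: sum.distrib S.scale_sum_right [symmetric] sum_R_card_2 sum_R_card_10[OF assms(1,3)])
  finally have "sS 256 (\<rho> (L \<psi> \<theta>) \<phi> + \<rho> (L \<phi> \<theta>) \<psi> + sS 3 (sS (B \<psi> \<theta>) \<phi> + sS (B \<phi> \<theta>) \<psi>)) =
      sS 256 (sS 2 (\<rho> (L \<psi> \<phi>) \<theta>))"
    by (simp add: S.scale_right_distrib algebra_simps flip: S.scale_left_distrib)
  moreover have "(256::'k) \<noteq> 0"
  proof -
    have "(256::'k) = 2 ^ 8" by simp
    then show ?thesis using two_neq_0 by (metis power_not_zero)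
  qed
  ultimately show ?thesis by (metis S.scale_cancel_left)
qed

lemma L_sym: "L \<phi> \<psi> = L \<psi> \<phi>"
proof -
  have "B \<phi> (\<rho> (e j * e i) \<psi>) = B \<psi> (\<rho> (e j * e i) \<phi>)" if "i < j" "j < 2 * n" for i j
  proof -
    have "B \<phi> (\<rho> (e j * e i) \<psi>) = B (\<rho> (e i * e j) \<phi>) \<psi>"
      using that by (simp add: rho_mult B_e)
    also have "\<dots> = - B \<psi> (\<rho> (e i * e j) \<phi>)" by (rule B_antisym)
    also have "\<dots> = B \<psi> (\<rho> (e j * e i) \<phi>)" using that e_anti[of i j] by (simp add: rho_minus)
    finally show ?thesis .
  qed
  then show ?thesis unfolding L_def by (intro arg_cong[of _ _ "sC _"] sum.cong refl) auto
qed

text \<open>Two instances of \<open>L_symmetrised\<close> have the same three terms \<open>L(\<cdot>,\<cdot>)\<cdot>\<close>; eliminating one of them leaves three times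
the difference of the other two.\<close>

theorem L_difference:
  assumes "\<phi> \<in> S1" "\<psi> \<in> S1" "\<theta> \<in> S1"
  shows "\<rho> (L \<psi> \<phi>) \<theta> - \<rho> (L \<phi> \<theta>) \<psi> = sS 2 (sS (B \<psi> \<theta>) \<phi>) + sS (B \<phi> \<theta>) \<psi> - sS (B \<phi> \<psi>) \<theta>"
proof -
  let ?a = "\<rho> (L \<psi> \<phi>) \<theta>" and ?b = "\<rho> (L \<phi> \<theta>) \<psi>" and ?c = "\<rho> (L \<psi> \<theta>) \<phi>"
  have 1: "?c + ?b + sS 3 (sS (B \<psi> \<theta>) \<phi> + sS (B \<phi> \<theta>) \<psi>) = ?a + ?a"
    using L_symmetrised[of \<phi> \<psi> \<theta>] assms S.scale_left_distrib[of 1 1 ?a] by simp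
  have 2: "?a + ?c + sS 3 (sS (B \<phi> \<psi>) \<theta> - sS (B \<psi> \<theta>) \<phi>) = ?b + ?b"
    using L_symmetrised[of \<theta> \<phi> \<psi>] assms S.scale_left_distrib[of 1 1 ?b] B_antisym[of \<theta> \<psi>]
    by (simp add: L_sym[of \<theta> \<psi>] L_sym[of \<theta> \<phi>] L_sym[of \<phi> \<psi>] add.commute)
  have eliminate: "(a - b) + (a - b) + (a - b) = (p + p + q - r) + (p + p + q - r) + (p + p + q - r)"
    if "c + b + ((p + q) + (p + q) + (p + q)) = a + a" and "a + c + ((r - p) + (r - p) + (r - p)) = b + b"
    for a b c p q r :: 's
  proof -
    have "c = a + a - b - ((p + q) + (p + q) + (p + q))" using that(1) by (simp add: algebra_simps)
    from that(2)[unfolded this] show ?thesis by (simp add: algebra_simps)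
  qed
  have s3: "sS 3 t = t + t + t" for t
    using S.scale_left_distrib[of 2 1 t] S.scale_left_distrib[of 1 1 t] by simp
  have "sS 3 (?a - ?b) = sS 3 (sS (B \<psi> \<theta>) \<phi> + sS (B \<psi> \<theta>) \<phi> + sS (B \<phi> \<theta>) \<psi> - sS (B \<phi> \<psi>) \<theta>)"
    using eliminate[OF 1[unfolded s3] 2[unfolded s3]] unfolding s3 by (simp add: algebra_simps)
  then have "?a - ?b = sS (B \<psi> \<theta>) \<phi> + sS (B \<psi> \<theta>) \<phi> + sS (B \<phi> \<theta>) \<psi> - sS (B \<phi> \<psi>) \<theta>"
    using three_neq_0 S.scale_cancel_left by blast
  then show ?thesis using S.scale_left_distrib[of 1 1 "sS (B \<psi> \<theta>) \<phi>"] by simp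
qed

end

section \<open>The orthogonal Lie algebra inside the Clifford algebra\<close>

lemma separating_functional:
  fixes s :: "'k::field \<Rightarrow> 'v::ab_group_add \<Rightarrow> 'v"
  assumes "vector_space s" "module.subspace s W" "x \<notin> W"
  shows "\<exists>f. Vector_Spaces.linear s (*) f \<and> (\<forall>w\<in>W. f w = 0) \<and> f x = 1"
proof -
  interpret V: vector_space s by fact
  interpret vector_space_pair s "(*) :: 'k \<Rightarrow> 'k \<Rightarrow> 'k"
    by (intro vector_space_pair.intro assms vector_space_over_itself.vector_space_axioms)
  obtain b where b: "b \<subseteq> W" "V.independent b" "W \<subseteq> V.span b"
    using V.maximal_independent_subset by blast
  have "V.span b \<subseteq> W" using b(1) assms(2) by (rule V.span_minimal)
  then have "x \<notin> V.span b" using assms(3) by blast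
  then have ind: "V.independent (insert x b)" and "x \<notin> b"
    using V.independent_insertI[OF _ b(2)] V.span_base by auto
  define h :: "'v \<Rightarrow> 'k" where "h y = (if y = x then 1 else 0)" for y
  obtain f where f: "Vector_Spaces.linear s (*) f" "\<forall>y\<in>insert x b. f y = h y"
    using linear_independent_extend[OF ind, of h] by blast
  interpret f: Vector_Spaces.linear s "(*)" f by fact
  have "f w = 0" if "w \<in> W" for w
  proof (rule f.eq_0_on_span[of b])
    show "w \<in> V.span b" using that b(3) by blast
    show "f y = 0" if "y \<in> b" for y using that f(2) \<open>x \<notin> b\<close> by (auto simp: h_def)
  qed
  moreover have "f x = 1" using f(2) by (simp add: h_def)
  ultimately show ?thesis using f(1) by blast
qed

context clifford_frame
begin

text \<open>The span of the products of two distinct generators is the space \<open>C\<^sup>2\<close> of the statement, a copy of the orthogonal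
Lie algebra.\<close>

definition pairs :: "'c set" where
  "pairs = {e i * e j | i j. i < j \<and> j < N}"

abbreviation "so \<equiv> C.span pairs"

lemma pair_in_so: "i < N \<Longrightarrow> j < N \<Longrightarrow> i \<noteq> j \<Longrightarrow> e i * e j \<in> so"
proof -
  have *: "e i * e j \<in> so" if "i < j" "j < N" for i j
    using that by (intro C.span_base) (auto simp: pairs_def)
  assume "i < N" "j < N" "i \<noteq> j"
  then show ?thesis
    using *[of i j] *[of j i] e_anti[of i j] C.span_neg[of "e j * e i"] by (cases i j rule: linorder_cases) auto
qed

lemma so_induct [consumes 1, case_names pair zero add scale]:
  assumes "A \<in> so"
    and "\<And>i j. i < j \<Longrightarrow> j < N \<Longrightarrow> P (e i * e j)"
    and "P 0" "\<And>A D. A \<in> so \<Longrightarrow> D \<in> so \<Longrightarrow> P A \<Longrightarrow> P D \<Longrightarrow> P (A + D)"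
    and "\<And>a A. A \<in> so \<Longrightarrow> P A \<Longrightarrow> P (sC a A)"
  shows "P A"
proof -
  have "A \<in> so \<and> P A"
    using assms(1)
  proof (rule C.span_induct)
    show "C.subspace {A. A \<in> so \<and> P A}"
      using assms(3-5) by (auto simp: C.subspace_def C.span_zero C.span_add C.span_scale)
  qed (use assms(2) in \<open>auto simp: pairs_def intro: C.span_base\<close>)
  then show ?thesis ..
qed

lemma finite_pairs: "finite pairs"
proof -
  have "pairs \<subseteq> (\<lambda>(i, j). e i * e j) ` ({..<N} \<times> {..<N})" by (auto simp: pairs_def)
  then show ?thesis by (rule finite_subset) simp
qed

lemma pair_vector_commutator:
  assumes "i < N" "j < N" "m < N" "i \<noteq> j"
  shows "e i * e j * e m - e m * (e i * e j) =
    sC (if j = m then 2 * eps m else 0) (e i) - sC (if i = m then 2 * eps m else 0) (e j)"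
proof -
  have two: "x + x = sC 2 x" for x using C.scale_left_distrib[of 1 1 x] by simp
  consider "j = m" | "i = m" | "i \<noteq> m" "j \<noteq> m" by blast
  then show ?thesis
  proof cases
    case 1
    have "e m * (e i * e m) = - sC (eps m) (e i)"
      using e_anti[of m i] assms 1 by (simp add: mult.assoc [symmetric]) (simp add: mult.assoc e_sq)
    then show ?thesis using 1 assms by (simp add: mult.assoc e_sq two mult.commute)
  next
    case 2
    have "e m * e j * e m = - sC (eps m) (e j)"
      using e_anti[of m j] assms 2 by (simp add: mult.assoc e_sq)
    moreover have "e m * (e m * e j) = sC (eps m) (e j)"
      using assms by (simp add: e_sq flip: mult.assoc)
    moreover have "- x - x = - sC 2 x" for x by (simp flip: two)
    ultimately show ?thesis using 2 assms by (simp add: mult.commute)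
  next
    case 3
    have "e m * (e i * e j) = - (e i * e m) * e j"
      using e_anti[of m i] assms 3 by (simp add: mult.assoc [symmetric])
    also have "\<dots> = e i * e j * e m"
      using e_anti[of m j] assms 3 by (simp add: mult.assoc)
    finally show ?thesis using 3 by simp
  qed
qed

abbreviation "vectors \<equiv> C.span (e ` {..<N})"

lemma so_vector: "A \<in> so \<Longrightarrow> m < N \<Longrightarrow> A * e m - e m * A \<in> vectors"
proof (induction A rule: so_induct)
  case (pair i j)
  then have ij: "i < N" "j < N" "m < N" "i \<noteq> j" by auto
  show ?case
    unfolding pair_vector_commutator[OF ij]
    by (intro C.span_diff C.span_scale C.span_base imageI) (use ij in auto)
next
  case (add A D)
  then have "(A * e m - e m * A) + (D * e m - e m * D) \<in> vectors" by (simp add: C.span_add)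
  then show ?case by (simp add: algebra_simps)
next
  case (scale a A)
  then have "sC a (A * e m - e m * A) \<in> vectors" by (simp add: C.span_scale)
  then show ?case by (simp add: C.scale_right_diff_distrib)
qed (simp add: C.span_zero)

lemma vector_commutator: "v \<in> vectors \<Longrightarrow> m < N \<Longrightarrow> v * e m - e m * v \<in> so"
proof (induction v rule: C.span_induct_alt)
  case base
  then show ?case by (simp add: C.span_zero)
next
  case (step a x y)
  then obtain i where i: "x = e i" "i < N" by auto
  have "x * e m - e m * x \<in> so"
    using i step.prems pair_in_so by (cases "i = m") (auto simp: C.span_zero intro: C.span_diff)
  then have "sC a (x * e m - e m * x) + (y * e m - e m * y) \<in> so"
    using step by (simp add: C.span_add C.span_scale)
  then show ?case by (simp add: algebra_simps C.scale_right_diff_distrib)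
qed

text \<open>An element of \<open>so\<close> acts on vectors by its commutator (\<open>so_vector\<close>), and commutators of vectors lie in \<open>so\<close>
(\<open>vector_commutator\<close>). As \<open>2 e\<^sub>i e\<^sub>j\<close> is the commutator of \<open>e\<^sub>i\<close> and \<open>e\<^sub>j\<close>, the derivation property of \<open>[A, \<cdot>]\<close> gives
closure.\<close>

lemma so_commutator:
  assumes "(2::'k) \<noteq> 0" "A \<in> so" "D \<in> so"
  shows "A * D - D * A \<in> so"
  using assms(3)
proof (induction D rule: so_induct)
  case (pair i j)
  let ?v = "A * e i - e i * A" and ?w = "A * e j - e j * A"
  have "?v \<in> vectors" "?w \<in> vectors" using pair assms(2) so_vector by auto
  then have "?v * e j - e j * ?v \<in> so" "?w * e i - e i * ?w \<in> so"
    using pair vector_commutator by auto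
  then have "(?v * e j - e j * ?v) - (?w * e i - e i * ?w) \<in> so"
    by (rule C.span_diff)
  moreover have "e j * e i = - (e i * e j)" using pair by (intro e_anti) auto
  then have "(?v * e j - e j * ?v) - (?w * e i - e i * ?w) = sC 2 (A * (e i * e j) - e i * e j * A)"
  proof -
    have "(?v * e j - e j * ?v) - (?w * e i - e i * ?w) =
        (A * (e i * e j) - e i * e j * A) - (A * (e j * e i) - e j * e i * A)"
      by (simp add: algebra_simps)
    also have "\<dots> = (A * (e i * e j) - e i * e j * A) + (A * (e i * e j) - e i * e j * A)"
      unfolding \<open>e j * e i = - (e i * e j)\<close> by simp
    finally show ?thesis using C.scale_left_distrib[of 1 1] by simp
  qed
  ultimately have "sC (1 / 2) (sC 2 (A * (e i * e j) - e i * e j * A)) \<in> so"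
    by (metis C.span_scale)
  then show ?case using assms(1) by simp
next
  case (add D D')
  then have "(A * D - D * A) + (A * D' - D' * A) \<in> so" by (simp add: C.span_add)
  then show ?case by (simp add: algebra_simps)
next
  case (scale a D)
  then have "sC a (A * D - D * A) \<in> so" by (simp add: C.span_scale)
  then show ?case by (simp add: C.scale_right_diff_distrib)
qed (simp add: C.span_zero)

lemma pair_double_commutator:
  assumes "i < j" "j < N" "p < m" "m < N"
  shows "(e i * e j * e m - e m * (e i * e j)) * e p + e p * (e i * e j * e m - e m * (e i * e j)) =
    sC (if i = p \<and> j = m then 4 * (eps p * eps m) else 0) 1"
proof -
  have two: "x + x = sC 2 x" for x using C.scale_left_distrib[of 1 1 x] by simp
  have anti: "e i * e p + e p * e i = sC (if i = p then 2 * eps p else 0) 1" if "i < N" "p < N" for i p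
    using that e_anti[of i p] e_sq[of p] by (auto simp: two)
  have ij: "i < N" "j < N" "m < N" "p < N" "i \<noteq> j" using assms by auto
  have "(sC a u - sC b v) * w + w * (sC a u - sC b v) = sC a (u * w + w * u) - sC b (v * w + w * v)"
    for a b u v w
    by (simp add: algebra_simps C.scale_right_distrib)
  then show ?thesis
    unfolding pair_vector_commutator[OF ij(1-3,5)] using assms
    by (auto simp: anti[OF ij(1,4)] anti[OF ij(2,4)] mult.commute)
qed

text \<open>The commutator with \<open>e\<^sub>m\<close> followed by the anticommutator with \<open>e\<^sub>p\<close> sends \<open>e\<^sub>p e\<^sub>m\<close> to a nonzero scalar and every other
product \<open>e\<^sub>i e\<^sub>j\<close> with \<open>i < j\<close> to 0, so it reads off one coefficient.\<close>

lemma pairs_independent: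
  assumes two: "(2::'k) \<noteq> 0" and "(\<Sum>j<N. \<Sum>i<j. sC (b i j) (e i * e j)) = 0" and pm: "p < m" "m < N"
  shows "b p m = 0"
proof -
  define T where "T X = (X * e m - e m * X) * e p + e p * (X * e m - e m * X)" for X
  have T_lin: "T (X + Y) = T X + T Y" "T (sC a X) = sC a (T X)" "T 0 = 0" for X Y a
    by (simp_all add: T_def algebra_simps C.scale_right_diff_distrib C.scale_right_distrib)
  have T_sum: "T (sum X I) = (\<Sum>i\<in>I. T (X i))" for X :: "nat \<Rightarrow> 'c" and I
    by (induction I rule: infinite_finite_induct) (auto simp: T_lin)
  have "0 = T (\<Sum>j<N. \<Sum>i<j. sC (b i j) (e i * e j))" using assms by (simp add: T_lin)
  also have "\<dots> = (\<Sum>j<N. \<Sum>i<j. sC (b i j) (T (e i * e j)))" by (simp add: T_sum T_lin)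
  also have "\<dots> = (\<Sum>j<N. \<Sum>i<j. if i = p then if j = m then sC (4 * (eps p * eps m) * b p m) 1 else 0 else 0)"
    unfolding T_def by (intro sum.cong refl) (subst pair_double_commutator, use pm in \<open>auto simp: mult.commute\<close>)
  also have "\<dots> = (\<Sum>j<N. if j = m then sC (4 * (eps p * eps m) * b p m) 1 else 0)"
    using pm by (intro sum.cong refl) auto
  also have "\<dots> = sC (4 * (eps p * eps m) * b p m) 1" using pm by simp
  finally have "4 * (eps p * eps m) * b p m = 0" by auto
  moreover have "(4::'k) = 2 * 2" by simp
  moreover have "eps p \<noteq> 0" "eps m \<noteq> 0" using eps_sq[of p] eps_sq[of m] pm by auto
  ultimately show ?thesis using two by (metis mult_eq_0_iff)
qed

text \<open>The tensor \<open>\<Sum>\<^sub>m \<plusminus> e\<^sub>m \<otimes> e\<^sub>m\<close> is invariant under the orthogonal Lie algebra; the bilinear map \<open>F\<close> stands for an arbitrary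
linear image of the tensor.\<close>

lemma so_invariance:
  assumes "A \<in> so"
    and F: "\<And>b. Vector_Spaces.linear sC sC (\<lambda>a. F a b)" "\<And>a. Vector_Spaces.linear sC sC (F a)"
  shows "(\<Sum>m<N. sC (eps m) (F (A * e m - e m * A) (e m))) = - (\<Sum>m<N. sC (eps m) (F (e m) (A * e m - e m * A)))"
proof -
  interpret F1: Vector_Spaces.linear sC sC "\<lambda>a. F a b" for b by (rule F)
  interpret F2: Vector_Spaces.linear sC sC "F a" for a by (rule F)
  show ?thesis
    using assms(1)
  proof (induction A rule: so_induct)
    case (pair i j)
    have delta: "(\<Sum>m<N. sC (eps m) (sC (if j = m then 2 * eps m else 0) (G m))) = sC 2 (G j)"
      if "j < N" for j G
    proof -
      have "(\<Sum>m<N. sC (eps m) (sC (if j = m then 2 * eps m else 0) (G m))) =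
          (\<Sum>m<N. if j = m then sC 2 (G m) else 0)"
        using eps_sq by (intro sum.cong) (auto simp: mult.left_commute)
      then show ?thesis using that by simp
    qed
    from pair have ij: "i < N" "j < N" "i \<noteq> j" by auto
    have "(\<Sum>m<N. sC (eps m) (F (e i * e j * e m - e m * (e i * e j)) (e m))) =
        sC 2 (F (e i) (e j)) - sC 2 (F (e j) (e i))"
      using ij delta[of j "\<lambda>m. F (e i) (e m)"] delta[of i "\<lambda>m. F (e j) (e m)"]
      by (simp add: pair_vector_commutator F1.diff F1.scale C.scale_right_diff_distrib sum_subtractf
        del: C.scale_scale)
    moreover have "(\<Sum>m<N. sC (eps m) (F (e m) (e i * e j * e m - e m * (e i * e j)))) =
        sC 2 (F (e j) (e i)) - sC 2 (F (e i) (e j))"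
      using ij delta[of j "\<lambda>m. F (e m) (e i)"] delta[of i "\<lambda>m. F (e m) (e j)"]
      by (simp add: pair_vector_commutator F2.diff F2.scale C.scale_right_diff_distrib sum_subtractf
        del: C.scale_scale)
    ultimately show ?case by simp
  next
    case zero
    show ?case by (simp add: F1.zero F2.zero)
  next
    case (add A D)
    have "(A + D) * e m - e m * (A + D) = (A * e m - e m * A) + (D * e m - e m * D)" for m
      by (simp add: algebra_simps)
    then show ?case
      using add by (simp only: F1.add F2.add C.scale_right_distrib sum.distrib) simp
  next
    case (scale a A)
    have "sC a A * e m - e m * sC a A = sC a (A * e m - e m * A)" for m
      by (simp add: C.scale_right_diff_distrib)
    then have "(\<Sum>m<N. sC (eps m) (F (sC a A * e m - e m * sC a A) (e m))) =
        sC a (\<Sum>m<N. sC (eps m) (F (A * e m - e m * A) (e m)))"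
      "(\<Sum>m<N. sC (eps m) (F (e m) (sC a A * e m - e m * sC a A))) =
        sC a (\<Sum>m<N. sC (eps m) (F (e m) (A * e m - e m * A)))"
      by (simp_all only: F1.scale F2.scale C.scale_sum_right C.scale_left_commute[of _ a])
    with scale show ?case by simp
  qed
qed

lemma pair_inj:
  assumes "(2::'k) \<noteq> 0" "i < j" "j < N" "p < m" "m < N" "e i * e j = e p * e m"
  shows "i = p \<and> j = m"
proof (rule ccontr)
  assume ne: "\<not> (i = p \<and> j = m)"
  have "sC 0 1 = sC (4 * (eps p * eps m)) 1"
    using pair_double_commutator[OF assms(2-5)] pair_double_commutator[OF assms(4,5) assms(4,5)] ne
    unfolding assms(6) by simp
  then have "4 * (eps p * eps m) = 0" by auto
  moreover have "(4::'k) = 2 * 2" by simp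
  moreover have "eps p \<noteq> 0" "eps m \<noteq> 0" using eps_sq[of p] eps_sq[of m] assms by auto
  ultimately show False using assms(1) by (metis mult_eq_0_iff)
qed

lemma contract_add: "contract (c + d) = contract c + contract d"
  by (simp add: contract_def distrib_left distrib_right C.scale_right_distrib sum.distrib)

definition pair_index :: "(nat \<times> nat) set" where
  "pair_index = (SIGMA j:{..<N}. {..<j})"

lemma pairs_image: "pairs = (\<lambda>(j, i). e i * e j) ` pair_index"
  by (auto simp: pairs_def pair_index_def image_iff)

lemma pairs_inj: "(2::'k) \<noteq> 0 \<Longrightarrow> inj_on (\<lambda>(j, i). e i * e j) pair_index"
  unfolding inj_on_def pair_index_def using pair_inj by force

lemma independent_pairs:
  assumes "(2::'k) \<noteq> 0"
  shows "C.independent pairs"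
proof (rule C.independent_if_scalars_zero)
  show "finite pairs" by (rule finite_pairs)
  fix f x
  assume 0: "(\<Sum>x\<in>pairs. sC (f x) x) = 0" and "x \<in> pairs"
  then obtain p m where pm: "p < m" "m < N" "x = e p * e m" by (auto simp: pairs_def)
  have "(\<Sum>x\<in>pairs. sC (f x) x) = (\<Sum>(j, i)\<in>pair_index. sC (f (e i * e j)) (e i * e j))"
    unfolding pairs_image using pairs_inj[OF assms] by (simp add: sum.reindex case_prod_unfold)
  also have "\<dots> = (\<Sum>j<N. \<Sum>i<j. sC (f (e i * e j)) (e i * e j))"
    unfolding pair_index_def by (simp add: sum.Sigma)
  finally have "(\<Sum>j<N. \<Sum>i<j. sC (f (e i * e j)) (e i * e j)) = 0" using 0 by simp
  from pairs_independent[OF assms this pm(1,2)] show "f x = 0" by (simp add: pm)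
qed

lemma card_pairs: "(2::'k) \<noteq> 0 \<Longrightarrow> card pairs = (\<Sum>j<N. j)"
  unfolding pairs_image by (simp add: card_image pairs_inj) (simp add: pair_index_def)

end

section \<open>Equivariance and span of the map into the Clifford algebra\<close>

context spin_norm
begin

lemma so_S1: "A \<in> so \<Longrightarrow> \<phi> \<in> S1 \<Longrightarrow> \<rho> A \<phi> \<in> S1"
proof (induction A rule: so_induct)
  case (pair i j)
  then show ?case using e_S1[of j \<phi>] e_S2[of i] by (simp add: rho_mult)
qed (auto simp: rho_simps S.subspace_0[OF sub_S1] S.subspace_add[OF sub_S1] S.subspace_scale[OF sub_S1])

lemma so_B: "A \<in> so \<Longrightarrow> B (\<rho> A \<phi>) \<psi> = - B \<phi> (\<rho> A \<psi>)"
proof (induction A rule: so_induct)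
  case (pair i j)
  then have "B (\<rho> (e i * e j) \<phi>) \<psi> = B \<phi> (\<rho> (e j * e i) \<psi>)" by (simp add: rho_mult B_e)
  also have "e j * e i = - (e i * e j)" using pair by (intro e_anti) auto
  finally show ?case by (simp add: rho_minus)
qed (auto simp: rho_simps B_simps)

lemma L_in_so: "L \<phi> \<psi> \<in> so"
  unfolding L_def by (intro C.span_scale C.span_sum pair_in_so) auto

lemma L_add1: "L (\<phi> + \<phi>') \<psi> = L \<phi> \<psi> + L \<phi>' \<psi>"
  by (simp add: L_def B_simps distrib_left C.scale_left_distrib sum.distrib C.scale_right_distrib)

lemma L_scale1: "L (sS a \<phi>) \<psi> = sC a (L \<phi> \<psi>)"
  by (simp add: L_def B_simps C.scale_sum_right mult.left_commute[of a])

lemma L_add2: "L \<psi> (\<phi> + \<phi>') = L \<psi> \<phi> + L \<psi> \<phi>'" and L_scale2: "L \<psi> (sS a \<phi>) = sC a (L \<psi> \<phi>)"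
  by (simp_all add: L_sym[of \<psi>] L_add1 L_scale1)

text \<open>Contraction multiplies \<open>so\<close> by \<open>12 - 4 = 8\<close>. If \<open>A\<close> kills \<open>S1\<close>, then \<open>e\<^sub>i A e\<^sub>i\<close> kills \<open>S2\<close> because \<open>e\<^sub>i\<close> maps \<open>S2\<close> into
\<open>S1\<close>, so \<open>8 A\<close> kills \<open>S2\<close> as well.\<close>

lemma so_faithful:
  assumes A: "A \<in> so" and kill: "\<And>\<phi>. \<phi> \<in> S1 \<Longrightarrow> \<rho> A \<phi> = 0"
  shows "A = 0"
proof -
  have "contract A = sC 8 A"
    using A
  proof (induction A rule: so_induct)
    case (pair i j)
    then show ?case
      using contract_eprod[of "{i, j}"] eprod_pair(1)[of i j "2 * n"] n6
      by (simp add: Int_absorb2)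
  next
    case zero
    show ?case by (simp add: contract_def)
  next
    case (add A D)
    then show ?case
      by (simp add: C.scale_right_distrib contract_add)
  next
    case (scale a A)
    then show ?case by (simp add: contract_scale mult.commute[of a])
  qed
  have "\<rho> A \<phi> = 0" if "\<phi> \<in> S2" for \<phi>
  proof -
    have "\<rho> (contract A) \<phi> = (\<Sum>i<2 * n. sS (eps i) (\<rho> (e i) (\<rho> A (\<rho> (e i) \<phi>))))"
      by (simp add: contract_def rho_simps)
    also have "\<dots> = 0" using that e_S2 kill by (intro sum.neutral) (auto simp: rho.zero)
    finally have "sS 8 (\<rho> A \<phi>) = 0" unfolding \<open>contract A = sC 8 A\<close> by (simp add: rho_scale)
    moreover have "(8::'k) \<noteq> 0"
    proof -
      have "(8::'k) = 2 ^ 3" by simp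
      then show ?thesis using two_neq_0 by (metis power_not_zero)
    qed
    ultimately show ?thesis by simp
  qed
  then have "\<rho> A \<phi> = \<rho> 0 \<phi>" for \<phi>
    using S1_plus_S2[of \<phi>] kill by (auto simp: rho.add)
  then show ?thesis by (intro rho_inj) auto
qed

text \<open>Up to a multiple of 1 this is \<open>4 L\<close>. Being a sum over independent indices \<open>i\<close> and \<open>j\<close>, it is the image of two copies of
the invariant tensor of \<open>so_invariance\<close>, from which its equivariance follows.\<close>

definition pair_sum :: "'s \<Rightarrow> 's \<Rightarrow> 'c" where
  "pair_sum \<phi> \<psi> = (\<Sum>i<2 * n. sC (eps i) (\<Sum>j<2 * n. sC (eps j) (sC (B \<phi> (\<rho> (e j * e i) \<psi>)) (e i * e j))))"

lemma pair_sum_L: "pair_sum \<phi> \<psi> = sC (of_nat (2 * n) * B \<phi> \<psi>) 1 + sC 4 (L \<phi> \<psi>)"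
proof (rule rho_inj, rule ext)
  fix \<theta>
  show "\<rho> (pair_sum \<phi> \<psi>) \<theta> = \<rho> (sC (of_nat (2 * n) * B \<phi> \<psi>) 1 + sC 4 (L \<phi> \<psi>)) \<theta>"
    using sum_pairs_all[of \<phi> \<psi> \<theta>]
    by (simp add: pair_sum_def rho_sum rho_scale S.scale_sum_right rho_add rho_1 mult.assoc)
qed

lemma pair_sum_equivariant:
  assumes "A \<in> so"
  shows "A * pair_sum \<phi> \<psi> - pair_sum \<phi> \<psi> * A = pair_sum (\<rho> A \<phi>) \<psi> + pair_sum \<phi> (\<rho> A \<psi>)"
proof -
  define c where "c m = A * e m - e m * A" for m
  have inv1: "(\<Sum>i<2 * n. sC (eps i) (sC (B \<phi> (\<rho> (e j * e i) \<psi>)) (c i * e j))) =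
      - (\<Sum>i<2 * n. sC (eps i) (sC (B \<phi> (\<rho> (e j * c i) \<psi>)) (e i * e j)))" for j
    unfolding c_def
    by (rule so_invariance[OF assms, where F = "\<lambda>a b. sC (B \<phi> (\<rho> (e j * b) \<psi>)) (a * e j)"];
      intro Vector_Spaces.linear_iff[THEN iffD2] conjI allI C.vector_space_axioms)
      (simp_all add: algebra_simps C.scale_right_distrib C.scale_left_distrib rho_simps B_simps)
  have inv2: "(\<Sum>j<2 * n. sC (eps j) (sC (B \<phi> (\<rho> (e j * e i) \<psi>)) (e i * c j))) =
      - (\<Sum>j<2 * n. sC (eps j) (sC (B \<phi> (\<rho> (c j * e i) \<psi>)) (e i * e j)))" for i
  proof -
    have "- (\<Sum>j<2 * n. sC (eps j) (sC (B \<phi> (\<rho> (e j * e i) \<psi>)) (e i * c j))) =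
      (\<Sum>j<2 * n. sC (eps j) (sC (B \<phi> (\<rho> (c j * e i) \<psi>)) (e i * e j)))"
      unfolding c_def
      by (rule so_invariance[OF assms, where F = "\<lambda>b a. sC (B \<phi> (\<rho> (b * e i) \<psi>)) (e i * a)", symmetric];
        intro Vector_Spaces.linear_iff[THEN iffD2] conjI allI C.vector_space_axioms)
        (simp_all add: algebra_simps C.scale_right_distrib C.scale_left_distrib rho_simps B_simps)
    from this [symmetric] show ?thesis by (simp only: minus_minus)
  qed
  have "A * pair_sum \<phi> \<psi> - pair_sum \<phi> \<psi> * A =
      (\<Sum>i<2 * n. \<Sum>j<2 * n. sC (eps i) (sC (eps j) (sC (B \<phi> (\<rho> (e j * e i) \<psi>)) (A * (e i * e j) - e i * e j * A))))"
    by (simp add: pair_sum_def sum_distrib_left sum_distrib_right C.scale_sum_right C.scale_right_diff_distrib sum_subtractf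
      mult.assoc)
  also have "\<dots> = (\<Sum>i<2 * n. \<Sum>j<2 * n. sC (eps i) (sC (eps j) (sC (B \<phi> (\<rho> (e j * e i) \<psi>)) (c i * e j)))) +
      (\<Sum>i<2 * n. \<Sum>j<2 * n. sC (eps i) (sC (eps j) (sC (B \<phi> (\<rho> (e j * e i) \<psi>)) (e i * c j))))"
  proof -
    have "A * (e i * e j) - e i * e j * A = c i * e j + e i * c j" for i j
      by (simp add: c_def algebra_simps)
    then show ?thesis by (simp only: C.scale_right_distrib sum.distrib)
  qed
  also have "(\<Sum>i<2 * n. \<Sum>j<2 * n. sC (eps i) (sC (eps j) (sC (B \<phi> (\<rho> (e j * e i) \<psi>)) (c i * e j)))) =
      (\<Sum>j<2 * n. sC (eps j) (\<Sum>i<2 * n. sC (eps i) (sC (B \<phi> (\<rho> (e j * e i) \<psi>)) (c i * e j))))"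
    by (subst sum.swap) (simp only: C.scale_sum_right C.scale_left_commute)
  also have "\<dots> = (\<Sum>j<2 * n. \<Sum>i<2 * n. - sC (eps j) (sC (eps i) (sC (B \<phi> (\<rho> (e j * c i) \<psi>)) (e i * e j))))"
    unfolding inv1 by (simp only: C.scale_sum_right C.scale_minus_right sum_negf)
  also have "\<dots> = (\<Sum>i<2 * n. \<Sum>j<2 * n. - sC (eps i) (sC (eps j) (sC (B \<phi> (\<rho> (e j * c i) \<psi>)) (e i * e j))))"
    by (subst sum.swap) (simp only: C.scale_left_commute)
  also have "(\<Sum>i<2 * n. \<Sum>j<2 * n. sC (eps i) (sC (eps j) (sC (B \<phi> (\<rho> (e j * e i) \<psi>)) (e i * c j)))) =
     (\<Sum>i<2 * n. \<Sum>j<2 * n. - sC (eps i) (sC (eps j) (sC (B \<phi> (\<rho> (c j * e i) \<psi>)) (e i * e j))))"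
    by (simp only: C.scale_sum_right [symmetric] inv2 C.scale_minus_right sum_negf)
  also have "(\<Sum>i<2 * n. \<Sum>j<2 * n. - sC (eps i) (sC (eps j) (sC (B \<phi> (\<rho> (e j * c i) \<psi>)) (e i * e j)))) +
      (\<Sum>i<2 * n. \<Sum>j<2 * n. - sC (eps i) (sC (eps j) (sC (B \<phi> (\<rho> (c j * e i) \<psi>)) (e i * e j)))) =
    pair_sum (\<rho> A \<phi>) \<psi> + pair_sum \<phi> (\<rho> A \<psi>)"
  proof -
    have "- B \<phi> (\<rho> (e j * c i) \<psi>) - B \<phi> (\<rho> (c j * e i) \<psi>) =
        B (\<rho> A \<phi>) (\<rho> (e j * e i) \<psi>) + B \<phi> (\<rho> (e j * e i) (\<rho> A \<psi>))" for i j
    proof -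
      have "e j * c i + c j * e i = A * (e j * e i) - e j * e i * A"
        by (simp add: c_def algebra_simps)
      then have "B \<phi> (\<rho> (e j * c i) \<psi>) + B \<phi> (\<rho> (c j * e i) \<psi>) =
          B \<phi> (\<rho> (A * (e j * e i) - e j * e i * A) \<psi>)"
        by (metis rho_add B_simps(2))
      also have "\<dots> = B \<phi> (\<rho> A (\<rho> (e j * e i) \<psi>)) - B \<phi> (\<rho> (e j * e i) (\<rho> A \<psi>))"
        by (simp only: rho_diff rho_mult) (simp only: diff_conv_add_uminus B_simps B_minus)
      finally show ?thesis using so_B[OF assms] by (simp add: algebra_simps)
    qed
    then have *: "- sC (B \<phi> (\<rho> (e j * c i) \<psi>)) (e i * e j) - sC (B \<phi> (\<rho> (c j * e i) \<psi>)) (e i * e j) =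
       sC (B (\<rho> A \<phi>) (\<rho> (e j * e i) \<psi>)) (e i * e j) + sC (B \<phi> (\<rho> (e j * e i) (\<rho> A \<psi>))) (e i * e j)" for i j
      by (metis C.scale_left_diff_distrib C.scale_left_distrib C.scale_minus_left)
    have "- sC (eps i) (sC (eps j) (sC (B \<phi> (\<rho> (e j * c i) \<psi>)) (e i * e j))) +
        - sC (eps i) (sC (eps j) (sC (B \<phi> (\<rho> (c j * e i) \<psi>)) (e i * e j))) =
       sC (eps i) (sC (eps j) (sC (B (\<rho> A \<phi>) (\<rho> (e j * e i) \<psi>)) (e i * e j))) +
       sC (eps i) (sC (eps j) (sC (B \<phi> (\<rho> (e j * e i) (\<rho> A \<psi>))) (e i * e j)))" for i j
      using arg_cong[OF *[of j i], of "\<lambda>t. sC (eps i) (sC (eps j) t)"]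
      by (simp only: C.scale_right_distrib C.scale_right_diff_distrib C.scale_minus_right diff_conv_add_uminus)
    then show ?thesis
      unfolding pair_sum_def C.scale_sum_right by (simp only: sum.distrib [symmetric])
  qed
  finally show ?thesis .
qed

lemma L_equivariant:
  assumes "A \<in> so"
  shows "A * L \<phi> \<psi> - L \<phi> \<psi> * A = L (\<rho> A \<phi>) \<psi> + L \<phi> (\<rho> A \<psi>)"
proof -
  have "sC (of_nat (2 * n) * B (\<rho> A \<phi>) \<psi>) 1 + sC (of_nat (2 * n) * B \<phi> (\<rho> A \<psi>)) 1 = (0::'c)"
    by (simp add: so_B[OF assms])
  then have "sC 4 (A * L \<phi> \<psi> - L \<phi> \<psi> * A) = sC 4 (L (\<rho> A \<phi>) \<psi> + L \<phi> (\<rho> A \<psi>))"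
    using pair_sum_equivariant[OF assms, of \<phi> \<psi>] unfolding pair_sum_L
    by (simp add: algebra_simps C.scale_right_diff_distrib C.scale_right_distrib)
  moreover have "(4::'k) \<noteq> 0" 
  proof -
    have "(4::'k) = 2 * 2" by simp
    then show ?thesis using two_neq_0 by (metis mult_eq_0_iff)
  qed
  ultimately show ?thesis by (metis C.scale_cancel_left)
qed

text \<open>Otherwise some linear functional \<open>f\<close> vanishes on all \<open>L \<phi> \<psi>\<close> but not on all of \<open>so\<close>. The coefficients of \<open>L \<phi> \<psi>\<close> are
the numbers \<open>B(\<phi>, e\<^sub>j e\<^sub>i \<psi>)\<close> up to sign and the factor 1/2, so \<open>f(L \<phi> \<psi>)\<close> is half of \<open>B(\<phi>, A \<psi>)\<close> for the
element \<open>A\<close> of \<open>so\<close> whose coefficients are, up to sign, the values of \<open>f\<close>. Then \<open>A\<close> kills \<open>S1\<close>, hence \<open>A = 0\<close> by faithfulness, hence \<open>f = 0\<close> on \<open>so\<close>.\<close>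

lemma L_spans:
  assumes W: "C.subspace W" and L: "\<And>\<phi> \<psi>. \<phi> \<in> S1 \<Longrightarrow> \<psi> \<in> S1 \<Longrightarrow> L \<phi> \<psi> \<in> W"
  shows "so \<subseteq> W"
proof (rule C.span_minimal[OF _ W], rule subsetI, rule ccontr)
  fix x assume "x \<in> pairs" "x \<notin> W"
  then obtain p m where pm: "p < m" "m < 2 * n" "x = e p * e m" by (auto simp: pairs_def)
  obtain f where f: "Vector_Spaces.linear sC (*) f" "\<And>w. w \<in> W \<Longrightarrow> f w = 0" "f x = 1"
    using separating_functional[OF C.vector_space_axioms W \<open>x \<notin> W\<close>] by blast
  interpret f: Vector_Spaces.linear sC "(*)" f by (rule f)
  define A where "A = (\<Sum>j<2 * n. \<Sum>i<j. sC (eps i * eps j * f (e i * e j)) (e j * e i))"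
  have A: "A \<in> so" unfolding A_def by (intro C.span_sum C.span_scale pair_in_so) auto
  have "\<rho> A \<psi> = 0" if \<psi>: "\<psi> \<in> S1" for \<psi>
  proof (rule ccontr)
    assume "\<rho> A \<psi> \<noteq> 0"
    then obtain \<phi> where \<phi>: "\<phi> \<in> S1" "B (\<rho> A \<psi>) \<phi> \<noteq> 0"
      using B_nondeg_S1 so_S1[OF A \<psi>] by blast
    have "B \<phi> (\<rho> A \<psi>) = 2 * f (L \<phi> \<psi>)"
      using two_neq_0 by (simp add: A_def L_def rho_sum rho_scale B_simps f.sum f.scale ac_simps)
    then show False using f(2)[OF L[OF \<phi>(1) \<psi>]] \<phi>(2) B_antisym[of "\<rho> A \<psi>" \<phi>] by simp
  qed
  then have "A = 0" using so_faithful[OF A] by blast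
  moreover have "A = (\<Sum>j<2 * n. \<Sum>i<j. sC (- (eps i * eps j * f (e i * e j))) (e i * e j))"
    unfolding A_def
  proof (intro sum.cong refl)
    fix i j assume "j \<in> {..<2 * n}" "i \<in> {..<j}"
    then have "e j * e i = - (e i * e j)" by (intro e_anti) auto
    then show "sC (eps i * eps j * f (e i * e j)) (e j * e i) = sC (- (eps i * eps j * f (e i * e j))) (e i * e j)"
      by simp
  qed
  ultimately have "eps p * eps m * f (e p * e m) = 0"
    using pairs_independent[OF two_neq_0 _ pm(1,2), of "\<lambda>i j. - (eps i * eps j * f (e i * e j))"] by simp
  moreover have "eps p \<noteq> 0" "eps m \<noteq> 0" using eps_sq[of p] eps_sq[of m] pm by auto
  ultimately show False using f(3) pm by simp
qed

end

section \<open>Dimensions of products\<close>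

text \<open>Unlike \<open>dim V = d\<close>, this includes finiteness also for \<open>d = 0\<close> and is stable under products of subspaces of possibly
infinite-dimensional spaces.\<close>

definition has_basis_of_card :: "('k::field \<Rightarrow> 'v::ab_group_add \<Rightarrow> 'v) \<Rightarrow> 'v set \<Rightarrow> nat \<Rightarrow> bool" where
  "has_basis_of_card s V d \<longleftrightarrow>
     (\<exists>b. finite b \<and> \<not> module.dependent s b \<and> module.span s b = V \<and> card b = d)"

lemma (in vector_space) dim_has_basis: "has_basis_of_card scale V d \<Longrightarrow> dim V = d"
  unfolding has_basis_of_card_def using dim_span_eq_card_independent by blast

lemma (in vector_space) has_basis_subspace:
  assumes "subspace V" "dim V = d" "d \<noteq> 0"
  shows "has_basis_of_card scale V d"
proof -
  obtain b where b: "b \<subseteq> V" "independent b" "V \<subseteq> span b" "card b = dim V"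
    using basis_exists by blast
  moreover have "span b = V" using b(1,3) assms(1) by (simp add: span_minimal subset_antisym)
  moreover have "finite b" using b(4) assms(2,3) card.infinite by fastforce
  ultimately show ?thesis using assms(2) unfolding has_basis_of_card_def by auto
qed

lemma (in vector_space_prod) has_basis_Times:
  assumes "has_basis_of_card s1 V d" "has_basis_of_card s2 W m"
  shows "has_basis_of_card scale (V \<times> W) (d + m)"
proof -
  obtain a where a: "finite a" "vs1.independent a" "vs1.span a = V" "card a = d"
    using assms(1) unfolding has_basis_of_card_def by blast
  obtain b where b: "finite b" "vs2.independent b" "vs2.span b = W" "card b = m"
    using assms(2) unfolding has_basis_of_card_def by blast
  have "a \<times> {0} \<inter> {0} \<times> b = {}" using a(2) vs1.dependent_zero by auto
  then have card: "card (a \<times> {0} \<union> {0} \<times> b) = d + m"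
    using a b by (subst card_Un_disjoint) (auto simp: card_cartesian_product)
  have span: "p.span (a \<times> {0} \<union> {0} \<times> b) = V \<times> W"
    unfolding p.span_Un span_Times_sing1 span_Times_sing2 a(3) b(3)
    by (force simp: set_eq_iff)
  have "p.independent (a \<times> {0} \<union> {0} \<times> b)"
  proof (rule p.independent_if_scalars_zero)
    fix f x
    assume 0: "(\<Sum>x\<in>a \<times> {0} \<union> {0} \<times> b. scale (f x) x) = 0" and x: "x \<in> a \<times> {0} \<union> {0} \<times> b"
    have "(\<Sum>x\<in>a \<times> {0} \<union> {0} \<times> b. scale (f x) x) =
        (\<Sum>x\<in>a \<times> {0}. scale (f x) x) + (\<Sum>x\<in>{0} \<times> b. scale (f x) x)"
      using a b \<open>a \<times> {0} \<inter> {0} \<times> b = {}\<close> by (intro sum.union_disjoint) auto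
    also have "(\<Sum>x\<in>a \<times> {0}. scale (f x) x) = (\<Sum>u\<in>a. (s1 (f (u, 0)) u, 0))"
      by (rule sum.reindex_bij_witness[of _ "\<lambda>u. (u, 0)" fst]) (auto simp: scale_prod)
    also have "(\<Sum>x\<in>{0} \<times> b. scale (f x) x) = (\<Sum>u\<in>b. (0, s2 (f (0, u)) u))"
      by (rule sum.reindex_bij_witness[of _ "\<lambda>u. (0, u)" snd]) (auto simp: scale_prod)
    finally have "(\<Sum>u\<in>a. s1 (f (u, 0)) u) = 0" "(\<Sum>u\<in>b. s2 (f (0, u)) u) = 0"
      using 0 by (auto simp: sum_prod zero_prod_def)
    with vs1.independentD[OF a(2,1) order_refl] vs2.independentD[OF b(2,1) order_refl] x
    show "f x = 0" by auto
  qed (use a b in auto)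
  with span card a b show ?thesis unfolding has_basis_of_card_def
    by (intro exI[of _ "a \<times> {0} \<union> {0} \<times> b"]) auto
qed

lemma (in vector_space_pair) dim_range_inj:
  assumes f: "Vector_Spaces.linear s1 s2 f" "inj f"
  shows "vs2.dim (range f) = vs1.dim UNIV"
proof -
  interpret f: Vector_Spaces.linear s1 s2 f by fact
  obtain b where b: "vs1.independent b" "UNIV \<subseteq> vs1.span b" "card b = vs1.dim UNIV"
    using vs1.basis_exists by blast
  have "inj_on f (vs1.span b)" using f(2) by (rule inj_on_subset) simp
  then have "vs2.independent (f ` b)"
    using f.independent_injective_image b(1) by blast
  moreover have "vs2.span (f ` b) = range f"
    using b(2) unfolding f.span_image by blast
  ultimately have "vs2.dim (range f) = card (f ` b)"
    by (metis vs2.dim_span_eq_card_independent)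
  also have "\<dots> = card b" using f(2) by (metis card_image inj_on_subset subset_UNIV)
  finally show ?thesis using b(3) by simp
qed

section \<open>Maps out of a presented vector space\<close>

lemma linear_linear_extension:
  fixes s :: "'k::field \<Rightarrow> 'm::ab_group_add \<Rightarrow> 'm" and h :: "'a \<Rightarrow> 'm"
  assumes "vector_space s"
  shows "Vector_Spaces.linear free_scale s (linear_extension s h)"
proof -
  interpret vector_space s by fact
  have ext: "linear_extension s h f = (\<Sum>a\<in>K. s (Poly_Mapping.lookup f a) (h a))"
    if "finite K" "Poly_Mapping.keys f \<subseteq> K" for f :: "'a \<Rightarrow>\<^sub>0 'k" and K
    unfolding linear_extension_def using that
    by (intro sum.mono_neutral_left) (auto simp: not_in_keys_iff_lookup_eq_zero)
  show ?thesis
  proof (intro Vector_Spaces.linear_iff[THEN iffD2] conjI allI vector_space_free_scale assms)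
    fix f g :: "'a \<Rightarrow>\<^sub>0 'k"
    let ?K = "Poly_Mapping.keys f \<union> Poly_Mapping.keys g"
    have "Poly_Mapping.keys (f + g) \<subseteq> ?K" by (rule Poly_Mapping.keys_add)
    then show "linear_extension s h (f + g) = linear_extension s h f + linear_extension s h g"
      by (simp add: ext[of ?K] lookup_add scale_left_distrib sum.distrib)
  next
    fix c and f :: "'a \<Rightarrow>\<^sub>0 'k"
    have "Poly_Mapping.keys (free_scale c f) \<subseteq> Poly_Mapping.keys f"
      by (auto simp: in_keys_iff)
    then show "linear_extension s h (free_scale c f) = s c (linear_extension s h f)"
      by (simp add: ext[of "Poly_Mapping.keys f"] scale_sum_right)
  qed
qed

lemma linear_extension_single:
  assumes "vector_space s"
  shows "linear_extension s h (Poly_Mapping.single a c) = s c (h a)"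
proof -
  interpret vector_space s by fact
  show ?thesis by (simp add: linear_extension_def)
qed

lemma linear_extension_simps:
  assumes "vector_space s"
  shows "linear_extension s h (f + g) = linear_extension s h f + linear_extension s h g"
    and "linear_extension s h (f - g) = linear_extension s h f - linear_extension s h g"
proof -
  interpret Vector_Spaces.linear free_scale s "linear_extension s h"
    by (rule linear_linear_extension[OF assms])
  show "linear_extension s h (f + g) = linear_extension s h f + linear_extension s h g"
    "linear_extension s h (f - g) = linear_extension s h f - linear_extension s h g"
    by (rule add diff)+
qed

lemma presented_by_kernel:
  assumes "presented_by s b A R"
  shows "f \<in> module.span free_scale R \<longleftrightarrow> Poly_Mapping.keys f \<subseteq> A \<and> linear_extension s b f = 0"
  using assms by (simp add: presented_by_def set_eq_iff)

lemma presented_by_surj: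
  assumes "presented_by s b A R"
  shows "\<exists>f. Poly_Mapping.keys f \<subseteq> A \<and> linear_extension s b f = x"
proof -
  have "x \<in> linear_extension s b ` {f. Poly_Mapping.keys f \<subseteq> A}"
    using assms by (simp add: presented_by_def)
  then show ?thesis by auto
qed

lemma presented_by_relation:
  assumes "presented_by s b A R" "r \<in> R"
  shows "linear_extension s b r = 0"
proof -
  interpret F: vector_space free_scale by (rule vector_space_free_scale)
  show ?thesis using presented_by_kernel[OF assms(1)] F.span_base[OF assms(2)] by simp
qed

lemma presented_by_induct [consumes 2, case_names generator]:
  assumes "presented_by s b A R" "module.subspace s V" "\<And>a. a \<in> A \<Longrightarrow> b a \<in> V"
  shows "x \<in> V"
proof -
  interpret vector_space s using assms(1) by (simp add: presented_by_def)
  obtain f where "Poly_Mapping.keys f \<subseteq> A" "x = linear_extension s b f"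
    using presented_by_surj[OF assms(1), of x] by auto
  then show ?thesis
    using assms(2,3) by (auto simp: linear_extension_def intro!: subspace_sum subspace_scale)
qed

text \<open>The universal property: a map on generators that respects the relations extends linearly. Any two expressions of an
element in the generators differ by an element of the span of \<open>R\<close>, so an arbitrary choice of expression is harmless.\<close>

lemma presented_by_factor:
  fixes b :: "'a \<Rightarrow> 'm::ab_group_add" and h :: "'a \<Rightarrow> 'n::ab_group_add"
  assumes P: "presented_by s b A R" and s': "vector_space s'"
    and R: "\<And>r. r \<in> R \<Longrightarrow> linear_extension s' h r = 0"
  shows "\<exists>F. Vector_Spaces.linear s s' F \<and> (\<forall>a\<in>A. F (b a) = h a)"
proof -
  have s: "vector_space s" using P by (simp add: presented_by_def)
  interpret s: vector_space s by fact
  interpret s': vector_space s' by fact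
  interpret F: vector_space free_scale by (rule vector_space_free_scale)
  interpret b: Vector_Spaces.linear free_scale s "linear_extension s b" by (rule linear_linear_extension[OF s])
  interpret h: Vector_Spaces.linear free_scale s' "linear_extension s' h" by (rule linear_linear_extension[OF s'])
  have kernel: "linear_extension s' h f = 0"
    if "Poly_Mapping.keys f \<subseteq> A" "linear_extension s b f = 0" for f
  proof -
    have "f \<in> F.span R" using presented_by_kernel[OF P] that by simp
    then show ?thesis using h.eq_0_on_span[OF R] by simp
  qed
  have ex: "\<exists>f. Poly_Mapping.keys f \<subseteq> A \<and> linear_extension s b f = x" for x
    by (rule presented_by_surj[OF P])
  define F where "F x = linear_extension s' h (SOME f. Poly_Mapping.keys f \<subseteq> A \<and> linear_extension s b f = x)" for x
  have F: "F x = linear_extension s' h f" if f: "Poly_Mapping.keys f \<subseteq> A" "linear_extension s b f = x" for f x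
  proof -
    define g where "g = (SOME f. Poly_Mapping.keys f \<subseteq> A \<and> linear_extension s b f = x)"
    have g: "Poly_Mapping.keys g \<subseteq> A" "linear_extension s b g = x"
      using someI_ex[OF ex[of x]] by (auto simp: g_def)
    have "Poly_Mapping.keys (g - f) \<subseteq> A" using f(1) g(1) Poly_Mapping.keys_diff[of g f] by blast
    from kernel[OF this] have "linear_extension s' h g = linear_extension s' h f"
      using f g by (simp add: b.diff h.diff)
    then show ?thesis by (simp add: F_def g_def)
  qed
  have "Vector_Spaces.linear s s' F"
  proof (intro Vector_Spaces.linear_iff[THEN iffD2] conjI allI s s')
    fix x y
    obtain f g where fg: "Poly_Mapping.keys f \<subseteq> A" "linear_extension s b f = x"
      "Poly_Mapping.keys g \<subseteq> A" "linear_extension s b g = y"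
      using ex by metis
    have "Poly_Mapping.keys (f + g) \<subseteq> A" using fg Poly_Mapping.keys_add[of f g] by blast
    then show "F (x + y) = F x + F y"
      using fg by (simp add: F[of "f + g"] F[of f] F[of g] b.add h.add)
  next
    fix c x
    obtain f where f: "Poly_Mapping.keys f \<subseteq> A" "linear_extension s b f = x" using ex by metis
    have "Poly_Mapping.keys (free_scale c f) \<subseteq> A" using f(1) by (auto simp: in_keys_iff)
    then show "F (s c x) = s' c (F x)"
      using f by (simp add: F[of "free_scale c f"] F[of f] b.scale h.scale)
  qed
  moreover have "F (b a) = h a" if "a \<in> A" for a
    using that F[of "Poly_Mapping.single a 1"]
    by (simp add: linear_extension_single s s')
  ultimately show ?thesis by blast
qed

section \<open>The tensor product with a plane\<close>

lemma tensor_bilinear: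
  assumes T: "is_tensor_product sU U sW W sT tens"
  shows "u \<in> U \<Longrightarrow> u' \<in> U \<Longrightarrow> w \<in> W \<Longrightarrow> tens (u + u') w = tens u w + tens u' w"
    and "u \<in> U \<Longrightarrow> w \<in> W \<Longrightarrow> w' \<in> W \<Longrightarrow> tens u (w + w') = tens u w + tens u w'"
    and "u \<in> U \<Longrightarrow> w \<in> W \<Longrightarrow> tens (sU a u) w = sT a (tens u w)"
    and "u \<in> U \<Longrightarrow> w \<in> W \<Longrightarrow> tens u (sW a w) = sT a (tens u w)"
proof -
  have P: "presented_by sT (\<lambda>(u, w). tens u w) (U \<times> W) (tensor_relations sU U sW W)"
    using T by (simp add: is_tensor_product_def)
  then have s: "vector_space sT" by (simp add: presented_by_def)
  interpret vector_space sT by fact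
  note simps = linear_extension_simps[OF s] linear_extension_single[OF s]
  show "tens (u + u') w = tens u w + tens u' w" if "u \<in> U" "u' \<in> U" "w \<in> W"
  proof -
    have "Poly_Mapping.single (u + u', w) 1 - Poly_Mapping.single (u, w) 1 - Poly_Mapping.single (u', w) 1
      \<in> tensor_relations sU U sW W"
      using that unfolding tensor_relations_def by blast
    from presented_by_relation[OF P this] show ?thesis by (simp add: simps algebra_simps)
  qed
  show "tens u (w + w') = tens u w + tens u w'" if "u \<in> U" "w \<in> W" "w' \<in> W"
  proof -
    have "Poly_Mapping.single (u, w + w') 1 - Poly_Mapping.single (u, w) 1 - Poly_Mapping.single (u, w') 1
      \<in> tensor_relations sU U sW W"
      using that unfolding tensor_relations_def by blast
    from presented_by_relation[OF P this] show ?thesis by (simp add: simps algebra_simps)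
  qed
  show "tens (sU a u) w = sT a (tens u w)" if "u \<in> U" "w \<in> W"
  proof -
    have "Poly_Mapping.single (sU a u, w) 1 - Poly_Mapping.single (u, w) a \<in> tensor_relations sU U sW W"
      using that unfolding tensor_relations_def by blast
    from presented_by_relation[OF P this] show ?thesis by (simp add: simps)
  qed
  show "tens u (sW a w) = sT a (tens u w)" if "u \<in> U" "w \<in> W"
  proof -
    have "Poly_Mapping.single (u, sW a w) 1 - Poly_Mapping.single (u, w) a \<in> tensor_relations sU U sW W"
      using that unfolding tensor_relations_def by blast
    from presented_by_relation[OF P this] show ?thesis by (simp add: simps)
  qed
qed

text \<open>The map \<open>(\<phi>, u) \<mapsto> u\<^sub>i \<phi>\<close> is bilinear, so it respects the tensor relations.\<close>

lemma tensor_functional: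
  fixes tens :: "'u::ab_group_add \<Rightarrow> 'k::field ^ 'n \<Rightarrow> 't::ab_group_add"
  assumes T: "is_tensor_product sU U (*s) UNIV sT tens" and sU: "vector_space sU"
  shows "\<exists>p. Vector_Spaces.linear sT sU p \<and> (\<forall>\<phi>\<in>U. \<forall>u. p (tens \<phi> u) = sU (u $ i) \<phi>)"
proof -
  have P: "presented_by sT (\<lambda>(u, w). tens u w) (U \<times> UNIV) (tensor_relations sU U (*s) UNIV)"
    using T by (simp add: is_tensor_product_def)
  interpret vector_space sU by fact
  note simps = linear_extension_simps[OF sU] linear_extension_single[OF sU]
  have "\<exists>p. Vector_Spaces.linear sT sU p \<and>
      (\<forall>a\<in>U \<times> UNIV. p ((\<lambda>(u, w). tens u w) a) = (\<lambda>(\<phi>, u). sU (u $ i) \<phi>) a)"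
  proof (rule presented_by_factor[OF P sU])
    fix r assume "r \<in> tensor_relations sU U (*s) (UNIV :: ('k ^ 'n) set)"
    then show "linear_extension sU (\<lambda>(\<phi>, u). sU (u $ i) \<phi>) r = 0"
      unfolding tensor_relations_def
      by (auto simp: simps scale_left_distrib scale_right_distrib mult.commute)
  qed
  then show ?thesis by auto
qed

lemma tensor_expand:
  fixes tens :: "'u::ab_group_add \<Rightarrow> 'k::field ^ 2 \<Rightarrow> 't::ab_group_add"
  assumes T: "is_tensor_product sU U (*s) UNIV sT tens" and "\<phi> \<in> U"
  shows "tens \<phi> u = sT (u $ 1) (tens \<phi> (axis 1 1)) + sT (u $ 2) (tens \<phi> (axis 2 1))"
proof -
  have "u = (u $ 1) *s axis 1 1 + (u $ 2) *s axis 2 1"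
    by (simp add: vec_eq_iff forall_2 axis_def)
  then have "tens \<phi> u = tens \<phi> ((u $ 1) *s axis 1 1 + (u $ 2) *s axis 2 1)" by simp
  then show ?thesis using tensor_bilinear(2,4)[OF T \<open>\<phi> \<in> U\<close>] by simp
qed

text \<open>Through the two coordinate maps the tensor product with a plane becomes two copies of \<open>U\<close>.\<close>

lemma tensor_plane:
  fixes tens :: "'u::ab_group_add \<Rightarrow> 'k::field ^ 2 \<Rightarrow> 't::ab_group_add"
  assumes T: "is_tensor_product sU U (*s) UNIV sT tens" and sU: "vector_space sU" "module.subspace sU U"
  obtains p q where "Vector_Spaces.linear sT sU p" "Vector_Spaces.linear sT sU q"
    "\<And>t. p t \<in> U" "\<And>t. q t \<in> U"
    "\<And>\<phi> u. \<phi> \<in> U \<Longrightarrow> p (tens \<phi> u) = sU (u $ 1) \<phi>"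
    "\<And>\<phi> u. \<phi> \<in> U \<Longrightarrow> q (tens \<phi> u) = sU (u $ 2) \<phi>"
    "\<And>t. tens (p t) (axis 1 1) + tens (q t) (axis 2 1) = t"
proof -
  interpret vector_space sU by fact
  have P: "presented_by sT (\<lambda>(u, w). tens u w) (U \<times> UNIV) (tensor_relations sU U (*s) UNIV)"
    using T by (simp add: is_tensor_product_def)
  then interpret T: vector_space sT by (simp add: presented_by_def)
  obtain p where p: "Vector_Spaces.linear sT sU p" "\<And>\<phi> u. \<phi> \<in> U \<Longrightarrow> p (tens \<phi> u) = sU (u $ 1) \<phi>"
    using tensor_functional[OF T sU(1), of 1] by blast
  obtain q where q: "Vector_Spaces.linear sT sU q" "\<And>\<phi> u. \<phi> \<in> U \<Longrightarrow> q (tens \<phi> u) = sU (u $ 2) \<phi>"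
    using tensor_functional[OF T sU(1), of 2] by blast
  interpret p: Vector_Spaces.linear sT sU p by (rule p)
  interpret q: Vector_Spaces.linear sT sU q by (rule q)
  let ?V = "{t. p t \<in> U \<and> q t \<in> U \<and> tens (p t) (axis 1 1) + tens (q t) (axis 2 1) = t}"
  note bil = tensor_bilinear[OF T]
  have "tens 0 w = 0" for w
    using bil(3)[of 0 w 0] subspace_0[OF sU(2)] by simp
  then have "T.subspace ?V"
  proof (intro T.subspaceI)
    show "0 \<in> ?V" using \<open>\<And>w. tens 0 w = 0\<close> subspace_0[OF sU(2)] by (simp add: p.zero q.zero)
  next
    fix s t assume st: "s \<in> ?V" "t \<in> ?V"
    then have "tens (p (s + t)) (axis 1 1) + tens (q (s + t)) (axis 2 1) =
        (tens (p s) (axis 1 1) + tens (q s) (axis 2 1)) + (tens (p t) (axis 1 1) + tens (q t) (axis 2 1))"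
      by (simp add: p.add q.add bil algebra_simps)
    with st show "s + t \<in> ?V" by (simp add: p.add q.add subspace_add[OF sU(2)])
  next
    fix a t assume t: "t \<in> ?V"
    then have "p t \<in> U" "q t \<in> U" by simp_all
    then have "tens (p (sT a t)) (axis 1 1) + tens (q (sT a t)) (axis 2 1) =
        sT a (tens (p t) (axis 1 1) + tens (q t) (axis 2 1))"
      by (simp add: p.scale q.scale bil T.scale_right_distrib)
    also have "\<dots> = sT a t" using t by (simp only: mem_Collect_eq)
    finally show "sT a t \<in> ?V" using t by (simp add: p.scale q.scale subspace_scale[OF sU(2)])
  qed
  moreover have "(\<lambda>(u, w). tens u w) a \<in> ?V" if "a \<in> U \<times> UNIV" for a
    using that by (auto simp: p q bil subspace_scale[OF sU(2)] intro: tensor_expand[OF T, symmetric])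
  ultimately have "t \<in> ?V" for t by (rule presented_by_induct[OF P])
  with p q show ?thesis by (intro that[of p q]) auto
qed

section \<open>The bracket and its Jacobi identity\<close>

abbreviation mat2 :: "'k \<Rightarrow> 'k \<Rightarrow> 'k \<Rightarrow> 'k \<Rightarrow> 'k::zero ^ 2 ^ 2" where
  "mat2 a b c d \<equiv> vector [vector [a, b], vector [c, d]]"

lemma mat2_eq_iff: "X = Y \<longleftrightarrow> X $ 1 $ 1 = Y $ 1 $ 1 \<and> X $ 1 $ 2 = Y $ 1 $ 2 \<and> X $ 2 $ 1 = Y $ 2 $ 1 \<and> X $ 2 $ 2 = Y $ 2 $ 2"
  for X Y :: "'k ^ 2 ^ 2"
  by (auto simp: vec_eq_iff forall_2)

lemma mult_2_component: "(X ** Y) $ i $ j = X $ i $ 1 * Y $ 1 $ j + X $ i $ 2 * Y $ 2 $ j"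
  for X Y :: "'k::comm_ring_1 ^ 2 ^ 2"
  by (simp add: matrix_matrix_mult_def sum_2)

lemma sl2_iff: "X \<in> sl2 \<longleftrightarrow> X $ 2 $ 2 = - X $ 1 $ 1"
  by (auto simp: sl2_def trace_def sum_2 eq_neg_iff_add_eq_0 add.commute)

lemma map_matrix_component [simp]: "map_matrix f X $ i $ j = f (X $ i $ j)"
  by (simp add: map_matrix_def)

text \<open>The space \<open>S\<^sub>1 \<otimes> k\<^sup>2\<close> as two copies of \<open>S1\<close>: \<open>p\<close> and \<open>q\<close> are the coordinates with respect to the standard basis of
\<open>k\<^sup>2\<close>, and \<open>mk\<close> assembles an element from its coordinates.\<close>

locale doubled_half_spinors = spin_norm n sC e eps sS \<rho> S1 S2 B + T: vector_space sT
  for n :: nat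
    and sC :: "'k::field \<Rightarrow> 'c::ring_1 \<Rightarrow> 'c"
    and e :: "nat \<Rightarrow> 'c"
    and eps :: "nat \<Rightarrow> 'k"
    and sS :: "'k \<Rightarrow> 's::ab_group_add \<Rightarrow> 's"
    and \<rho> :: "'c \<Rightarrow> 's \<Rightarrow> 's"
    and S1 S2 :: "'s set"
    and B :: "'s \<Rightarrow> 's \<Rightarrow> 'k"
    and sT :: "'k \<Rightarrow> 't::ab_group_add \<Rightarrow> 't" +
  fixes p q :: "'t \<Rightarrow> 's"
    and mk :: "'s \<Rightarrow> 's \<Rightarrow> 't"
  assumes p_linear: "Vector_Spaces.linear sT sS p" and q_linear: "Vector_Spaces.linear sT sS q"
    and p_S1 [simp]: "p t \<in> S1" and q_S1 [simp]: "q t \<in> S1"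
    and p_mk [simp]: "\<phi> \<in> S1 \<Longrightarrow> \<psi> \<in> S1 \<Longrightarrow> p (mk \<phi> \<psi>) = \<phi>"
    and q_mk [simp]: "\<phi> \<in> S1 \<Longrightarrow> \<psi> \<in> S1 \<Longrightarrow> q (mk \<phi> \<psi>) = \<psi>"
    and mk_eta [simp]: "mk (p t) (q t) = t"
begin

sublocale p: Vector_Spaces.linear sT sS p by (rule p_linear)
sublocale q: Vector_Spaces.linear sT sS q by (rule q_linear)

lemmas pq_simps = p.add p.diff p.neg p.scale p.zero q.add q.diff q.neg q.scale q.zero

lemma T_eqI: "p s = p t \<Longrightarrow> q s = q t \<Longrightarrow> s = t"
  by (metis mk_eta)

lemmas S1_closed [simp, intro] = S.subspace_add[OF sub_S1] S.subspace_scale[OF sub_S1]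
  S.subspace_0[OF sub_S1] S.subspace_neg[OF sub_S1] so_S1

text \<open>The joint action of \<open>C\<^sup>2\<close> and of the 2 by 2 matrices on \<open>S\<^sub>1 \<otimes> k\<^sup>2\<close>.\<close>

definition act :: "'c \<Rightarrow> 'k ^ 2 ^ 2 \<Rightarrow> 't \<Rightarrow> 't" where
  "act A X t = mk (\<rho> A (p t) + sS (X $ 1 $ 1) (p t) + sS (X $ 1 $ 2) (q t))
     (\<rho> A (q t) + sS (X $ 2 $ 1) (p t) + sS (X $ 2 $ 2) (q t))"

text \<open>The components in \<open>C\<^sup>2\<close> and in \<open>sl(2)\<close> of the bracket on \<open>S\<^sub>1 \<otimes> k\<^sup>2\<close>: the coefficients come from
\<open>\<omega>(u\<^sub>1,u\<^sub>2) = 1\<close> and from the matrices of \<open>\<sigma>(u\<^sub>i,u\<^sub>j)\<close> for the standard basis \<open>u\<^sub>1, u\<^sub>2\<close> of \<open>k\<^sup>2\<close>.\<close>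

definition Lam :: "'t \<Rightarrow> 't \<Rightarrow> 'c" where
  "Lam s t = L (p s) (q t) - L (q s) (p t)"

definition Sig :: "'t \<Rightarrow> 't \<Rightarrow> 'k ^ 2 ^ 2" where
  "Sig s t = mat2 (- (B (p s) (q t) + B (q s) (p t))) (2 * B (p s) (p t))
     (- (2 * B (q s) (q t))) (B (p s) (q t) + B (q s) (p t))"

definition bracket :: "'c \<times> ('k ^ 2 ^ 2) \<times> 't \<Rightarrow> 'c \<times> ('k ^ 2 ^ 2) \<times> 't \<Rightarrow> 'c \<times> ('k ^ 2 ^ 2) \<times> 't" where
  "bracket = (\<lambda>(A, X, s) (D, Y, t).
     (A * D - D * A + Lam s t, X ** Y - Y ** X + Sig s t, act A X t - act D Y s))"

definition e7 :: "('c \<times> ('k ^ 2 ^ 2) \<times> 't) set" where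
  "e7 = so \<times> sl2 \<times> UNIV"

lemma p_act: "A \<in> so \<Longrightarrow> p (act A X t) = \<rho> A (p t) + sS (X $ 1 $ 1) (p t) + sS (X $ 1 $ 2) (q t)"
  and q_act: "A \<in> so \<Longrightarrow> q (act A X t) = \<rho> A (q t) + sS (X $ 2 $ 1) (p t) + sS (X $ 2 $ 2) (q t)"
  by (simp_all add: act_def)

lemma Lam_in_so: "Lam s t \<in> so"
  unfolding Lam_def by (intro C.span_diff L_in_so)

lemma Sig_in_sl2: "Sig s t \<in> sl2"
  by (simp add: sl2_iff Sig_def)

lemma sl2_commutator: "X ** Y - Y ** X \<in> sl2" for X Y :: "'k ^ 2 ^ 2"
  by (simp add: sl2_iff mult_2_component algebra_simps)

lemma L_minus: "L (- \<phi>) \<psi> = - L \<phi> \<psi>" "L \<phi> (- \<psi>) = - L \<phi> \<psi>"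
  using L_scale1[of "- 1"] L_scale2[of _ "- 1"] by auto

lemma L_diff: "L (\<phi> - \<phi>') \<psi> = L \<phi> \<psi> - L \<phi>' \<psi>" "L \<psi> (\<phi> - \<phi>') = L \<psi> \<phi> - L \<psi> \<phi>'"
  using L_add1[of \<phi> "- \<phi>'"] L_add2[of \<psi> \<phi> "- \<phi>'"] by (auto simp: L_minus)

lemma B_diff: "B (\<phi> - \<phi>') \<psi> = B \<phi> \<psi> - B \<phi>' \<psi>" "B \<psi> (\<phi> - \<phi>') = B \<psi> \<phi> - B \<psi> \<phi>'"
  using B_simps(1)[of \<phi> "- \<phi>'"] B_simps(2)[of \<psi> \<phi> "- \<phi>'"] by auto

lemma Lam_antisym: "Lam s t = - Lam t s"
  by (simp add: Lam_def L_sym)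

lemma Sig_antisym: "Sig s t = - Sig t s"
  using B_antisym[of "p s" "q t"] B_antisym[of "q s" "p t"] B_antisym[of "p s" "p t"] B_antisym[of "q s" "q t"]
  by (simp add: mat2_eq_iff Sig_def)

lemma Lam_add: "Lam (s + s') t = Lam s t + Lam s' t" "Lam t (s + s') = Lam t s + Lam t s'"
  and Lam_scale: "Lam (sT a s) t = sC a (Lam s t)" "Lam t (sT a s) = sC a (Lam t s)"
  and Lam_diff: "Lam t (s - s') = Lam t s - Lam t s'"
  by (simp_all add: Lam_def pq_simps L_add1 L_add2 L_scale1 L_scale2 L_diff C.scale_right_diff_distrib)

lemma Sig_add: "Sig (s + s') t = Sig s t + Sig s' t" "Sig t (s + s') = Sig t s + Sig t s'"
  and Sig_scale: "Sig (sT a s) t = map_matrix ((*) a) (Sig s t)" "Sig t (sT a s) = map_matrix ((*) a) (Sig t s)"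
  and Sig_diff: "Sig t (s - s') = Sig t s - Sig t s'"
  by (simp_all add: mat2_eq_iff Sig_def pq_simps B_simps B_diff algebra_simps)

lemma act_add: "A \<in> so \<Longrightarrow> act A X (s + t) = act A X s + act A X t"
  and act_diff: "A \<in> so \<Longrightarrow> act A X (s - t) = act A X s - act A X t"
  and act_scale: "A \<in> so \<Longrightarrow> act A X (sT a t) = sT a (act A X t)"
  by (rule T_eqI; simp add: p_act q_act pq_simps rho_simps S.scale_right_distrib
      S.scale_right_diff_distrib mult.commute algebra_simps)+

lemma act_add_left: "A \<in> so \<Longrightarrow> D \<in> so \<Longrightarrow> act (A + D) (X + Y) t = act A X t + act D Y t"
  by (rule T_eqI) (simp_all add: p_act q_act C.span_add pq_simps rho_simps S.scale_left_distrib algebra_simps)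

lemma act_scale_left: "A \<in> so \<Longrightarrow> act (sC a A) (map_matrix ((*) a) X) t = sT a (act A X t)"
  by (rule T_eqI) (simp_all add: p_act q_act C.span_scale pq_simps rho_simps S.scale_right_distrib)

lemma act_commutator:
  assumes "A \<in> so" "D \<in> so"
  shows "act (A * D - D * A) (X ** Y - Y ** X) t = act A X (act D Y t) - act D Y (act A X t)"
proof -
  note comm = so_commutator[OF two_neq_0 assms]
  show ?thesis
    by (rule T_eqI) (simp_all add: p_act[OF comm] q_act[OF comm] p_act[OF assms(1)] q_act[OF assms(1)]
      p_act[OF assms(2)] q_act[OF assms(2)] pq_simps rho_simps mult_2_component
      S.scale_right_distrib S.scale_left_distrib S.scale_left_diff_distrib algebra_simps)
qed

text \<open>The part of \<open>A\<close> is \<open>L_equivariant\<close>. The part of \<open>X\<close> has to cancel, and does because a matrix acts on an alternating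
form on \<open>k\<^sup>2\<close> by its trace, which is 0.\<close>

lemma Lam_equivariant:
  assumes "A \<in> so" "X \<in> sl2"
  shows "A * Lam s t - Lam s t * A = Lam (act A X s) t + Lam s (act A X t)"
proof -
  have X: "X $ 2 $ 2 = - X $ 1 $ 1" using assms(2) by (simp add: sl2_iff)
  have "A * Lam s t - Lam s t * A =
      (A * L (p s) (q t) - L (p s) (q t) * A) - (A * L (q s) (p t) - L (q s) (p t) * A)"
    by (simp add: Lam_def algebra_simps)
  also have "\<dots> = Lam (act A X s) t + Lam s (act A X t)"
    unfolding L_equivariant[OF assms(1)]
    using L_sym[of "q t" "q s"] L_sym[of "p t" "p s"]
    by (simp add: Lam_def p_act q_act assms(1) L_add1 L_add2 L_scale1 L_scale2 L_diff X)
  finally show ?thesis .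
qed

lemma Sig_equivariant:
  assumes "A \<in> so" "X \<in> sl2"
  shows "X ** Sig s t - Sig s t ** X = Sig (act A X s) t + Sig s (act A X t)"
proof -
  have X: "X $ 2 $ 2 = - X $ 1 $ 1" using assms(2) by (simp add: sl2_iff)
  show ?thesis
    by (simp add: mat2_eq_iff mult_2_component Sig_def p_act[OF assms(1)] q_act[OF assms(1)] B_simps B_diff so_B[OF assms(1)] X algebra_simps)
qed

text \<open>The Jacobi identity for three elements of \<open>S\<^sub>1 \<otimes> k\<^sup>2\<close>. In either coordinate the cyclic sum splits into three pieces,
each an instance of \<open>L_difference\<close>; a piece collects the terms in which one fixed argument contributes its other
coordinate. The second coordinate is the negative of the first with the two coordinates exchanged.\<close>

lemma module_jacobi: "act (Lam s t) (Sig s t) r + act (Lam t r) (Sig t r) s + act (Lam r s) (Sig r s) t = 0"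
proof -
  have cyclic: "(\<rho> (L a b' - L a' b) c + sS (- (B a b' + B a' b)) c + sS (2 * B a b) c') +
      (\<rho> (L b c' - L b' c) a + sS (- (B b c' + B b' c)) a + sS (2 * B b c) a') +
      (\<rho> (L c a' - L c' a) b + sS (- (B c a' + B c' a)) b + sS (2 * B c a) b') = 0"
    if "a \<in> S1" "a' \<in> S1" "b \<in> S1" "b' \<in> S1" "c \<in> S1" "c' \<in> S1" for a a' b b' c c'
  proof -
    have part: "\<rho> (L a b') c - \<rho> (L b' c) a + sS (- B a b') c + sS (- B b' c) a + sS (2 * B c a) b' = 0"
      if "a \<in> S1" "b' \<in> S1" "c \<in> S1" for a b' c
    proof -
      have "\<rho> (L a b') c - \<rho> (L b' c) a = sS 2 (sS (B a c) b') + sS (B b' c) a - sS (B b' a) c"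
        using that by (intro L_difference)
      then show ?thesis
        using B_antisym[of b' a] B_antisym[of c a] by (simp add: algebra_simps)
    qed
    have "(\<rho> (L a b' - L a' b) c + sS (- (B a b' + B a' b)) c + sS (2 * B a b) c') +
        (\<rho> (L b c' - L b' c) a + sS (- (B b c' + B b' c)) a + sS (2 * B b c) a') +
        (\<rho> (L c a' - L c' a) b + sS (- (B c a' + B c' a)) b + sS (2 * B c a) b') =
      (\<rho> (L a b') c - \<rho> (L b' c) a + sS (- B a b') c + sS (- B b' c) a + sS (2 * B c a) b') +
      (\<rho> (L b c') a - \<rho> (L c' a) b + sS (- B b c') a + sS (- B c' a) b + sS (2 * B a b) c') +
      (\<rho> (L c a') b - \<rho> (L a' b) c + sS (- B c a') b + sS (- B a' b) c + sS (2 * B b c) a')"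
      by (simp add: rho_diff S.scale_left_distrib S.scale_left_diff_distrib algebra_simps)
    also have "\<dots> = 0" using part that by simp
    finally show ?thesis .
  qed
  have cyclic': "(\<rho> (L a b' - L a' b) c' + sS (- (2 * B a' b')) c + sS (B a b' + B a' b) c') +
      (\<rho> (L b c' - L b' c) a' + sS (- (2 * B b' c')) a + sS (B b c' + B b' c) a') +
      (\<rho> (L c a' - L c' a) b' + sS (- (2 * B c' a')) b + sS (B c a' + B c' a) b') = 0"
    if "a \<in> S1" "a' \<in> S1" "b \<in> S1" "b' \<in> S1" "c \<in> S1" "c' \<in> S1" for a a' b b' c c'
  proof -
    have "(\<rho> (L a b' - L a' b) c' + sS (- (2 * B a' b')) c + sS (B a b' + B a' b) c') +
        (\<rho> (L b c' - L b' c) a' + sS (- (2 * B b' c')) a + sS (B b c' + B b' c) a') +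
        (\<rho> (L c a' - L c' a) b' + sS (- (2 * B c' a')) b + sS (B c a' + B c' a) b') =
      - ((\<rho> (L a' b - L a b') c' + sS (- (B a' b + B a b')) c' + sS (2 * B a' b') c) +
        (\<rho> (L b' c - L b c') a' + sS (- (B b' c + B b c')) a' + sS (2 * B b' c') a) +
        (\<rho> (L c' a - L c a') b' + sS (- (B c' a + B c a')) b' + sS (2 * B c' a') b))"
      by (simp add: rho_diff S.scale_left_distrib S.scale_left_diff_distrib algebra_simps)
    also have "\<dots> = 0" unfolding cyclic[OF that(2,1,4,3,6,5)] by simp
    finally show ?thesis .
  qed
  show ?thesis
    by (rule T_eqI)
      (use cyclic[of "p s" "q s" "p t" "q t" "p r" "q r"] cyclic'[of "p s" "q s" "p t" "q t" "p r" "q r"] in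
       \<open>simp_all add: pq_simps p_act q_act Lam_in_so, simp_all add: Lam_def Sig_def\<close>)
qed

end

lemma vector_space_map_matrix:
  "vector_space (\<lambda>a. map_matrix ((*) a) :: 'k::field ^ 'n ^ 'm \<Rightarrow> 'k ^ 'n ^ 'm)"
  by unfold_locales (simp_all add: vec_eq_iff algebra_simps)

lemma E_scale_simp [simp]: "E_scale sC sT a (A, X, t) = (sC a A, map_matrix ((*) a) X, sT a t)"
  by (simp add: E_scale_def)

lemma subspace_sl2: "module.subspace (\<lambda>a. map_matrix ((*) a)) (sl2 :: ('k::field ^ 2 ^ 2) set)"
proof -
  interpret M: vector_space "\<lambda>a. map_matrix ((*) a) :: 'k ^ 2 ^ 2 \<Rightarrow> 'k ^ 2 ^ 2"
    by (rule vector_space_map_matrix)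
  show ?thesis by (simp add: M.subspace_def sl2_iff algebra_simps)
qed

lemma sl2_basis:
  "has_basis_of_card (\<lambda>a. map_matrix ((*) a)) (sl2 :: ('k::field ^ 2 ^ 2) set) 3"
proof -
  interpret M: vector_space "\<lambda>a. map_matrix ((*) a) :: 'k ^ 2 ^ 2 \<Rightarrow> 'k ^ 2 ^ 2"
    by (rule vector_space_map_matrix)
  let ?h = "mat2 1 0 0 (- 1) :: 'k ^ 2 ^ 2" and ?e = "mat2 0 1 0 0 :: 'k ^ 2 ^ 2"
    and ?f = "mat2 0 0 1 0 :: 'k ^ 2 ^ 2"
  have ne: "?h \<noteq> ?e" "?h \<noteq> ?f" "?e \<noteq> ?f" by (auto simp: mat2_eq_iff)
  have "M.independent {?h, ?e, ?f}"
  proof (rule M.independent_if_scalars_zero)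
    fix c x
    assume 0: "(\<Sum>x\<in>{?h, ?e, ?f}. map_matrix ((*) (c x)) x) = 0" and x: "x \<in> {?h, ?e, ?f}"
    from 0 ne have "c ?h = 0" "c ?e = 0" "c ?f = 0" by (simp_all add: mat2_eq_iff)
    with x show "c x = 0" by blast
  qed simp
  moreover have "M.span {?h, ?e, ?f} = sl2"
  proof (rule subset_antisym)
    show "M.span {?h, ?e, ?f} \<subseteq> sl2"
      by (rule M.span_minimal[OF _ subspace_sl2]) (simp add: sl2_iff)
    show "sl2 \<subseteq> M.span {?h, ?e, ?f}"
    proof
      fix X :: "'k ^ 2 ^ 2" assume "X \<in> sl2"
      then have "X = map_matrix ((*) (X $ 1 $ 1)) ?h + map_matrix ((*) (X $ 1 $ 2)) ?e
          + map_matrix ((*) (X $ 2 $ 1)) ?f"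
        by (simp add: mat2_eq_iff sl2_iff)
      also have "\<dots> \<in> M.span {?h, ?e, ?f}"
        by (intro M.span_add M.span_scale M.span_base) auto
      finally show "X \<in> M.span {?h, ?e, ?f}" .
    qed
  qed
  ultimately show ?thesis unfolding has_basis_of_card_def
    using ne by (intro exI[of _ "{?h, ?e, ?f}"]) simp
qed

context doubled_half_spinors
begin

abbreviation "mscale \<equiv> \<lambda>a. map_matrix ((*) a) :: 'k ^ 2 ^ 2 \<Rightarrow> 'k ^ 2 ^ 2"

sublocale M: vector_space mscale by (rule vector_space_map_matrix)

sublocale ST: vector_space_prod sS sS by unfold_locales

sublocale MT: vector_space_prod mscale sT by unfold_locales

sublocale CMT: vector_space_prod sC MT.scale by unfold_locales

lemma E_scale_eq: "E_scale sC sT = CMT.scale"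
  by (auto simp: fun_eq_iff E_scale_def CMT.scale_prod MT.scale_prod)

sublocale E: vector_space "E_scale sC sT"
  unfolding E_scale_eq by (rule CMT.p.vector_space_axioms)

lemma subspace_e7: "E.subspace e7"
  unfolding e7_def E_scale_eq
  by (intro CMT.subspace_Times MT.subspace_Times C.subspace_span subspace_sl2 T.subspace_UNIV)

lemma bracket_closed: "x \<in> e7 \<Longrightarrow> y \<in> e7 \<Longrightarrow> bracket x y \<in> e7"
  by (auto simp: e7_def bracket_def intro!: C.span_add so_commutator[OF two_neq_0] Lam_in_so
      M.subspace_add[OF subspace_sl2] sl2_commutator Sig_in_sl2)

lemma map_matrix_mult:
  fixes X Y :: "'k ^ 2 ^ 2"
  shows "map_matrix ((*) a) X ** Y = map_matrix ((*) a) (X ** Y)"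
    and "X ** map_matrix ((*) a) Y = map_matrix ((*) a) (X ** Y)"
  by (simp_all add: mat2_eq_iff mult_2_component algebra_simps)

lemma matrix_distrib:
  fixes X Y Z :: "'k ^ 2 ^ 2"
  shows "(X + Y) ** Z = X ** Z + Y ** Z" "Z ** (X + Y) = Z ** X + Z ** Y"
    "(X - Y) ** Z = X ** Z - Y ** Z" "Z ** (X - Y) = Z ** X - Z ** Y"
  by (simp_all add: mat2_eq_iff mult_2_component algebra_simps)

lemma bracket_antisym: "bracket x y = - bracket y x"
proof (cases x; cases y)
  fix A X s D Y t
  assume "x = (A, X, s)" "y = (D, Y, t)"
  then show ?thesis
    using Lam_antisym[of s t] Sig_antisym[of s t] by (simp add: bracket_def)
qed

lemma bracket_self: "x \<in> e7 \<Longrightarrow> bracket x x = 0"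
proof (cases x)
  fix A X s assume "x = (A, X, s)"
  moreover have "Lam s s = 0" by (simp add: Lam_def L_sym)
  moreover have "B (p s) (p s) = 0" "B (q s) (q s) = 0" "B (p s) (q s) + B (q s) (p s) = 0"
  proof -
    have *: "B \<phi> \<phi> = 0" for \<phi>
    proof -
      have "2 * B \<phi> \<phi> = 0" using B_antisym[of \<phi> \<phi>] by (simp add: eq_neg_iff_add_eq_0)
      then show ?thesis using two_neq_0 by simp
    qed
    show "B (p s) (p s) = 0" "B (q s) (q s) = 0" by (rule *)+
    show "B (p s) (q s) + B (q s) (p s) = 0"
      using B_antisym[of "p s" "q s"] by simp
  qed
  then have "Sig s s = 0" by (simp add: Sig_def mat2_eq_iff)
  ultimately show ?thesis by (simp add: bracket_def zero_prod_def)
qed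

lemma bracket_add_left:
  assumes "x \<in> e7" "y \<in> e7" "z \<in> e7"
  shows "bracket (x + y) z = bracket x z + bracket y z"
proof -
  obtain A X s D Y t F Z r where xyz: "x = (A, X, s)" "y = (D, Y, t)" "z = (F, Z, r)"
    by (cases x; cases y; cases z) auto
  then have so: "A \<in> so" "D \<in> so" "F \<in> so" using assms by (auto simp: e7_def)
  show ?thesis
    unfolding xyz
    by (simp add: bracket_def Lam_add Sig_add act_add_left[OF so(1,2)] act_add[OF so(3)]
        matrix_distrib algebra_simps del: mult.commute)
qed

lemma bracket_scale_left:
  assumes "x \<in> e7" "y \<in> e7"
  shows "bracket (E_scale sC sT a x) y = E_scale sC sT a (bracket x y)"
proof -
  obtain A X s D Y t where xy: "x = (A, X, s)" "y = (D, Y, t)"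
    by (cases x; cases y) auto
  then have so: "A \<in> so" "D \<in> so" using assms by (auto simp: e7_def)
  show ?thesis
    unfolding xy
    by (simp add: bracket_def Lam_scale Sig_scale act_scale_left[OF so(1)] act_scale[OF so(2)]
        map_matrix_mult C.scale_right_distrib C.scale_right_diff_distrib T.scale_right_diff_distrib
        M.scale_right_distrib M.scale_right_diff_distrib)
qed

lemma bilinear_bracket: "bilinear_on (E_scale sC sT) e7 bracket"
proof -
  have 1: "bracket z (x + y) = bracket z x + bracket z y" if "x \<in> e7" "y \<in> e7" "z \<in> e7" for x y z
    using bracket_add_left[OF that] bracket_antisym[of z] by simp
  have 2: "bracket x (E_scale sC sT a y) = E_scale sC sT a (bracket x y)" if "x \<in> e7" "y \<in> e7" for a x y
    using bracket_scale_left[OF that(2,1), of a] bracket_antisym[of x] by simp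
  show ?thesis
    unfolding bilinear_on_def
    by (intro conjI ballI allI) (simp_all only: bracket_closed bracket_add_left bracket_scale_left 1 2)
qed

text \<open>Componentwise: the component in \<open>C\<^sup>2\<close> and the one in \<open>sl(2)\<close> reduce to the Jacobi identity for commutators and to
equivariance, the one in \<open>S\<^sub>1 \<otimes> k\<^sup>2\<close> to the module property and \<open>module_jacobi\<close>.\<close>

lemma jacobi:
  assumes "x \<in> e7" "y \<in> e7" "z \<in> e7"
  shows "bracket x (bracket y z) + bracket y (bracket z x) + bracket z (bracket x y) = 0"
proof -
  obtain A X s D Y t F Z r where xyz: "x = (A, X, s)" "y = (D, Y, t)" "z = (F, Z, r)"
    by (cases x; cases y; cases z) auto
  then have so: "A \<in> so" "D \<in> so" "F \<in> so" and sl: "X \<in> sl2" "Y \<in> sl2" "Z \<in> sl2"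
    using assms by (auto simp: e7_def)
  note comm = so_commutator[OF two_neq_0]
  have act_split: "act (G * H - H * G + Lam u v) (P ** R - R ** P + Sig u v) w =
      act G P (act H R w) - act H R (act G P w) + act (Lam u v) (Sig u v) w"
    if "G \<in> so" "H \<in> so" for G H P R u v w
    unfolding act_add_left[OF comm[OF that] Lam_in_so] act_commutator[OF that] ..
  have split_C: "G * (c + l) - (c + l) * G = (G * c - c * G) + (G * l - l * G)" for G c l :: 'c
    by (simp add: algebra_simps)
  have split_M: "G ** (c + l) - (c + l) ** G = (G ** c - c ** G) + (G ** l - l ** G)" for G c l :: "'k ^ 2 ^ 2"
    by (simp add: matrix_distrib)
  have 1: "(A * (D * F - F * D + Lam t r) - (D * F - F * D + Lam t r) * A + Lam s (act D Y r - act F Z t)) +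
    (D * (F * A - A * F + Lam r s) - (F * A - A * F + Lam r s) * D + Lam t (act F Z s - act A X r)) +
    (F * (A * D - D * A + Lam s t) - (A * D - D * A + Lam s t) * F + Lam r (act A X t - act D Y s)) = 0"
    unfolding split_C Lam_equivariant[OF so(1) sl(1)] Lam_equivariant[OF so(2) sl(2)]
      Lam_equivariant[OF so(3) sl(3)] Lam_diff
      Lam_antisym[of "act A X t" r] Lam_antisym[of "act D Y r" s] Lam_antisym[of "act F Z s" t]
    by (simp add: algebra_simps)
  have mat_assoc: "G ** H ** P = G ** (H ** P)" for G H P :: "'k ^ 2 ^ 2"
    by (simp add: matrix_mul_assoc)
  have 2: "(X ** (Y ** Z - Z ** Y + Sig t r) - (Y ** Z - Z ** Y + Sig t r) ** X + Sig s (act D Y r - act F Z t)) +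
    (Y ** (Z ** X - X ** Z + Sig r s) - (Z ** X - X ** Z + Sig r s) ** Y + Sig t (act F Z s - act A X r)) +
    (Z ** (X ** Y - Y ** X + Sig s t) - (X ** Y - Y ** X + Sig s t) ** Z + Sig r (act A X t - act D Y s)) = 0"
    unfolding split_M Sig_equivariant[OF so(1) sl(1)] Sig_equivariant[OF so(2) sl(2)]
      Sig_equivariant[OF so(3) sl(3)] Sig_diff
      Sig_antisym[of "act A X t" r] Sig_antisym[of "act D Y r" s] Sig_antisym[of "act F Z s" t]
    by (simp add: matrix_distrib mat_assoc algebra_simps)
  have 3: "(act A X (act D Y r - act F Z t) - act (D * F - F * D + Lam t r) (Y ** Z - Z ** Y + Sig t r) s) +
    (act D Y (act F Z s - act A X r) - act (F * A - A * F + Lam r s) (Z ** X - X ** Z + Sig r s) t) +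
    (act F Z (act A X t - act D Y s) - act (A * D - D * A + Lam s t) (X ** Y - Y ** X + Sig s t) r) = 0"
    using module_jacobi[of s t r]
    unfolding act_split[OF so(2,3)] act_split[OF so(3,1)] act_split[OF so(1,2)]
      act_diff[OF so(1)] act_diff[OF so(2)] act_diff[OF so(3)]
    by (simp add: algebra_simps)
  show ?thesis
    using 1 2 3 by (simp add: xyz bracket_def zero_prod_def)
qed

theorem lie_algebra_e7: "lie_algebra (E_scale sC sT) e7 bracket"
  unfolding lie_algebra_def
  by (intro conjI ballI E.vector_space_axioms subspace_e7 bilinear_bracket bracket_self jacobi)

section \<open>Dimension\<close>

text \<open>\<open>66 + 3 + 2 \<cdot> 32 = 133\<close>.\<close>

lemma dim_e7:
  assumes "S.dim S1 = 32"
  shows "E.dim e7 = 133"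
proof -
  have "(\<Sum>j<2 * n. j) = 66" using n6 by (simp add: eval_nat_numeral)
  then have so: "has_basis_of_card sC so 66"
    unfolding has_basis_of_card_def
    using finite_pairs independent_pairs[OF two_neq_0] card_pairs[OF two_neq_0]
    by (intro exI[of _ pairs]) simp
  have "has_basis_of_card sS S1 32"
    using S.has_basis_subspace[OF sub_S1 assms] by simp
  then have 64: "has_basis_of_card ST.scale (S1 \<times> S1) 64"
    using ST.has_basis_Times[of S1 32 S1 32] by simp
  interpret pair: vector_space_pair sT ST.scale by unfold_locales
  let ?f = "\<lambda>t. (p t, q t)"
  have "Vector_Spaces.linear sT ST.scale ?f"
    by (intro Vector_Spaces.linear_iff[THEN iffD2] conjI allI)
      (auto simp: pq_simps ST.scale_prod T.vector_space_axioms ST.p.vector_space_axioms)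
  moreover have "inj ?f" by (auto intro: injI T_eqI)
  ultimately have "ST.p.dim (range ?f) = T.dim UNIV" by (rule pair.dim_range_inj)
  moreover have "range ?f = S1 \<times> S1"
  proof (intro subset_antisym subsetI)
    fix z assume "z \<in> S1 \<times> S1"
    then have "z = ?f (mk (fst z) (snd z))" by auto
    then show "z \<in> range ?f" by blast
  qed auto
  ultimately have "T.dim UNIV = 64" using ST.p.dim_has_basis[OF 64] by simp
  then have "has_basis_of_card sT UNIV 64"
    by (intro T.has_basis_subspace T.subspace_UNIV) auto
  from CMT.has_basis_Times[OF so MT.has_basis_Times[OF sl2_basis this]]
  have "has_basis_of_card (E_scale sC sT) e7 133"
    by (simp add: e7_def E_scale_eq)
  then show ?thesis by (rule E.dim_has_basis)
qed

section \<open>Simplicity\<close>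

lemma mk_0_0 [simp]: "mk 0 0 = 0"
  using mk_eta[of 0] by (simp add: pq_simps)

lemma act_0_0 [simp]: "act 0 0 t = 0"
  by (simp add: act_def)

lemma act_zero [simp]: "act A X 0 = 0"
  by (simp add: act_def pq_simps)

lemma zero_in_so [simp]: "0 \<in> so" and zero_in_sl2 [simp]: "(0 :: 'k ^ 2 ^ 2) \<in> sl2"
  by (simp_all add: C.span_zero sl2_iff)

lemma L_zero [simp]: "L 0 \<psi> = 0" "L \<psi> 0 = 0"
  using L_scale1[of 0 0 \<psi>] by (simp_all add: L_sym[of \<psi>])

lemma Lam_zero [simp]: "Lam 0 t = 0" "Lam t 0 = 0" and Sig_zero [simp]: "Sig 0 t = 0" "Sig t 0 = 0"
  by (simp_all add: Lam_def Sig_def pq_simps mat2_eq_iff)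

lemma bracket_even_odd: "bracket (A, X, 0) (0, 0, t) = (0, 0, act A X t)"
  by (simp add: bracket_def mat2_eq_iff mult_2_component)

abbreviation "mH \<equiv> mat2 1 0 0 (- 1) :: 'k ^ 2 ^ 2"
abbreviation "mE \<equiv> mat2 0 1 0 0 :: 'k ^ 2 ^ 2"
abbreviation "mF \<equiv> mat2 0 0 1 0 :: 'k ^ 2 ^ 2"

lemma bracket_sl2: "Y \<in> sl2 \<Longrightarrow> bracket (0, Y, 0) (A, X, t) = (0, Y ** X - X ** Y, act 0 Y t)"
  by (simp add: bracket_def)

lemma act_weight_vectors [simp]: "act 0 mH (act 0 mH t) = t" "act 0 mE (mk 0 (q t)) = mk (q t) 0"
    "act 0 mH t + t = mk (p t + p t) 0"
  by (rule T_eqI; simp add: p_act q_act pq_simps)+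

text \<open>From a nonzero element of \<open>S\<^sub>1 \<otimes> k\<^sup>2\<close> the ideal reaches \<open>mE\<close> and \<open>mH\<close> through \<open>B\<close>, then all of \<open>S\<^sub>1 \<otimes> k\<^sup>2\<close>, on
which \<open>mH\<close> acts invertibly, and then \<open>C\<^sup>2\<close> through the span of the values of \<open>L\<close>.\<close>

theorem e7_ideal:
  assumes "lie_ideal (E_scale sC sT) e7 bracket I" "I \<noteq> {0}"
  shows "I = e7"
proof -
  have I: "E.subspace I" "I \<subseteq> e7" and ideal: "\<And>x y. x \<in> e7 \<Longrightarrow> y \<in> I \<Longrightarrow> bracket x y \<in> I"
    using assms(1) by (auto simp: lie_ideal_def)
  note I_add = E.subspace_add[OF I(1)] and I_diff = E.subspace_diff[OF I(1)]
    and I_scale = E.subspace_scale[OF I(1)] and I_0 = E.subspace_0[OF I(1)]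
  have ideal': "bracket y x \<in> I" if "x \<in> e7" "y \<in> I" for x y
    using E.subspace_neg[OF I(1) ideal[OF that]] bracket_antisym[of y x] by simp
  have so_in: "A \<in> so \<Longrightarrow> (A, 0, 0) \<in> e7" and sl_in: "X \<in> sl2 \<Longrightarrow> (0, X, 0) \<in> e7" and T_in: "(0, 0, t) \<in> e7" for A X t
    by (auto simp: e7_def)
  have H: "mH \<in> sl2" and X: "mE \<in> sl2" and F: "mF \<in> sl2" by (simp_all add: sl2_iff)
  have isolate: "(0, 0, t) \<in> I" if "(A, X, t) \<in> I" for A X t
  proof -
    \<comment> \<open>With \<open>ad\<close> the bracket with \<open>mH\<close>, the square of \<open>ad\<close> is 0 on \<open>so\<close>, is 0 and 4 on the diagonal and
      off-diagonal matrices, and is 1 on the spinor component; so \<open>ad\<^sup>4 - 4 ad\<^sup>2\<close> is -3 there and 0 elsewhere.\<close>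
    define ad where "ad y = bracket (0, mH, 0) y" for y
    have ad: "y \<in> I \<Longrightarrow> ad y \<in> I" for y unfolding ad_def using H sl_in ideal by blast
    define O1 where "O1 = mat2 0 (X $ 1 $ 2) (X $ 2 $ 1) 0"
    have 1: "ad (ad (A, X, t)) = (0, mscale 4 O1, t)"
      unfolding ad_def bracket_sl2[OF H] by (simp add: O1_def mat2_eq_iff mult_2_component)
    have 2: "ad (ad (0, mscale 4 O1, t)) = (0, mscale 16 O1, t)"
      unfolding ad_def bracket_sl2[OF H] by (simp add: O1_def mat2_eq_iff mult_2_component)
    have "(0, mscale 4 O1, t) \<in> I" "(0, mscale 16 O1, t) \<in> I"
      using ad[OF ad[OF that]] unfolding 1 using ad[OF ad] 2 by metis+
    then have "E_scale sC sT (- (1 / 3)) ((0, mscale 16 O1, t) - E_scale sC sT 4 (0, mscale 4 O1, t)) \<in> I"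
      by (intro I_scale I_diff)
    moreover have "t - sT 4 t = sT (- 3) t"
      using T.scale_left_diff_distrib[of 1 4 t] by simp
    then have "E_scale sC sT (- (1 / 3)) ((0, mscale 16 O1, t) - E_scale sC sT 4 (0, mscale 4 O1, t)) = (0, 0, t)"
      using three_neq_0 by (simp add: mat2_eq_iff)
    ultimately show ?thesis by simp
  qed
  obtain t where t: "t \<noteq> 0" "(0, 0, t) \<in> I"
  proof -
    obtain y where y: "y \<in> I" "y \<noteq> 0" using assms(2) I_0 by blast
    obtain A X t where AXt: "y = (A, X, t)" by (cases y)
    with y I(2) have AX: "A \<in> so" "X \<in> sl2" by (auto simp: e7_def)
    show ?thesis
    proof (cases "t = 0")
      case False
      with that isolate y AXt show ?thesis by blast
    next
      case True
      have in_I: "(0, 0, act A X s) \<in> I" for s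
        using ideal'[OF T_in[of s] y(1)] by (simp add: AXt True bracket_even_odd)
      \<comment> \<open>The coordinates of \<open>act A X\<close> mix only through the off-diagonal entries of \<open>X\<close>, so if it
        vanishes, \<open>X\<close> is a scalar matrix of trace 0.\<close>
      have "\<exists>s. act A X s \<noteq> 0"
      proof (rule ccontr)
        assume "\<not> (\<exists>s. act A X s \<noteq> 0)"
        then have "p (act A X s) = 0" "q (act A X s) = 0" for s by (simp_all add: pq_simps)
        then have *: "\<rho> A (p s) + sS (X $ 1 $ 1) (p s) + sS (X $ 1 $ 2) (q s) = 0"
          "\<rho> A (q s) + sS (X $ 2 $ 1) (p s) + sS (X $ 2 $ 2) (q s) = 0" for s
          by (simp_all add: p_act q_act AX)
        have **: "\<rho> A \<phi> + sS (X $ 1 $ 1) \<phi> = 0" "sS (X $ 2 $ 1) \<phi> = 0"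
          "\<rho> A \<phi> + sS (X $ 2 $ 2) \<phi> = 0" "sS (X $ 1 $ 2) \<phi> = 0" if "\<phi> \<in> S1" for \<phi>
          using *[of "mk \<phi> 0"] *[of "mk 0 \<phi>"] that by simp_all
        obtain \<phi> where \<phi>: "\<phi> \<in> S1" "\<phi> \<noteq> 0" using S1_nontrivial S.subspace_0[OF sub_S1] by blast
        have "sS (X $ 1 $ 1) \<phi> = sS (X $ 2 $ 2) \<phi>"
          using **(1,3)[OF \<phi>(1)] by (metis add_left_cancel)
        then have "X $ 1 $ 1 = X $ 2 $ 2" using \<phi>(2) by simp
        then have "2 * X $ 1 $ 1 = 0"
          using AX(2) unfolding sl2_iff by (metis eq_neg_iff_add_eq_0 mult_2)
        then have "X = 0"
          using **(2,4)[OF \<phi>(1)] \<phi>(2) two_neq_0 AX(2) by (simp add: mat2_eq_iff sl2_iff)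
        moreover have "A = 0"
          using so_faithful[OF AX(1)] **(1) by (simp add: \<open>X = 0\<close>)
        ultimately show False using y(2) AXt True by (simp add: zero_prod_def)
      qed
      with in_I that show ?thesis by blast
    qed
  qed
  obtain \<phi> where \<phi>: "\<phi> \<in> S1" "\<phi> \<noteq> 0" "(0, 0, mk \<phi> 0) \<in> I"
  proof (cases "p t = 0")
    case True
    then have "q t \<noteq> 0" using t(1) T_eqI[of t 0] by (auto simp: pq_simps)
    have "mk 0 (q t) = t" using mk_eta[of t] True by simp
    then have "bracket (0, mE, 0) (0, 0, t) = (0, 0, mk (q t) 0)"
      unfolding bracket_sl2[OF X] using act_weight_vectors(2)[of t] by simp
    then have "(0, 0, mk (q t) 0) \<in> I" using ideal[OF sl_in[OF X] t(2)] by simp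
    with \<open>q t \<noteq> 0\<close> show ?thesis by (intro that[of "q t"]) simp_all
  next
    case False
    have "bracket (0, mH, 0) (0, 0, t) + (0, 0, t) \<in> I"
      using ideal[OF sl_in[OF H] t(2)] t(2) by (rule I_add)
    then have "(0, 0, mk (p t + p t) 0) \<in> I" by (simp add: bracket_sl2[OF H])
    moreover have "p t + p t = sS 2 (p t)" using S.scale_left_distrib[of 1 1 "p t"] by simp
    then have "p t + p t \<noteq> 0" using False two_neq_0 by simp
    ultimately show ?thesis by (intro that[of "p t + p t"]) (simp_all add: S.subspace_add[OF sub_S1])
  qed
  obtain \<psi> where \<psi>: "\<psi> \<in> S1" "B \<psi> \<phi> \<noteq> 0"
    using B_nondeg_S1[OF \<phi>(1,2)] B_antisym by (metis neg_equal_0_iff_equal)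
  have "bracket (0, 0, mk \<psi> 0) (0, 0, mk \<phi> 0) \<in> I" using ideal T_in \<phi>(3) by blast
  moreover have "bracket (0, 0, mk \<psi> 0) (0, 0, mk \<phi> 0) = (0, mscale (2 * B \<psi> \<phi>) mE, 0)"
    using \<phi>(1) \<psi>(1) S.subspace_0[OF sub_S1]
    by (simp add: bracket_def Lam_def Sig_def mat2_eq_iff)
  ultimately have "E_scale sC sT (1 / (2 * B \<psi> \<phi>)) (0, mscale (2 * B \<psi> \<phi>) mE, 0) \<in> I"
    by (intro I_scale) simp
  moreover have "mscale (1 / (2 * B \<psi> \<phi>)) (mscale (2 * B \<psi> \<phi>) mE) = mE"
    using \<psi>(2) two_neq_0 by (simp add: mat2_eq_iff)
  ultimately have E_I: "(0, mE, 0) \<in> I" by simp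
  have "bracket (0, mF, 0) (0, mE, 0) = - (0, mH, 0)"
    unfolding bracket_sl2[OF F] by (simp add: mat2_eq_iff mult_2_component)
  then have H_I: "(0, mH, 0) \<in> I"
    using ideal[OF sl_in[OF F] E_I] E.subspace_neg[OF I(1)] by fastforce
  have T_I: "(0, 0, s) \<in> I" for s
    using ideal'[OF T_in[of "act 0 mH s"] H_I] by (simp add: bracket_sl2[OF H])
  have F_I: "(0, mF, 0) \<in> I"
  proof -
    have "bracket (0, mF, 0) (0, mH, 0) = E_scale sC sT 2 (0, mF, 0)"
      unfolding bracket_sl2[OF F] by (simp add: mat2_eq_iff mult_2_component)
    then have "E_scale sC sT (1 / 2) (E_scale sC sT 2 (0, mF, 0)) \<in> I"
      using ideal[OF sl_in[OF F] H_I] by (metis I_scale)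
    moreover have "mscale (1 / 2) (mscale 2 mF) = mF" using two_neq_0 by (simp add: mat2_eq_iff)
    ultimately show ?thesis by simp
  qed
  have sl_I: "(0, X, 0) \<in> I" if "X \<in> sl2" for X
  proof -
    have "E_scale sC sT (X $ 1 $ 1) (0, mH, 0) + E_scale sC sT (X $ 1 $ 2) (0, mE, 0)
        + E_scale sC sT (X $ 2 $ 1) (0, mF, 0) \<in> I"
      by (intro I_add I_scale H_I E_I F_I)
    moreover have "mscale (X $ 1 $ 1) mH + mscale (X $ 1 $ 2) mE + mscale (X $ 2 $ 1) mF = X"
      using that by (simp add: mat2_eq_iff sl2_iff)
    ultimately show ?thesis by simp
  qed
  have "so \<subseteq> {A. (A, 0, 0) \<in> I}"
  proof (rule L_spans)
    have "(A + D, 0, 0) \<in> I" if "(A, 0, 0) \<in> I" "(D, 0, 0) \<in> I" for A D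
      using I_add[OF that] by simp
    moreover have "(sC a A, 0, 0) \<in> I" if "(A, 0, 0) \<in> I" for a A
      using I_scale[OF that, of a] by simp
    ultimately show "C.subspace {A. (A, 0, 0) \<in> I}"
      using I_0 by (simp add: C.subspace_def zero_prod_def)
  next
    fix \<phi> \<psi> assume \<phi>\<psi>: "\<phi> \<in> S1" "\<psi> \<in> S1"
    let ?s = "mk \<phi> 0" and ?t = "mk 0 \<psi>"
    have "bracket (0, 0, ?s) (0, 0, ?t) - (0, Sig ?s ?t, 0) \<in> I"
      using ideal[OF T_in T_I] sl_I[OF Sig_in_sl2] by (rule I_diff)
    then show "L \<phi> \<psi> \<in> {A. (A, 0, 0) \<in> I}"
      using \<phi>\<psi> S.subspace_0[OF sub_S1] by (simp add: bracket_def Lam_def zero_prod_def)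
  qed
  then have so_I: "(A, 0, 0) \<in> I" if "A \<in> so" for A using that by blast
  have "e7 \<subseteq> I"
  proof
    fix y assume "y \<in> e7"
    then obtain A X t where y: "y = (A, X, t)" "A \<in> so" "X \<in> sl2" by (auto simp: e7_def)
    have "(A, 0, 0) + (0, X, 0) + (0, 0, t) \<in> I"
      by (intro I_add so_I sl_I T_I y)
    then show "y \<in> I" by (simp add: y)
  qed
  with I(2) show ?thesis by blast
qed

theorem simple_e7: "simple_lie_algebra (E_scale sC sT) e7 bracket"
proof -
  have sl: "mH \<in> sl2" "mE \<in> sl2" by (simp_all add: sl2_iff)
  have "bracket (0, mH, 0) (0, mE, 0) \<noteq> 0"
    unfolding bracket_sl2[OF sl(1)] using two_neq_0 by (simp add: zero_prod_def mat2_eq_iff mult_2_component)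
  moreover have "(0, mH, 0) \<in> e7" "(0, mE, 0) \<in> e7" using sl by (simp_all add: e7_def)
  ultimately show ?thesis
    unfolding simple_lie_algebra_def using lie_algebra_e7 e7_ideal by blast
qed

end

section \<open>Characterisation of the bracket\<close>

lemma is_E_bracketD:
  assumes "is_E_bracket n g sC \<iota> \<rho> S1 B x sT tens br"
  shows "bilinear_on (E_scale sC sT) (E_space n sC \<iota> x) br"
    and "\<forall>y\<in>E_space n sC \<iota> x. \<forall>z\<in>E_space n sC \<iota> x. br y z = - br z y"
    and "\<forall>A\<in>C2 n sC \<iota> x. \<forall>A'\<in>C2 n sC \<iota> x. br (A, 0, 0) (A', 0, 0) = (A * A' - A' * A, 0, 0)"
    and "\<forall>X\<in>sl2. \<forall>Y\<in>sl2. br (0, X, 0) (0, Y, 0) = (0, X ** Y - Y ** X, 0)"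
    and "\<forall>A\<in>C2 n sC \<iota> x. \<forall>X\<in>sl2. br (A, 0, 0) (0, X, 0) = 0"
    and "\<forall>A\<in>C2 n sC \<iota> x. \<forall>\<psi>\<in>S1. \<forall>u. br (A, 0, 0) (0, 0, tens \<psi> u) = (0, 0, tens (\<rho> A \<psi>) u)"
    and "\<forall>X\<in>sl2. \<forall>\<psi>\<in>S1. \<forall>u. br (0, X, 0) (0, 0, tens \<psi> u) = (0, 0, tens \<psi> (X *v u))"
    and "\<forall>\<phi>\<in>S1. \<forall>\<psi>\<in>S1. \<forall>u w. br (0, 0, tens \<phi> u) (0, 0, tens \<psi> w) =
        (sC (symp u w) (L2 n g sC \<iota> \<rho> B x \<phi> \<psi>), map_matrix ((*) (B \<phi> \<psi>)) (sigma u w), 0)"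
  using assms unfolding is_E_bracket_def by - (elim conjE, assumption)+

text \<open>The clauses of \<open>is_E_bracket\<close> give one of the two orders of every pair of homogeneous generators, antisymmetry gives
the other, and every element of \<open>E\<close> is a sum of four such generators.\<close>

lemma E_bracket_unique:
  fixes sC :: "'k::field \<Rightarrow> 'c::ring_1 \<Rightarrow> 'c" and tens :: "'s \<Rightarrow> 'k ^ 2 \<Rightarrow> 't::ab_group_add"
    and br1 br2 :: "'c \<times> ('k ^ 2 ^ 2) \<times> 't \<Rightarrow> 'c \<times> ('k ^ 2 ^ 2) \<times> 't \<Rightarrow> 'c \<times> ('k ^ 2 ^ 2) \<times> 't"
  assumes 1: "is_E_bracket n g sC \<iota> \<rho> S1 B x sT tens br1"
    and 2: "is_E_bracket n g sC \<iota> \<rho> S1 B x sT tens br2"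
    and sC: "vector_space sC"
    and T: "\<And>t. \<exists>\<phi>\<in>S1. \<exists>\<psi>\<in>S1. t = tens \<phi> (axis 1 1) + tens \<psi> (axis 2 1)"
    and yz: "y \<in> E_space n sC \<iota> x" "z \<in> E_space n sC \<iota> x"
  shows "br1 y z = br2 y z"
proof -
  interpret vector_space sC by fact
  interpret M: vector_space "\<lambda>a. map_matrix ((*) a) :: 'k ^ 2 ^ 2 \<Rightarrow> 'k ^ 2 ^ 2"
    by (rule vector_space_map_matrix)
  let ?E = "E_space n sC \<iota> x :: ('c \<times> ('k ^ 2 ^ 2) \<times> 't) set" and ?C2 = "C2 n sC \<iota> x"
  define G :: "('c \<times> ('k ^ 2 ^ 2) \<times> 't) set" where
    "G = {(A, 0, 0) | A. A \<in> ?C2} \<union> {(0, X, 0) | X. X \<in> sl2} \<union> {(0, 0, tens \<phi> u) | \<phi> u. \<phi> \<in> S1}"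
  have sl2: "(0 :: 'k ^ 2 ^ 2) \<in> sl2" by (simp add: sl2_iff)
  have C2: "0 \<in> ?C2" unfolding C2_def by (rule span_zero)
  have G: "G \<subseteq> ?E" using C2 sl2 by (auto simp: G_def E_space_def)
  have E_add: "a + b \<in> ?E" if "a \<in> ?E" "b \<in> ?E" for a b
    using that M.subspace_add[OF subspace_sl2] by (auto simp: E_space_def C2_def span_add)
  have add: "br (a + b) c = br a c + br b c" "br c (a + b) = br c a + br c b"
    if "is_E_bracket n g sC \<iota> \<rho> S1 B x sT tens br" "a \<in> ?E" "b \<in> ?E" "c \<in> ?E" for br a b c
    using is_E_bracketD(1)[OF that(1), unfolded bilinear_on_def, THEN conjunct2, THEN conjunct1, rule_format, OF that(2-4)]
    by - (elim conjE, assumption)+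
  have anti: "br a b = - br b a"
    if "is_E_bracket n g sC \<iota> \<rho> S1 B x sT tens br" "a \<in> ?E" "b \<in> ?E" for br a b
    by (rule is_E_bracketD(2)[OF that(1), rule_format, OF that(2,3)])
  have half: "br1 a b = br2 a b \<or> br1 b a = br2 b a" if "a \<in> G" "b \<in> G" for a b
    using that unfolding G_def
    by (elim UnE CollectE exE conjE)
      (simp_all only: is_E_bracketD(3-8)[OF 1, rule_format] is_E_bracketD(3-8)[OF 2, rule_format] simp_thms)
  have GG: "br1 a b = br2 a b" if "a \<in> G" "b \<in> G" for a b
  proof -
    have "a \<in> ?E" "b \<in> ?E" using that G by auto
    with half[OF that] anti[OF 1, of a b] anti[OF 2, of a b] show ?thesis by auto
  qed
  have split: "\<exists>a\<in>G. \<exists>b\<in>G. \<exists>c\<in>G. \<exists>d\<in>G. y = a + (b + (c + d))" if y_E: "y \<in> ?E" for y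
  proof -
    obtain A X t where y: "y = (A, X, t)" "A \<in> ?C2" "X \<in> sl2" using y_E by (auto simp: E_space_def)
    obtain \<phi> \<psi> where t: "\<phi> \<in> S1" "\<psi> \<in> S1" "t = tens \<phi> (axis 1 1) + tens \<psi> (axis 2 1)" using T by blast
    have "(A, 0, 0) \<in> G" "(0, X, 0) \<in> G" "(0, 0, tens \<phi> (axis 1 1)) \<in> G" "(0, 0, tens \<psi> (axis 2 1)) \<in> G"
      using y t by (auto simp: G_def)
    moreover have "y = (A, 0, 0) + ((0, X, 0) + ((0, 0, tens \<phi> (axis 1 1)) + (0, 0, tens \<psi> (axis 2 1))))"
      by (simp add: y t)
    ultimately show ?thesis by metis
  qed
  have GE: "br1 a z = br2 a z" if a: "a \<in> G" and "z \<in> ?E" for a z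
  proof -
    obtain b c d f where z: "b \<in> G" "c \<in> G" "d \<in> G" "f \<in> G" "z = b + (c + (d + f))"
      using split[OF \<open>z \<in> ?E\<close>] by blast
    then have "a \<in> ?E" "b \<in> ?E" "c \<in> ?E" "d \<in> ?E" "f \<in> ?E" using a G by auto
    then show ?thesis
      using GG[OF a z(1)] GG[OF a z(2)] GG[OF a z(3)] GG[OF a z(4)]
      by (simp add: z(5) add(2)[OF 1] add(2)[OF 2] E_add)
  qed
  obtain a b c d where y: "a \<in> G" "b \<in> G" "c \<in> G" "d \<in> G" "y = a + (b + (c + d))"
    using split[OF yz(1)] by blast
  then have "a \<in> ?E" "b \<in> ?E" "c \<in> ?E" "d \<in> ?E" using G by auto
  then show ?thesis
    using GE[OF y(1) yz(2)] GE[OF y(2) yz(2)] GE[OF y(3) yz(2)] GE[OF y(4) yz(2)] yz(2)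
    by (simp add: y(5) add(1)[OF 1] add(1)[OF 2] E_add)
qed

lemma (in doubled_half_spinors) is_E_bracket_bracket:
  assumes C2: "C2 n' sC \<iota> x = so" and L2: "\<And>\<phi> \<psi>. L2 n' g sC \<iota> \<rho> B x \<phi> \<psi> = L \<phi> \<psi>"
    and p: "\<And>\<phi> u. \<phi> \<in> S1 \<Longrightarrow> p (tens \<phi> u) = sS (u $ 1) \<phi>"
    and q: "\<And>\<phi> u. \<phi> \<in> S1 \<Longrightarrow> q (tens \<phi> u) = sS (u $ 2) \<phi>"
  shows "is_E_bracket n' g sC \<iota> \<rho> S1 B x sT tens bracket"
proof -
  have E: "E_space n' sC \<iota> x = e7" by (simp add: E_space_def e7_def C2)
  have C_T: "act A 0 (tens \<psi> u) = tens (\<rho> A \<psi>) u" if "A \<in> so" "\<psi> \<in> S1" for A \<psi> u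
    by (rule T_eqI) (simp_all add: p_act q_act that p q so_S1 rho.scale)
  have sl_T: "act 0 X (tens \<psi> u) = tens \<psi> (X *v u)" if "\<psi> \<in> S1" for X \<psi> u
    by (rule T_eqI) (simp_all add: p_act q_act that p q matrix_vector_mult_def sum_2 S.scale_left_distrib)
  have TT: "bracket (0, 0, tens \<phi> u) (0, 0, tens \<psi> w) =
      (sC (symp u w) (L \<phi> \<psi>), map_matrix ((*) (B \<phi> \<psi>)) (sigma u w), 0)"
    if "\<phi> \<in> S1" "\<psi> \<in> S1" for \<phi> \<psi> u w
  proof -
    have "Lam (tens \<phi> u) (tens \<psi> w) = sC (symp u w) (L \<phi> \<psi>)"
      using that by (simp add: Lam_def p q L_scale1 L_scale2 symp_def C.scale_left_diff_distrib mult.commute)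
    moreover have "Sig (tens \<phi> u) (tens \<psi> w) = map_matrix ((*) (B \<phi> \<psi>)) (sigma u w)"
      using that
      by (simp add: Sig_def p q B_simps sigma_def matrix_def symp_def mat2_eq_iff axis_def algebra_simps)
    ultimately show ?thesis by (simp add: bracket_def)
  qed
  show ?thesis
    unfolding is_E_bracket_def E C2 L2
  proof (intro conjI ballI allI)
    show "bilinear_on (E_scale sC sT) e7 bracket" by (rule bilinear_bracket)
    show "bracket y z = - bracket z y" for y z by (rule bracket_antisym)
    show "bracket (A, 0, 0) (A', 0, 0) = (A * A' - A' * A, 0, 0)" for A A'
      by (simp add: bracket_def mat2_eq_iff mult_2_component)
    show "bracket (0, X, 0) (0, Y, 0) = (0, X ** Y - Y ** X, 0)" for X Y
      by (simp add: bracket_def)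
    show "bracket (A, 0, 0) (0, X, 0) = 0" for A X
      by (simp add: bracket_def mat2_eq_iff mult_2_component zero_prod_def)
    show "bracket (A, 0, 0) (0, 0, tens \<psi> u) = (0, 0, tens (\<rho> A \<psi>) u)" if "A \<in> so" "\<psi> \<in> S1" for A \<psi> u
      by (simp add: bracket_even_odd C_T that)
    show "bracket (0, X, 0) (0, 0, tens \<psi> u) = (0, 0, tens \<psi> (X *v u))" if "\<psi> \<in> S1" for X \<psi> u
      by (simp add: bracket_even_odd sl_T that)
  qed (rule TT)
qed

section \<open>The Clifford algebra of a quadratic space\<close>

lemma field_char_numeral:
  assumes "CHAR('k::field) \<noteq> 2" "CHAR('k) \<noteq> 3"
  shows "(2::'k) \<noteq> 0" "(3::'k) \<noteq> 0"
proof -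
  have 1: "CHAR('k) \<noteq> 1" using of_nat_CHAR[where ?'a = 'k] by auto
  have *: "d = 1 \<or> d = 2" if "d dvd (2::nat)" for d
    using that dvd_imp_le[OF that] by (auto simp: le_Suc_eq numeral_2_eq_2)
  have **: "d = 1 \<or> d = 3" if "d dvd (3::nat)" for d
  proof -
    have "d \<le> 3" using that by (auto dest: dvd_imp_le)
    moreover have "d \<noteq> 0" "d \<noteq> 2" using that by (intro notI; simp)+
    ultimately show ?thesis by linarith
  qed
  show "(2::'k) \<noteq> 0"
    using of_nat_eq_0_iff_char_dvd[of 2, where ?'a = 'k] *[of "CHAR('k)"] assms 1 by auto
  show "(3::'k) \<noteq> 0"
    using of_nat_eq_0_iff_char_dvd[of 3, where ?'a = 'k] **[of "CHAR('k)"] assms 1 by auto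
qed

lemma clifford_relation:
  assumes "is_clifford_algebra sV g sC \<iota>"
  shows "\<iota> (v + w) = \<iota> v + \<iota> w" "\<iota> (sV a v) = sC a (\<iota> v)"
    "\<iota> v * \<iota> w + \<iota> w * \<iota> v = sC (2 * g v w) 1"
proof -
  have P: "presented_by sC (\<lambda>w. prod_list (map \<iota> w)) UNIV (clifford_relations sV g)"
    and "k_algebra sC" using assms by (auto simp: is_clifford_algebra_def)
  then have s: "vector_space sC" by (simp add: k_algebra_def)
  interpret vector_space sC by fact
  note simps = linear_extension_simps[OF s] linear_extension_single[OF s]
  have "Poly_Mapping.single ([] @ [v + w] @ []) 1 - Poly_Mapping.single ([] @ [v] @ []) 1
      - Poly_Mapping.single ([] @ [w] @ []) 1 \<in> clifford_relations sV g"
    unfolding clifford_relations_def by blast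
  from presented_by_relation[OF P this] show "\<iota> (v + w) = \<iota> v + \<iota> w"
    by (simp add: simps algebra_simps)
  have "Poly_Mapping.single ([] @ [sV a v] @ []) 1 - Poly_Mapping.single ([] @ [v] @ []) a
      \<in> clifford_relations sV g"
    unfolding clifford_relations_def by blast
  from presented_by_relation[OF P this] show "\<iota> (sV a v) = sC a (\<iota> v)"
    by (simp add: simps)
  have "Poly_Mapping.single ([] @ [v, w] @ []) 1 + Poly_Mapping.single ([] @ [w, v] @ []) 1
      - Poly_Mapping.single ([] @ []) (2 * g v w) \<in> clifford_relations sV g"
    unfolding clifford_relations_def by blast
  from presented_by_relation[OF P this] show "\<iota> v * \<iota> w + \<iota> w * \<iota> v = sC (2 * g v w) 1"
    by (simp add: simps)
qed

text \<open>Generators commuting with \<open>c\<close> suffice because words in vectors span the Clifford algebra.\<close>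

lemma clifford_central:
  assumes Cl: "is_clifford_algebra sV g sC \<iota>" and V: "vector_space sV"
    and span: "module.span sV X = UNIV" and comm: "\<And>v. v \<in> X \<Longrightarrow> \<iota> v * c = c * \<iota> v"
  shows "c * d = d * c"
proof -
  interpret V: vector_space sV by fact
  have alg: "k_algebra sC" using Cl by (simp add: is_clifford_algebra_def)
  then interpret vector_space sC by (simp add: k_algebra_def)
  have scale: "sC a x * y = sC a (x * y)" "x * sC a y = sC a (x * y)" for a x y
    using alg by (auto simp: k_algebra_def)
  have "\<iota> v * c = c * \<iota> v" for v
  proof -
    have "v \<in> V.span X" using span by simp
    then show ?thesis
    proof (induction v rule: V.span_induct_alt)
      case base
      have "\<iota> (sV 0 0) = 0" unfolding clifford_relation(2)[OF Cl] by simp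
      then show ?case by simp
    next
      case (step a v w)
      then show ?case using comm[of v]
        by (simp add: clifford_relation[OF Cl] distrib_left distrib_right scale)
    qed
  qed
  then have words: "prod_list (map \<iota> w) * c = c * prod_list (map \<iota> w)" for w
  proof (induction w)
    case (Cons v w)
    then show ?case by simp (metis mult.assoc)
  qed simp
  have P: "presented_by sC (\<lambda>w. prod_list (map \<iota> w)) UNIV (clifford_relations sV g)"
    using Cl by (simp add: is_clifford_algebra_def)
  have "d \<in> {d. c * d = d * c}"
    by (rule presented_by_induct[OF P])
      (use words in \<open>auto simp: subspace_def distrib_left distrib_right scale\<close>)
  then show ?thesis by simp
qed

theorem proposition8p2:
  fixes n :: nat
    and sV :: "'k::field \<Rightarrow> 'v::ab_group_add \<Rightarrow> 'v"
    and g :: "'v \<Rightarrow> 'v \<Rightarrow> 'k"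
    and sC :: "'k \<Rightarrow> 'c::ring_1 \<Rightarrow> 'c"
    and \<iota> :: "'v \<Rightarrow> 'c"
    and sS :: "'k \<Rightarrow> 's::ab_group_add \<Rightarrow> 's"
    and \<rho> :: "'c \<Rightarrow> 's \<Rightarrow> 's"
    and S1 S2 :: "'s set"
    and B :: "'s \<Rightarrow> 's \<Rightarrow> 'k"
    and x :: "nat \<Rightarrow> 'v"
    and sT :: "'k \<Rightarrow> 't::ab_group_add \<Rightarrow> 't"
    and tens :: "'s \<Rightarrow> 'k ^ 2 \<Rightarrow> 't"
  defines "E \<equiv> (E_space n sC \<iota> x :: ('c \<times> ('k ^ 2 ^ 2) \<times> 't) set)"
  assumes "CHAR('k) \<noteq> 2" and "CHAR('k) \<noteq> 3"
    and "n = 6"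
    and "hyperbolic_space n sV g"
    and "is_clifford_algebra sV g sC \<iota>"
    and "spinor_space n sC sS \<rho>"
    and "half_spinor_spaces n sC \<iota> sS \<rho> S1 S2"
    and "spinor_norm \<iota> sS \<rho> B" and "nondegenerate B"
    and "orthonormal_basis n sV g x"
    and "is_tensor_product sS S1 (*s) (UNIV :: ('k ^ 2) set) sT tens"
  shows "vector_space.dim (E_scale sC sT) E = 133 \<and>
    (\<exists>br. is_E_bracket n g sC \<iota> \<rho> S1 B x sT tens br \<and>
       (\<forall>br'. is_E_bracket n g sC \<iota> \<rho> S1 B x sT tens br' \<longrightarrow> (\<forall>y\<in>E. \<forall>z\<in>E. br' y z = br y z)) \<and>
       simple_lie_algebra (E_scale sC sT) E br)"
proof -
  note n6 = \<open>n = 6\<close> and V = \<open>hyperbolic_space n sV g\<close> and Cl = \<open>is_clifford_algebra sV g sC \<iota>\<close>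
    and S = \<open>spinor_space n sC sS \<rho>\<close> and half = \<open>half_spinor_spaces n sC \<iota> sS \<rho> S1 S2\<close>
    and norm = \<open>spinor_norm \<iota> sS \<rho> B\<close> and basis = \<open>orthonormal_basis n sV g x\<close>
    and T = \<open>is_tensor_product sS S1 (*s) UNIV sT tens\<close>
  define e where "e i = \<iota> (x i)" for i
  define eps where "eps i = g (x i) (x i)" for i
  have char: "(2::'k) \<noteq> 0" "(3::'k) \<noteq> 0" using field_char_numeral assms(2,3) by auto
  have sV: "vector_space sV" and g_sym: "\<And>v w. g v w = g w v"
    using V by (auto simp: hyperbolic_space_def)
  have alg: "k_algebra sC" using Cl by (simp add: is_clifford_algebra_def)
  then interpret C: vector_space sC by (simp add: k_algebra_def)
  interpret S: vector_space sS using S by (simp add: spinor_space_def)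
  interpret T: vector_space sT using T by (simp add: is_tensor_product_def presented_by_def)
  have sub: "S.subspace S1" "S.subspace S2" using half by (auto simp: half_spinor_spaces_def)
  have dims: "S.dim S1 = 32" using half n6 by (simp add: half_spinor_spaces_def)
  have gx: "g (x i) (x i) \<in> {1, - 1}" if "i < 2 * n" for i
    using basis that unfolding orthonormal_basis_def by metis
  have gxy: "g (x i) (x j) = 0" if "i < 2 * n" "j < 2 * n" "i \<noteq> j" for i j
    using basis that unfolding orthonormal_basis_def by metis
  have odd: "e i \<in> clifford_odd sC \<iota>" for i
    unfolding clifford_odd_def e_def by (rule C.span_base) (auto intro!: exI[of _ "[x i]"])
  obtain p q where pq: "Vector_Spaces.linear sT sS p" "Vector_Spaces.linear sT sS q"
    "\<And>t. p t \<in> S1" "\<And>t. q t \<in> S1"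
    "\<And>\<phi> u. \<phi> \<in> S1 \<Longrightarrow> p (tens \<phi> u) = sS (u $ 1) \<phi>"
    "\<And>\<phi> u. \<phi> \<in> S1 \<Longrightarrow> q (tens \<phi> u) = sS (u $ 2) \<phi>"
    "\<And>t. tens (p t) (axis 1 1) + tens (q t) (axis 2 1) = t"
    using tensor_plane[OF T S.vector_space_axioms sub(1)] by blast
  interpret p: Vector_Spaces.linear sT sS p by (rule pq)
  interpret q: Vector_Spaces.linear sT sS q by (rule pq)
  have e_sq: "e i * e i = sC (eps i) 1" for i
  proof -
    have "sC 2 (e i * e i) = sC 2 (sC (eps i) 1)"
      using clifford_relation(3)[OF Cl, of "x i" "x i"] C.scale_left_distrib[of 1 1 "e i * e i"]
      by (simp add: e_def eps_def)
    then show ?thesis using char(1) C.scale_cancel_left by blast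
  qed
  have e_anti: "e i * e j = - (e j * e i)" if "i < 2 * n" "j < 2 * n" "i \<noteq> j" for i j
    using clifford_relation(3)[OF Cl, of "x i" "x j"] gxy[OF that]
    by (simp add: e_def eq_neg_iff_add_eq_0)
  have central: "c * d = d * c" if comm: "\<And>i. i < 2 * n \<Longrightarrow> e i * c = c * e i" for c d
  proof (rule clifford_central[OF Cl sV])
    show "module.span sV (x ` {..<2 * n}) = UNIV" using basis by (simp add: orthonormal_basis_def)
    show "\<iota> v * c = c * \<iota> v" if "v \<in> x ` {..<2 * n}" for v
      using that comm by (auto simp: e_def)
  qed
  have S1_S2: "S1 \<inter> S2 = {0}" and S1_plus_S2: "{\<phi> + \<psi> | \<phi> \<psi>. \<phi> \<in> S1 \<and> \<psi> \<in> S2} = UNIV"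
    and odd_swap: "\<And>c. c \<in> clifford_odd sC \<iota> \<Longrightarrow> \<rho> c ` S1 \<subseteq> S2 \<and> \<rho> c ` S2 \<subseteq> S1"
    using half by (auto simp: half_spinor_spaces_def)
  interpret X: doubled_half_spinors n sC e eps sS \<rho> S1 S2 B sT p q
      "\<lambda>\<phi> \<psi>. tens \<phi> (axis 1 1) + tens \<psi> (axis 2 1)"
  proof unfold_locales
    show "k_algebra sC" by (rule alg)
    show "eps i * eps i = 1" if "i < 2 * n" for i using gx[OF that] by (auto simp: eps_def)
    show "e i * e i = sC (eps i) 1" for i by (rule e_sq)
    show "e i * e j = - (e j * e i)" if "i < 2 * n" "j < 2 * n" "i \<noteq> j" for i j using e_anti[OF that] .
    show "(2::'k) \<noteq> 0" "(3::'k) \<noteq> 0" by (rule char)+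
    show "c * d = d * c" if "\<And>i. i < 2 * n \<Longrightarrow> e i * c = c * e i" for c d using central[OF that] .
    show "S.dim UNIV = 2 ^ n" "algebra_iso_End sC sS \<rho>" using S by (auto simp: spinor_space_def)
    show "n = 6" by (rule n6)
    show "S.subspace S1" "S.subspace S2" by (rule sub)+
    show "S1 \<inter> S2 = {0}" by (rule S1_S2)
    show "\<exists>\<phi>1\<in>S1. \<exists>\<phi>2\<in>S2. \<phi> = \<phi>1 + \<phi>2" for \<phi> using S1_plus_S2 by blast
    show "\<rho> (e i) \<phi> \<in> S2" if "\<phi> \<in> S1" for i \<phi> using odd_swap[OF odd] that by blast
    show "\<rho> (e i) \<phi> \<in> S1" if "\<phi> \<in> S2" for i \<phi> using odd_swap[OF odd] that by blast
    show "S1 \<noteq> {0}" using dims S.dim_span_eq_card_independent[OF S.independent_empty] by auto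
    show "bilinear_form sS B" and "B (\<rho> (e i) \<phi>) \<psi> = B \<phi> (\<rho> (e i) \<psi>)" for i \<phi> \<psi>
      using norm by (auto simp: spinor_norm_def e_def)
    show "nondegenerate B" by fact
    show "p t \<in> S1" "q t \<in> S1" for t
      by (rule pq)+
    show "tens (p t) (axis 1 1) + tens (q t) (axis 2 1) = t" for t by (rule pq)
    show "p (tens \<phi> (axis 1 1) + tens \<psi> (axis 2 1)) = \<phi>" "q (tens \<phi> (axis 1 1) + tens \<psi> (axis 2 1)) = \<psi>"
      if "\<phi> \<in> S1" "\<psi> \<in> S1" for \<phi> \<psi>
      using that by (simp_all add: p.add q.add pq axis_def)
  qed
  have C2: "C2 n sC \<iota> x = X.so"
    by (simp add: C2_def X.pairs_def e_def)
  have L2: "L2 n g sC \<iota> \<rho> B x \<phi> \<psi> = X.L \<phi> \<psi>" for \<phi> \<psi>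
    by (simp add: L2_def X.L_def e_def eps_def)
  have E: "E = X.e7" by (simp add: E_def E_space_def X.e7_def C2)
  have br: "is_E_bracket n g sC \<iota> \<rho> S1 B x sT tens X.bracket"
    by (rule X.is_E_bracket_bracket[OF C2 L2 pq(5,6)])
  have "br' y z = X.bracket y z"
    if "is_E_bracket n g sC \<iota> \<rho> S1 B x sT tens br'" "y \<in> E" "z \<in> E" for br' y z
    using that(2,3) pq(3,4,7) unfolding E_def
    by (intro E_bracket_unique[OF that(1) br C.vector_space_axioms]) metis+
  with br X.simple_e7 X.dim_e7[OF dims] show ?thesis unfolding E by blast
qed

end
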